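(* Consider the successive point insertion algorithm described in the context, with step sizes given by the quasi-Armijo-Goldstein condition with parameters $\gamma\in(0,1)$, $\alpha\in(0,1/2]$, started at $\omega^1\in\operatorname{dom}_{M^+(\Omega_o)}\psi$ with $\#\operatorname{supp}\omega^1\le n(n+1)/2$, and where in each iteration $\omega^{k+1}$ is obtained by applying the support-point removal procedure (described in the context) to $\omega^{k+1/2}$. Then: (a) $(\omega^k)$ has at least one weak* accumulation point, every weak* accumulation point is an optimal solution of $(P_\beta)$, and for all $k\ge1$ $$ r_F(\omega^k)\le \frac{r_F(\omega^1)}{1+q(k-1)},\qquad q=\alpha\min\left\{\frac{2\gamma(1-\alpha)r_F(\omega^1)}{L_{\omega^1}(M_0+c_2)^2},\,1\right\}, $$ where $L_{\omega^1}>0$ is a Lipschitz constant of $\psi'$ on $E_{\omega^1}$ (with respect to $\|\cdot\|_{M(\Omega_o)}$ and $\|\cdot\|_{C(\Omega_o)}$), $M_0=F(\omega^1)/\beta$, and $c_2>0$ is a constant with $\|v^k\|_{M(\Omega_o)}\le c_2$ for all $k$ (such a constant exists). (b) $\#\operatorname{supp}\omega^k\le n(n+1)/2$ for all $k\in\mathbb N$, and consequently $\#\operatorname{supp}\bar\omega_\beta\le n(n+1)/2$ for every weak* accumulation point $\bar\omega_\beta$ of $(\omega^k)$.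
   Context: Setting. Let $n\in\mathbb N$, $\Omega\subset\mathbb R^d$ a bounded domain, $\Omega_o\subset\bar\Omega$ nonempty and closed (hence compact). $C(\Omega_o)$ carries the supremum norm; $M(\Omega_o)=C(\Omega_o)^*$ is the space of regular signed Borel measures with duality pairing $\langle\cdot,\cdot\rangle$ and total variation norm $\|\cdot\|_{M(\Omega_o)}$; $M^+(\Omega_o)$ is the cone of positive measures; $\#\operatorname{supp}\omega$ is the cardinality of the support. $\operatorname{Sym}(n)$, $\operatorname{NND}(n)$, $\operatorname{PD}(n)$ are the symmetric, symmetric positive semidefinite, and symmetric positive definite real $n\times n$ matrices; $\operatorname{Sym}(n)$ has inner product $\operatorname{Tr}(AB^\top)$ (Frobenius norm); $A\le_L B$ means $B-A\in\operatorname{NND}(n)$. Let $Q_{ad}\subset\mathbb R^n$ and let $S$ (the parameter-to-state map) be a map with values in $C(\Omega_o)$, continuously differentiable in a neighborhood of $Q_{ad}$; fix $\hat q\in Q_{ad}$ and let $\partial S[\hat q]=(\partial_1S[\hat q],\dots,\partial_nS[\hat q])^\top\in C(\Omega_o,\mathbb R^n)$ be its partial derivatives at $\hat q$. Define $\mathcal I:M(\Omega_o)\to\operatorname{Sym}(n)$ by $\mathcal I(\omega)_{kl}=\langle\partial_kS[\hat q]\,\partial_lS[\hat q],\omega\rangle$. Fix $\mathcal I_0\in\operatorname{NND}(n)$ and $\beta>0$. Let $\Psi:\operatorname{Sym}(n)\to\mathbb R\cup\{+\infty\}$ satisfy: (A1) $\{\Psi<\infty\}=\operatorname{PD}(n)$;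 (A2) $\Psi$ is continuously differentiable on $\operatorname{PD}(n)$; (A3) $\Psi\ge0$ on $\operatorname{NND}(n)$; (A4) $\Psi$ is lower semicontinuous and convex on $\operatorname{NND}(n)$; (A5) $N_1\le_LN_2\Rightarrow\Psi(N_1)\ge\Psi(N_2)$ for $N_1,N_2\in\operatorname{NND}(n)$. Assume moreover that $\Psi'$ is Lipschitz continuous on every compact subset of $\operatorname{PD}(n)$. Put $\psi(\omega)=\Psi(\mathcal I(\omega)+\mathcal I_0)$, $\operatorname{dom}_{M^+(\Omega_o)}\psi=\{\omega\in M^+(\Omega_o):\psi(\omega)<\infty\}$, $F(\omega)=\psi(\omega)+\beta\|\omega\|_{M(\Omega_o)}$. Problem $(P_\beta)$: minimize $F$ over $M^+(\Omega_o)$. For $\omega\in\operatorname{dom}_{M^+(\Omega_o)}\psi$ the derivative $\psi'(\omega)$ is identified with the continuous function $\psi'(\omega)(x)=\partial S[\hat q](x)^\top\Psi'(\mathcal I(\omega)+\mathcal I_0)\,\partial S[\hat q](x)$. Set $r_F(\omega)=F(\omega)-\min_{M^+(\Omega_o)}F$ and $E_{\omega^1}=\{\omega\in M^+(\Omega_o):F(\omega)\le F(\omega^1)\}$. Point insertion algorithm. Given $\omega^1$, set $M_0=F(\omega^1)/\beta>0$. Let $\varphi_{M_0}(t)=t$ for $0\le t\le M_0$ and $\varphi_{M_0}(t)=\frac1{2M_0}(t^2+M_0^2)$ for $t>M_0$; $F_{M_0}(\omega)=\psi(\omega)+\beta\varphi_{M_0}(\|\omega\|_{M(\Omega_o)})$;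 and $$\Phi(\omega)=\sup_{v\in M^+(\Omega_o)}\big[\langle\psi'(\omega),\omega-v\rangle+\beta\|\omega\|_{M(\Omega_o)}-\beta\varphi_{M_0}(\|v\|_{M(\Omega_o)})\big].$$ For $k=1,2,\dots$, as long as $\Phi(\omega^k)>0$ (if $\Phi(\omega^k)=0$ the algorithm stops and the sequence is continued constantly): choose $\hat x^k\in\arg\min_{x\in\Omega_o}\psi'(\omega^k)(x)$; set $v^k=\theta^k\delta_{\hat x^k}$ with $\theta^k=0$ if $\psi'(\omega^k)(\hat x^k)\ge-\beta$ and $\theta^k=-(M_0/\beta)\psi'(\omega^k)(\hat x^k)$ otherwise; set $s^k=\gamma^{n_k}$ with $n_k$ the smallest non-negative integer such that (quasi-Armijo-Goldstein condition) $$\alpha s^k\Phi(\omega^k)\le F_{M_0}(\omega^k)-F_{M_0}(\omega^k+s^k(v^k-\omega^k));$$ set $\omega^{k+1/2}=(1-s^k)\omega^k+s^kv^k$; then compute $\omega^{k+1}$ from $\omega^{k+1/2}$ by the removal procedure. Support-point removal procedure. Input: $\omega=\sum_{j=1}^m\lambda_j\delta_{x_j}$ with distinct $x_j$ and $\lambda_j>0$. While the family $\{\mathcal I(\delta_{x_j})\}_{j=1}^m$ is linearly dependent: find $0\ne\gamma\in\mathbb R^m$ with $\sum_j\gamma_j\mathcal I(\delta_{x_j})=0$ and $\sum_j\gamma_j\ge0$; set $\mu=\max_j\gamma_j/\lambda_j$ and $\lambda_{\mathrm{new},j}=\lambda_j-\gamma_j/\mu$; replace $\omega$ by $\omega_{\mathrm{new}}=\sum_{\{j:\lambda_{\mathrm{new},j}>0\}}\lambda_{\mathrm{new},j}\delta_{x_j}$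 (and relabel the points and weights). *)

theory Defs
  imports "HOL-Analysis.Analysis"
begin

text \<open>An element of \<open>C(X)\<close> is represented by any function on the ambient space that is
  continuous on \<open>X\<close>; its values outside \<open>X\<close> are never used.\<close>

definition sup_norm :: "'a set \<Rightarrow> ('a \<Rightarrow> real) \<Rightarrow> real" where
  "sup_norm X f = (SUP x\<in>X. \<bar>f x\<bar>)"

text \<open>\<open>S\<close> is continuously Frechet differentiable on \<open>U\<close> as a map into \<open>C(X)\<close> with the sup norm;
  the \<open>k\<close>-th partial derivative at \<open>q\<close> is the function \<open>\<lambda>x. DS q x $ k\<close> in \<open>C(X)\<close>.\<close>

definition C1_into_C ::
    "'a::topological_space set \<Rightarrow> (real^'n) set \<Rightarrow> (real^'n \<Rightarrow> 'a \<Rightarrow> real) \<Rightarrow> (real^'n \<Rightarrow> 'a \<Rightarrow> real^'n) \<Rightarrow> bool" where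
  "C1_into_C X U S DS \<longleftrightarrow>
     (\<forall>q\<in>U. continuous_on X (S q)) \<and>
     (\<forall>q\<in>U. continuous_on X (DS q)) \<and>
     (\<forall>q\<in>U. ((\<lambda>h. sup_norm X (\<lambda>x. S (q + h) x - S q x - (\<Sum>k\<in>UNIV. h $ k * DS q x $ k)) / norm h)
               \<longlongrightarrow> 0) (at 0)) \<and>
     (\<forall>q\<in>U. \<forall>k. ((\<lambda>p. sup_norm X (\<lambda>x. DS p x $ k - DS q x $ k)) \<longlongrightarrow> 0) (at q))"

abbreviation borel_on :: "'a::topological_space set \<Rightarrow> 'a set set" where
  "borel_on X \<equiv> sets (restrict_space borel X)"

text \<open>Finite signed Borel measures on \<open>X\<close>, as real set functions that are zero off the Borel subsets
  of \<open>X\<close> (so that equality is equality of measures). On a compact metric space every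
  such measure is regular, so regularity is not imposed separately.\<close>

definition signed_measures :: "'a::topological_space set \<Rightarrow> ('a set \<Rightarrow> real) set" where
  "signed_measures X = {\<omega>.
     (\<forall>A. A \<notin> borel_on X \<longrightarrow> \<omega> A = 0) \<and>
     (\<forall>A::nat \<Rightarrow> 'a set. range A \<subseteq> borel_on X \<and> disjoint_family A \<longrightarrow>
        (\<lambda>i. \<omega> (A i)) sums \<omega> (\<Union>i. A i))}"

definition positive_measures :: "'a::topological_space set \<Rightarrow> ('a set \<Rightarrow> real) set" where
  "positive_measures X = {\<omega> \<in> signed_measures X. \<forall>A. 0 \<le> \<omega> A}"

text \<open>The positive variation \<open>\<omega>\<^sup>+\<close> of the Jordan decomposition; the negative variation
  is the positive variation of \<open>- \<omega>\<close>.\<close>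

definition pos_variation :: "'a::topological_space set \<Rightarrow> ('a set \<Rightarrow> real) \<Rightarrow> 'a set \<Rightarrow> real" where
  "pos_variation X \<omega> A = (SUP B\<in>{B \<in> borel_on X. B \<subseteq> A}. \<omega> B)"

definition total_variation :: "'a::topological_space set \<Rightarrow> ('a set \<Rightarrow> real) \<Rightarrow> 'a set \<Rightarrow> real" where
  "total_variation X \<omega> A = pos_variation X \<omega> A + pos_variation X (\<lambda>B. - \<omega> B) A"

definition tv_norm :: "'a::topological_space set \<Rightarrow> ('a set \<Rightarrow> real) \<Rightarrow> real" where
  "tv_norm X \<omega> = total_variation X \<omega> X"

definition pos_part_measure :: "'a::topological_space set \<Rightarrow> ('a set \<Rightarrow> real) \<Rightarrow> 'a measure" where
  "pos_part_measure X \<omega> = measure_of X (borel_on X) (\<lambda>A. ennreal (pos_variation X \<omega> A))"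

definition pairing :: "'a::topological_space set \<Rightarrow> ('a \<Rightarrow> real) \<Rightarrow> ('a set \<Rightarrow> real) \<Rightarrow> real" where
  "pairing X f \<omega> =
     (\<integral>x. f x \<partial>pos_part_measure X \<omega>) - (\<integral>x. f x \<partial>pos_part_measure X (\<lambda>A. - \<omega> A))"

definition supp :: "'a::topological_space set \<Rightarrow> ('a set \<Rightarrow> real) \<Rightarrow> 'a set" where
  "supp X \<omega> = {x \<in> X. \<forall>U. open U \<and> x \<in> U \<longrightarrow> 0 < total_variation X \<omega> (U \<inter> X)}"

definition dirac :: "'a::topological_space set \<Rightarrow> 'a \<Rightarrow> 'a set \<Rightarrow> real" where
  "dirac X x A = (if A \<in> borel_on X \<and> x \<in> A then 1 else 0)"

definition atomic :: "'a::topological_space set \<Rightarrow> 'a set \<Rightarrow> ('a \<Rightarrow> real) \<Rightarrow> 'a set \<Rightarrow> real" where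
  "atomic X P w = (\<lambda>A. \<Sum>x\<in>P. w x * dirac X x A)"

text \<open>The coarsest topology on the space of signed measures that makes all pairings with
  functions in \<open>C(X)\<close> continuous.\<close>

definition weak_star :: "'a::topological_space set \<Rightarrow> ('a set \<Rightarrow> real) topology" where
  "weak_star X = topology_generated_by
     {{\<omega> \<in> signed_measures X. pairing X f \<omega> \<in> V} | f V. continuous_on X f \<and> open V}"

definition weak_star_accumulation_point ::
    "'a::topological_space set \<Rightarrow> (nat \<Rightarrow> 'a set \<Rightarrow> real) \<Rightarrow> ('a set \<Rightarrow> real) \<Rightarrow> bool" where
  "weak_star_accumulation_point X \<omega> \<nu> \<longleftrightarrow>
     \<nu> \<in> signed_measures X \<and>
     (\<forall>U. openin (weak_star X) U \<and> \<nu> \<in> U \<longrightarrow> (\<exists>\<^sub>\<infinity>k. \<omega> k \<in> U))"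

definition Sym :: "(real^'n^'n) set" where
  "Sym = {A. transpose A = A}"

definition NND :: "(real^'n^'n) set" where
  "NND = {A \<in> Sym. \<forall>x. 0 \<le> x \<bullet> (A *v x)}"

definition PD :: "(real^'n^'n) set" where
  "PD = {A \<in> Sym. \<forall>x. x \<noteq> 0 \<longrightarrow> 0 < x \<bullet> (A *v x)}"

definition loewner_le :: "real^'n^'n \<Rightarrow> real^'n^'n \<Rightarrow> bool" where
  "loewner_le A B \<longleftrightarrow> B - A \<in> NND"

text \<open>The assumptions on the design criterion \<open>\<Psi>\<close>, with gradient \<open>\<Psi>'\<close> on \<open>PD\<close>. The library inner
  product and norm on \<open>real^'n^'n\<close> are the Frobenius ones: \<open>A \<bullet> B\<close> is the trace of \<open>A ** transpose B\<close>.\<close>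

definition design_criterion ::
    "(real^'n^'n \<Rightarrow> ereal) \<Rightarrow> (real^'n^'n \<Rightarrow> real^'n^'n) \<Rightarrow> bool" where
  "design_criterion \<Psi> \<Psi>' \<longleftrightarrow>
     (\<forall>N\<in>Sym. \<Psi> N \<noteq> -\<infinity>) \<and>
     {N \<in> Sym. \<Psi> N < \<infinity>} = PD \<and>
     (\<forall>N\<in>PD. \<Psi>' N \<in> Sym \<and>
        ((\<lambda>A. real_of_ereal (\<Psi> A)) has_derivative (\<lambda>H. \<Psi>' N \<bullet> H)) (at N within PD)) \<and>
     continuous_on PD \<Psi>' \<and>
     (\<forall>N\<in>NND. 0 \<le> \<Psi> N) \<and>
     (\<forall>N\<in>NND. \<Psi> N \<le> Liminf (at N within NND) \<Psi>) \<and>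
     (\<forall>A\<in>NND. \<forall>B\<in>NND. \<forall>t\<in>{0..1}.
        \<Psi> ((1 - t) *\<^sub>R A + t *\<^sub>R B) \<le> ereal (1 - t) * \<Psi> A + ereal t * \<Psi> B) \<and>
     (\<forall>A\<in>NND. \<forall>B\<in>NND. loewner_le A B \<longrightarrow> \<Psi> B \<le> \<Psi> A) \<and>
     (\<forall>K. compact K \<and> K \<subseteq> PD \<longrightarrow> (\<exists>L. L-lipschitz_on K \<Psi>'))"

text \<open>Throughout, \<open>g x\<close> is the vector of the partial derivatives of \<open>S\<close> at the reference
  parameter, evaluated at \<open>x\<close>.\<close>

definition info_op :: "'a::topological_space set \<Rightarrow> ('a \<Rightarrow> real^'n) \<Rightarrow> ('a set \<Rightarrow> real) \<Rightarrow> real^'n^'n" where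
  "info_op X g \<omega> = (\<chi> k l. pairing X (\<lambda>x. g x $ k * g x $ l) \<omega>)"

definition psi ::
    "'a::topological_space set \<Rightarrow> ('a \<Rightarrow> real^'n) \<Rightarrow> real^'n^'n \<Rightarrow> (real^'n^'n \<Rightarrow> ereal) \<Rightarrow>
     ('a set \<Rightarrow> real) \<Rightarrow> ereal" where
  "psi X g I0 \<Psi> \<omega> = \<Psi> (info_op X g \<omega> + I0)"

definition dpsi ::
    "'a::topological_space set \<Rightarrow> ('a \<Rightarrow> real^'n) \<Rightarrow> real^'n^'n \<Rightarrow> (real^'n^'n \<Rightarrow> real^'n^'n) \<Rightarrow>
     ('a set \<Rightarrow> real) \<Rightarrow> 'a \<Rightarrow> real" where
  "dpsi X g I0 \<Psi>' \<omega> x = g x \<bullet> (\<Psi>' (info_op X g \<omega> + I0) *v g x)"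

definition dom_psi ::
    "'a::topological_space set \<Rightarrow> ('a \<Rightarrow> real^'n) \<Rightarrow> real^'n^'n \<Rightarrow> (real^'n^'n \<Rightarrow> ereal) \<Rightarrow>
     ('a set \<Rightarrow> real) set" where
  "dom_psi X g I0 \<Psi> = {\<omega> \<in> positive_measures X. psi X g I0 \<Psi> \<omega> < \<infinity>}"

definition objective ::
    "'a::topological_space set \<Rightarrow> ('a \<Rightarrow> real^'n) \<Rightarrow> real^'n^'n \<Rightarrow> (real^'n^'n \<Rightarrow> ereal) \<Rightarrow> real \<Rightarrow>
     ('a set \<Rightarrow> real) \<Rightarrow> ereal" where
  "objective X g I0 \<Psi> \<beta> \<omega> = psi X g I0 \<Psi> \<omega> + ereal (\<beta> * tv_norm X \<omega>)"

definition optimal_solution ::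
    "'a::topological_space set \<Rightarrow> ('a \<Rightarrow> real^'n) \<Rightarrow> real^'n^'n \<Rightarrow> (real^'n^'n \<Rightarrow> ereal) \<Rightarrow> real \<Rightarrow>
     ('a set \<Rightarrow> real) \<Rightarrow> bool" where
  "optimal_solution X g I0 \<Psi> \<beta> \<nu> \<longleftrightarrow>
     is_arg_min (objective X g I0 \<Psi> \<beta>) (\<lambda>\<omega>. \<omega> \<in> positive_measures X) \<nu>"

definition residual ::
    "'a::topological_space set \<Rightarrow> ('a \<Rightarrow> real^'n) \<Rightarrow> real^'n^'n \<Rightarrow> (real^'n^'n \<Rightarrow> ereal) \<Rightarrow> real \<Rightarrow>
     ('a set \<Rightarrow> real) \<Rightarrow> ereal" where
  "residual X g I0 \<Psi> \<beta> \<omega> =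
     objective X g I0 \<Psi> \<beta> \<omega> - (INF \<nu>\<in>positive_measures X. objective X g I0 \<Psi> \<beta> \<nu>)"

definition sublevel ::
    "'a::topological_space set \<Rightarrow> ('a \<Rightarrow> real^'n) \<Rightarrow> real^'n^'n \<Rightarrow> (real^'n^'n \<Rightarrow> ereal) \<Rightarrow> real \<Rightarrow>
     ('a set \<Rightarrow> real) \<Rightarrow> ('a set \<Rightarrow> real) set" where
  "sublevel X g I0 \<Psi> \<beta> \<omega>1 =
     {\<omega> \<in> positive_measures X. objective X g I0 \<Psi> \<beta> \<omega> \<le> objective X g I0 \<Psi> \<beta> \<omega>1}"

definition dpsi_lipschitz ::
    "'a::topological_space set \<Rightarrow> ('a \<Rightarrow> real^'n) \<Rightarrow> real^'n^'n \<Rightarrow> (real^'n^'n \<Rightarrow> real^'n^'n) \<Rightarrow>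
     ('a set \<Rightarrow> real) set \<Rightarrow> real \<Rightarrow> bool" where
  "dpsi_lipschitz X g I0 \<Psi>' E L \<longleftrightarrow>
     (\<forall>\<omega>\<in>E. \<forall>\<nu>\<in>E. sup_norm X (\<lambda>x. dpsi X g I0 \<Psi>' \<omega> x - dpsi X g I0 \<Psi>' \<nu> x)
        \<le> L * tv_norm X (\<lambda>A. \<omega> A - \<nu> A))"

definition phi :: "real \<Rightarrow> real \<Rightarrow> real" where
  "phi M0 t = (if t \<le> M0 then t else (t\<^sup>2 + M0\<^sup>2) / (2 * M0))"

definition objective_mod ::
    "'a::topological_space set \<Rightarrow> ('a \<Rightarrow> real^'n) \<Rightarrow> real^'n^'n \<Rightarrow> (real^'n^'n \<Rightarrow> ereal) \<Rightarrow> real \<Rightarrow>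
     real \<Rightarrow> ('a set \<Rightarrow> real) \<Rightarrow> ereal" where
  "objective_mod X g I0 \<Psi> \<beta> M0 \<omega> = psi X g I0 \<Psi> \<omega> + ereal (\<beta> * phi M0 (tv_norm X \<omega>))"

text \<open>The real supremum is over a set that is bounded above for \<open>M0 > 0\<close>, as \<open>phi M0\<close> grows quadratically.\<close>

definition primal_dual_gap ::
    "'a::topological_space set \<Rightarrow> ('a \<Rightarrow> real^'n) \<Rightarrow> real^'n^'n \<Rightarrow> (real^'n^'n \<Rightarrow> real^'n^'n) \<Rightarrow> real \<Rightarrow>
     real \<Rightarrow> ('a set \<Rightarrow> real) \<Rightarrow> real" where
  "primal_dual_gap X g I0 \<Psi>' \<beta> M0 \<omega> =
     (SUP v\<in>positive_measures X.
        pairing X (dpsi X g I0 \<Psi>' \<omega>) (\<lambda>A. \<omega> A - v A)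
        + \<beta> * tv_norm X \<omega> - \<beta> * phi M0 (tv_norm X v))"

text \<open>Linear dependence of the matrices \<open>info_op X g (dirac X x)\<close>, \<open>x \<in> P\<close>, as an indexed family:
  different points with equal matrices count as dependent.\<close>

definition dependent_family :: "'a::topological_space set \<Rightarrow> ('a \<Rightarrow> real^'n) \<Rightarrow> 'a set \<Rightarrow> bool" where
  "dependent_family X g P \<longleftrightarrow>
     (\<exists>c. (\<exists>x\<in>P. c x \<noteq> 0) \<and> (\<Sum>x\<in>P. c x *\<^sub>R info_op X g (dirac X x)) = 0)"

text \<open>\<open>removal X g \<omega> \<omega>'\<close>: a run of the support-point removal procedure can turn \<open>\<omega>\<close> into \<open>\<omega>'\<close>.
  The relation is nondeterministic, since the coefficients \<open>c\<close> in a removal step are arbitrary.\<close>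

inductive removal ::
    "'a::topological_space set \<Rightarrow> ('a \<Rightarrow> real^'n) \<Rightarrow> ('a set \<Rightarrow> real) \<Rightarrow> ('a set \<Rightarrow> real) \<Rightarrow> bool"
  for X g where
  stop: "removal X g (atomic X P w) (atomic X P w)"
    if "finite P" "P \<subseteq> X" "\<forall>x\<in>P. 0 < w x" "\<not> dependent_family X g P"
| step: "removal X g (atomic X P w) \<omega>'"
    if "finite P" "P \<subseteq> X" "\<forall>x\<in>P. 0 < w x" "dependent_family X g P"
       "\<exists>x\<in>P. c x \<noteq> 0"
       "(\<Sum>x\<in>P. c x *\<^sub>R info_op X g (dirac X x)) = 0"
       "0 \<le> (\<Sum>x\<in>P. c x)"
       "\<mu> = Max ((\<lambda>x. c x / w x) ` P)"
       "w_new = (\<lambda>x. w x - c x / \<mu>)"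
       "removal X g (atomic X {x \<in> P. 0 < w_new x} w_new) \<omega>'"

definition armijo ::
    "'a::topological_space set \<Rightarrow> ('a \<Rightarrow> real^'n) \<Rightarrow> real^'n^'n \<Rightarrow> (real^'n^'n \<Rightarrow> ereal) \<Rightarrow>
     (real^'n^'n \<Rightarrow> real^'n^'n) \<Rightarrow> real \<Rightarrow> real \<Rightarrow> real \<Rightarrow> ('a set \<Rightarrow> real) \<Rightarrow> ('a set \<Rightarrow> real) \<Rightarrow> real \<Rightarrow> bool" where
  "armijo X g I0 \<Psi> \<Psi>' \<beta> M0 \<alpha> \<omega> v s \<longleftrightarrow>
     ereal (\<alpha> * s * primal_dual_gap X g I0 \<Psi>' \<beta> M0 \<omega>)
       \<le> objective_mod X g I0 \<Psi> \<beta> M0 \<omega>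
         - objective_mod X g I0 \<Psi> \<beta> M0 (\<lambda>A. \<omega> A + s * (v A - \<omega> A))"

text \<open>One iteration from \<open>\<omega>\<close> to \<open>\<omega>'\<close>; \<open>m\<close> is the line search exponent.\<close>

definition insertion_step ::
    "'a::topological_space set \<Rightarrow> ('a \<Rightarrow> real^'n) \<Rightarrow> real^'n^'n \<Rightarrow> (real^'n^'n \<Rightarrow> ereal) \<Rightarrow>
     (real^'n^'n \<Rightarrow> real^'n^'n) \<Rightarrow> real \<Rightarrow> real \<Rightarrow> real \<Rightarrow> real \<Rightarrow>
     ('a set \<Rightarrow> real) \<Rightarrow> 'a \<Rightarrow> ('a set \<Rightarrow> real) \<Rightarrow> nat \<Rightarrow> ('a set \<Rightarrow> real) \<Rightarrow> bool" where
  "insertion_step X g I0 \<Psi> \<Psi>' \<beta> M0 \<alpha> \<gamma> \<omega> x v m \<omega>' \<longleftrightarrow>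
     is_arg_min (dpsi X g I0 \<Psi>' \<omega>) (\<lambda>y. y \<in> X) x \<and>
     v = (\<lambda>A. (if dpsi X g I0 \<Psi>' \<omega> x \<ge> - \<beta> then 0 else - (M0 / \<beta>) * dpsi X g I0 \<Psi>' \<omega> x) * dirac X x A) \<and>
     armijo X g I0 \<Psi> \<Psi>' \<beta> M0 \<alpha> \<omega> v (\<gamma> ^ m) \<and>
     (\<forall>j<m. \<not> armijo X g I0 \<Psi> \<Psi>' \<beta> M0 \<alpha> \<omega> v (\<gamma> ^ j)) \<and>
     removal X g (\<lambda>A. (1 - \<gamma> ^ m) * \<omega> A + \<gamma> ^ m * v A) \<omega>'"

text \<open>Iterates are indexed from \<open>1\<close>; \<open>x k\<close>, \<open>v k\<close> and \<open>m k\<close> are constrained only as long as the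
  algorithm has not stopped.\<close>

definition point_insertion ::
    "'a::topological_space set \<Rightarrow> ('a \<Rightarrow> real^'n) \<Rightarrow> real^'n^'n \<Rightarrow> (real^'n^'n \<Rightarrow> ereal) \<Rightarrow>
     (real^'n^'n \<Rightarrow> real^'n^'n) \<Rightarrow> real \<Rightarrow> real \<Rightarrow> real \<Rightarrow> real \<Rightarrow>
     (nat \<Rightarrow> 'a set \<Rightarrow> real) \<Rightarrow> (nat \<Rightarrow> 'a) \<Rightarrow> (nat \<Rightarrow> 'a set \<Rightarrow> real) \<Rightarrow> (nat \<Rightarrow> nat) \<Rightarrow> bool" where
  "point_insertion X g I0 \<Psi> \<Psi>' \<beta> M0 \<alpha> \<gamma> \<omega> x v m \<longleftrightarrow>
     (\<forall>k\<ge>1.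
        (primal_dual_gap X g I0 \<Psi>' \<beta> M0 (\<omega> k) > 0 \<longrightarrow>
           insertion_step X g I0 \<Psi> \<Psi>' \<beta> M0 \<alpha> \<gamma> (\<omega> k) (x k) (v k) (m k) (\<omega> (k + 1))) \<and>
        (primal_dual_gap X g I0 \<Psi>' \<beta> M0 (\<omega> k) = 0 \<longrightarrow> \<omega> (k + 1) = \<omega> k))"

definition inserted_bounded ::
    "'a::topological_space set \<Rightarrow> ('a \<Rightarrow> real^'n) \<Rightarrow> real^'n^'n \<Rightarrow> (real^'n^'n \<Rightarrow> real^'n^'n) \<Rightarrow> real \<Rightarrow>
     real \<Rightarrow> (nat \<Rightarrow> 'a set \<Rightarrow> real) \<Rightarrow> (nat \<Rightarrow> 'a set \<Rightarrow> real) \<Rightarrow> real \<Rightarrow> bool" where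
  "inserted_bounded X g I0 \<Psi>' \<beta> M0 \<omega> v c \<longleftrightarrow>
     (\<forall>k\<ge>1. primal_dual_gap X g I0 \<Psi>' \<beta> M0 (\<omega> k) > 0 \<longrightarrow> tv_norm X (v k) \<le> c)"

end

theory Submission
  imports Defs
begin

text \<open>The objective depends on a positive measure only through its information matrix and its mass, and both are
  pairings with finitely many continuous functions. Everything reduces to finite-dimensional convex analysis of
  \<open>\<Psi>\<close> and to elementary facts about the pairing.

  \<^bold>\<open>Decrease.\<close> The gap is attained at the inserted measure (\<open>gap_attained\<close>), and by convexity
  it bounds the residual (\<open>F_minus_gap_le\<close>). Along the segment from the iterate to the inserted measure the objective
  starts with slope at most minus the gap; on the part of the segment that stays in the initial sublevel set the derivative is
  Lipschitz, so that a quadratic model bounds the objective, and convexity keeps the segment in the sublevel set as long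
  as the model predicts decrease (\<open>sufficient_decrease\<close>). Hence the line search stops at a step at least as large as
  the smaller of \<open>1\<close> and a multiple of the gap (\<open>armijo_holds\<close>, \<open>step_size_bound\<close>). Removing support points keeps the
  information matrix and does not raise the mass (\<open>removal_invariants\<close>). Together the residuals satisfy
  \<open>r (k + 1) \<le> r k - \<alpha> min 1 (\<kappa> r k) r k\<close>, and \<open>sublinear_rate\<close> turns this into the
  claimed rate.

  \<^bold>\<open>Number of atoms.\<close> Removal ends with linearly independent matrices in the space of symmetric matrices, whose dimension
  is \<open>n (n + 1) / 2\<close> (\<open>independent_family_card_le\<close>).

  \<^bold>\<open>Accumulation points.\<close> The measures with at most that many atoms and bounded mass form the continuous image of
  a product of compact sets, so they are weak* compact (\<open>compactin_few_atoms\<close>); since the weak* topology is Hausdorff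
  (\<open>Hausdorff_weak_star\<close>), they are also closed. So accumulation points exist and have few atoms themselves, and lower
  semicontinuity of \<open>\<Psi>\<close> makes them optimal (\<open>accumulation_point_optimal\<close>). The constants exist because the
  information matrices of a sublevel set lie in a compact subset of the positive definite matrices
  (\<open>sublevel_info_compact\<close>).

  The pairing is defined by the Jordan decomposition, so its linearity in the measure has to be
  established first, for arbitrary signed measures.\<close>

section \<open>Jordan decomposition of signed measures\<close>

lemma sigma_algebra_borel_on: "sigma_algebra X (borel_on X)"
  using sets.sigma_algebra_axioms[of "restrict_space borel X"] by (simp add: space_restrict_space)

lemma borel_on_subset: "A \<in> borel_on X \<Longrightarrow> A \<subseteq> X"
  using sets.sets_into_space[of A "restrict_space borel X"] by (simp add: space_restrict_space)

lemma whole_in_borel_on [simp]: "X \<in> borel_on X"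
  using sets.top[of "restrict_space borel X"] by (simp add: space_restrict_space)

lemma signed_measure_outside: "\<nu> \<in> signed_measures X \<Longrightarrow> A \<notin> borel_on X \<Longrightarrow> \<nu> A = 0"
  by (simp add: signed_measures_def)

lemma signed_measure_sums:
  "\<nu> \<in> signed_measures X \<Longrightarrow> range A \<subseteq> borel_on X \<Longrightarrow> disjoint_family A
    \<Longrightarrow> (\<lambda>i::nat. \<nu> (A i)) sums \<nu> (\<Union>i. A i)"
  by (simp add: signed_measures_def)

lemma signed_measure_empty [simp]:
  assumes "\<nu> \<in> signed_measures X" shows "\<nu> {} = 0"
proof -
  have "(\<lambda>i::nat. \<nu> {}) sums \<nu> (\<Union>i::nat. {})"
    by (rule signed_measure_sums[OF assms]) (auto simp: disjoint_family_on_def)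
  then have "summable (\<lambda>i::nat. \<nu> {})" by (rule sums_summable)
  then show ?thesis by (simp add: summable_const_iff)
qed

lemma signed_measure_Un:
  assumes "\<nu> \<in> signed_measures X" "A \<in> borel_on X" "B \<in> borel_on X" "A \<inter> B = {}"
  shows "\<nu> (A \<union> B) = \<nu> A + \<nu> B"
proof -
  have "(\<lambda>i::nat. \<nu> (binaryset A B i)) sums \<nu> (\<Union>i. binaryset A B i)"
    using assms
    by (intro signed_measure_sums) (auto simp: binaryset_def disjoint_family_on_def)
  moreover have "(\<lambda>i::nat. \<nu> (binaryset A B i)) sums (\<nu> A + \<nu> B)"
    using binaryset_sums[of \<nu> A B] assms by simp
  ultimately show ?thesis
    by (simp add: UN_binaryset_eq sums_unique2)
qed

lemma signed_measure_Diff: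
  assumes "\<nu> \<in> signed_measures X" "A \<in> borel_on X" "B \<in> borel_on X" "B \<subseteq> A"
  shows "\<nu> (A - B) = \<nu> A - \<nu> B"
  using signed_measure_Un[OF assms(1), of "A - B" B] assms
  by (simp add: Un_absorb2 sets.Diff Int_commute[of _ B])

lemma signed_measures_lincomb:
  assumes "\<mu> \<in> signed_measures X" "\<nu> \<in> signed_measures X"
  shows "(\<lambda>A. a * \<mu> A + b * \<nu> A) \<in> signed_measures X"
  using assms unfolding signed_measures_def by (auto intro!: sums_add sums_mult)

lemma signed_measures_zero: "(\<lambda>A. 0) \<in> signed_measures X"
  by (simp add: signed_measures_def)

lemma signed_measures_uminus:
  "\<nu> \<in> signed_measures X \<Longrightarrow> (\<lambda>A. - \<nu> A) \<in> signed_measures X"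
  using signed_measures_lincomb[of \<nu> X \<nu> "-1" 0] by simp

lemma signed_measures_diff:
  "\<mu> \<in> signed_measures X \<Longrightarrow> \<nu> \<in> signed_measures X \<Longrightarrow> (\<lambda>A. \<mu> A - \<nu> A) \<in> signed_measures X"
  using signed_measures_lincomb[of \<mu> X \<nu> 1 "-1"] by simp

text \<open>If the values on the subsets of \<open>A\<close> are unbounded, then \<open>A\<close> splits into a part of
  value at least \<open>1\<close> in modulus and a part on which the values are again unbounded. Iterating would
  give disjoint sets whose values do not tend to \<open>0\<close>, against countable additivity.\<close>

lemma signed_measure_bounded:
  assumes \<nu>: "\<nu> \<in> signed_measures X"
  shows "\<exists>C. \<forall>A\<in>borel_on X. \<bar>\<nu> A\<bar> \<le> C"
proof (rule ccontr)
  define unb where "unb A \<longleftrightarrow> A \<in> borel_on X \<and> (\<forall>C. \<exists>B\<in>borel_on X. B \<subseteq> A \<and> C < \<bar>\<nu> B\<bar>)" for A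
  assume "\<not> ?thesis"
  then have unbX: "unb X"
    unfolding unb_def by (auto simp: not_le) (meson borel_on_subset)
  have split: "\<exists>B. unb B \<and> B \<subseteq> A \<and> 1 \<le> \<bar>\<nu> (A - B)\<bar>" if A: "unb A" for A
  proof -
    obtain B where B: "B \<in> borel_on X" "B \<subseteq> A" "\<bar>\<nu> A\<bar> + 1 < \<bar>\<nu> B\<bar>"
      using A unfolding unb_def by blast
    have Ab: "A \<in> borel_on X" using A by (simp add: unb_def)
    have D: "\<nu> (A - B) = \<nu> A - \<nu> B"
      by (rule signed_measure_Diff[OF \<nu> Ab B(1,2)])
    have "unb B \<or> unb (A - B)"
    proof (rule ccontr)
      assume "\<not> (unb B \<or> unb (A - B))"
      then have nB: "\<not> unb B" and nAB: "\<not> unb (A - B)" by simp_all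
      from nB obtain C1 where C1: "\<And>E. E \<in> borel_on X \<Longrightarrow> E \<subseteq> B \<Longrightarrow> \<bar>\<nu> E\<bar> \<le> C1"
        using B(1) unfolding unb_def by (meson not_less)
      have "A - B \<in> borel_on X" using Ab B(1) by (rule sets.Diff)
      with nAB obtain C2 where C2: "\<And>E. E \<in> borel_on X \<Longrightarrow> E \<subseteq> A - B \<Longrightarrow> \<bar>\<nu> E\<bar> \<le> C2"
        unfolding unb_def by (meson not_less)
      obtain E where E: "E \<in> borel_on X" "E \<subseteq> A" "C1 + C2 < \<bar>\<nu> E\<bar>"
        using A unfolding unb_def by blast
      have "\<nu> (E \<inter> B \<union> (E - B)) = \<nu> (E \<inter> B) + \<nu> (E - B)"
        using E B by (intro signed_measure_Un[OF \<nu>]) auto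
      moreover have "E \<inter> B \<union> (E - B) = E" by blast
      ultimately have "\<bar>\<nu> E\<bar> \<le> \<bar>\<nu> (E \<inter> B)\<bar> + \<bar>\<nu> (E - B)\<bar>" by simp
      also have "\<dots> \<le> C1 + C2"
        using E B by (intro add_mono C1 C2) auto
      finally show False using E(3) by simp
    qed
    then show ?thesis
    proof
      assume "unb B" then show ?thesis using B D by (intro exI[of _ B]) auto
    next
      assume "unb (A - B)"
      moreover have "A - (A - B) = B" using B(2) by blast
      ultimately show ?thesis using B(3) by (intro exI[of _ "A - B"]) auto
    qed
  qed
  define R where "R = rec_nat X (\<lambda>_ A. SOME B. unb B \<and> B \<subseteq> A \<and> 1 \<le> \<bar>\<nu> (A - B)\<bar>)"
  have R: "unb (R n) \<and> R (Suc n) \<subseteq> R n \<and> 1 \<le> \<bar>\<nu> (R n - R (Suc n))\<bar>" for n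
  proof (induction n)
    case 0
    show ?case using someI_ex[OF split[OF unbX]] unbX by (simp add: R_def)
  next
    case (Suc n)
    have "unb (R (Suc n))" using someI_ex[OF split, of "R n"] Suc by (simp add: R_def)
    then show ?case using someI_ex[OF split, of "R (Suc n)"] by (simp add: R_def)
  qed
  define D where "D n = R n - R (Suc n)" for n
  have anti: "R n \<subseteq> R m" if "m \<le> n" for m n
    using lift_Suc_antimono_le[of R, OF _ that] R by simp
  have "disjoint_family D"
  proof (unfold disjoint_family_on_def, intro ballI impI)
    fix m n :: nat assume "m \<noteq> n"
    then consider "Suc m \<le> n" | "Suc n \<le> m" by linarith
    then show "D m \<inter> D n = {}"
      using anti[of "Suc m" n] anti[of "Suc n" m] unfolding D_def by cases blast+
  qed
  moreover have "range D \<subseteq> borel_on X"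
    using R unfolding D_def unb_def by auto
  ultimately have "(\<lambda>n. \<nu> (D n)) \<longlonglongrightarrow> 0"
    using signed_measure_sums[OF \<nu>] sums_summable summable_LIMSEQ_zero by blast
  then have "eventually (\<lambda>n. \<bar>\<nu> (D n)\<bar> < 1) sequentially"
    using order_tendstoD(2)[OF tendsto_rabs_zero, of _ _ 1] by simp
  then obtain n where "\<bar>\<nu> (D n)\<bar> < 1" by (auto simp: eventually_sequentially)
  then show False using R[of n] by (simp add: D_def)
qed

lemma pos_variation_bdd:
  assumes "\<nu> \<in> signed_measures X"
  shows "bdd_above (\<nu> ` {B \<in> borel_on X. B \<subseteq> A})"
proof -
  obtain C where "\<And>B. B \<in> borel_on X \<Longrightarrow> \<bar>\<nu> B\<bar> \<le> C"
    using signed_measure_bounded[OF assms] by blast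
  then show ?thesis by (intro bdd_aboveI2[of _ _ C]) (auto dest!: abs_le_D1)
qed

lemma pos_variation_upper:
  assumes "\<nu> \<in> signed_measures X" "B \<in> borel_on X" "B \<subseteq> A"
  shows "\<nu> B \<le> pos_variation X \<nu> A"
  unfolding pos_variation_def
  using assms pos_variation_bdd[OF assms(1), of A] by (auto intro: cSUP_upper)

lemma pos_variation_least:
  assumes "\<And>B. B \<in> borel_on X \<Longrightarrow> B \<subseteq> A \<Longrightarrow> \<nu> B \<le> c"
  shows "pos_variation X \<nu> A \<le> c"
  unfolding pos_variation_def using assms sets.empty_sets by (intro cSUP_least) blast+

lemma pos_variation_nonneg: "\<nu> \<in> signed_measures X \<Longrightarrow> 0 \<le> pos_variation X \<nu> A"
  using pos_variation_upper[of \<nu> X "{}" A] by simp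

lemma pos_variation_empty [simp]: "\<nu> \<in> signed_measures X \<Longrightarrow> pos_variation X \<nu> {} = 0"
  by (rule order_antisym[OF pos_variation_least pos_variation_nonneg]) simp_all

lemma pos_variation_mono:
  "\<nu> \<in> signed_measures X \<Longrightarrow> A \<subseteq> B \<Longrightarrow> pos_variation X \<nu> A \<le> pos_variation X \<nu> B"
  by (rule pos_variation_least) (auto intro: pos_variation_upper)

lemma pos_variation_superadditive:
  assumes \<nu>: "\<nu> \<in> signed_measures X" and "A \<inter> A' = {}"
  shows "pos_variation X \<nu> A + pos_variation X \<nu> A' \<le> pos_variation X \<nu> (A \<union> A')"
proof -
  have "pos_variation X \<nu> A \<le> pos_variation X \<nu> (A \<union> A') - pos_variation X \<nu> A'"
  proof (rule pos_variation_least)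
    fix B assume B: "B \<in> borel_on X" "B \<subseteq> A"
    have "pos_variation X \<nu> A' \<le> pos_variation X \<nu> (A \<union> A') - \<nu> B"
    proof (rule pos_variation_least)
      fix B' assume B': "B' \<in> borel_on X" "B' \<subseteq> A'"
      have "\<nu> (B \<union> B') = \<nu> B + \<nu> B'"
        using B B' assms(2) by (intro signed_measure_Un[OF \<nu>]) auto
      moreover have "\<nu> (B \<union> B') \<le> pos_variation X \<nu> (A \<union> A')"
        using B B' by (intro pos_variation_upper[OF \<nu>]) auto
      ultimately show "\<nu> B' \<le> pos_variation X \<nu> (A \<union> A') - \<nu> B" by simp
    qed
    then show "\<nu> B \<le> pos_variation X \<nu> (A \<union> A') - pos_variation X \<nu> A'" by simp
  qed
  then show ?thesis by simp
qed

text \<open>Cutting a competitor \<open>B\<close> along the pieces bounds the variation of the union by the series;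
  superadditivity bounds the partial sums the other way and gives convergence.\<close>

lemma pos_variation_sums:
  fixes A :: "nat \<Rightarrow> 'a::topological_space set"
  assumes \<nu>: "\<nu> \<in> signed_measures X" and A: "range A \<subseteq> borel_on X" "disjoint_family A"
  shows "(\<lambda>i. pos_variation X \<nu> (A i)) sums pos_variation X \<nu> (\<Union>i. A i)"
proof -
  let ?V = "pos_variation X \<nu>"
  have partial: "(\<Sum>i<n. ?V (A i)) \<le> ?V (\<Union>i<n. A i)" for n
  proof (induction n)
    case (Suc n)
    have "(\<Union>i<n. A i) \<inter> A n = {}"
    proof -
      have "A i \<inter> A n = {}" if "i < n" for i
        using A(2) that unfolding disjoint_family_on_def by (metis UNIV_I less_irrefl)
      then show ?thesis by blast
    qed
    from pos_variation_superadditive[OF \<nu> this]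
    have "?V (\<Union>i<n. A i) + ?V (A n) \<le> ?V (\<Union>i<Suc n. A i)"
      by (simp add: lessThan_Suc Un_commute)
    with Suc show ?case by simp
  qed (use \<nu> in simp)
  have bound: "(\<Sum>i<n. ?V (A i)) \<le> ?V (\<Union>i. A i)" for n
    by (rule order_trans[OF partial pos_variation_mono[OF \<nu>]]) blast
  have sm: "summable (\<lambda>i. ?V (A i))"
    by (rule summableI_nonneg_bounded[OF pos_variation_nonneg[OF \<nu>] bound])
  have "?V (\<Union>i. A i) \<le> (\<Sum>i. ?V (A i))"
  proof (rule pos_variation_least)
    fix B assume B: "B \<in> borel_on X" "B \<subseteq> (\<Union>i. A i)"
    have s: "(\<lambda>i. \<nu> (B \<inter> A i)) sums \<nu> (\<Union>i. B \<inter> A i)"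
      using B(1) A by (intro signed_measure_sums[OF \<nu>]) (auto simp: disjoint_family_on_def)
    have "(\<Union>i. B \<inter> A i) = B" using B(2) by blast
    with s have s: "(\<lambda>i. \<nu> (B \<inter> A i)) sums \<nu> B" by simp
    have "\<nu> B = (\<Sum>i. \<nu> (B \<inter> A i))" using s by (simp add: sums_iff)
    also have "\<dots> \<le> (\<Sum>i. ?V (A i))"
    proof (rule suminf_le[OF _ sums_summable[OF s] sm])
      show "\<nu> (B \<inter> A i) \<le> ?V (A i)" for i
        using B(1) A(1) by (intro pos_variation_upper[OF \<nu>]) auto
    qed
    finally show "\<nu> B \<le> (\<Sum>i. ?V (A i))" .
  qed
  moreover have "(\<Sum>i. ?V (A i)) \<le> ?V (\<Union>i. A i)"
    by (rule suminf_le_const[OF sm bound])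
  ultimately show ?thesis using sm by (simp add: sums_iff)
qed

text \<open>Complements in \<open>A\<close> exchange the competitors for \<open>\<nu>\<close> with those for \<open>- \<nu>\<close>, so the
  suprema differ by \<open>\<nu> A\<close>.\<close>

lemma pos_variation_diff:
  assumes \<nu>: "\<nu> \<in> signed_measures X" and A: "A \<in> borel_on X"
  shows "pos_variation X \<nu> A - pos_variation X (\<lambda>B. - \<nu> B) A = \<nu> A"
proof -
  have aux: "pos_variation X \<mu> A \<le> \<mu> A + pos_variation X (\<lambda>B. - \<mu> B) A"
    if \<mu>: "\<mu> \<in> signed_measures X" for \<mu>
  proof (rule pos_variation_least)
    fix B assume B: "B \<in> borel_on X" "B \<subseteq> A"
    have "A - B \<in> borel_on X" using A B(1) by (rule sets.Diff)
    from pos_variation_upper[OF signed_measures_uminus[OF \<mu>] this Diff_subset]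
    have "- \<mu> (A - B) \<le> pos_variation X (\<lambda>B. - \<mu> B) A" .
    then show "\<mu> B \<le> \<mu> A + pos_variation X (\<lambda>B. - \<mu> B) A"
      unfolding signed_measure_Diff[OF \<mu> A B] by linarith
  qed
  from aux[OF \<nu>] aux[OF signed_measures_uminus[OF \<nu>]] show ?thesis by simp
qed

lemma space_pos_part [simp]: "space (pos_part_measure X \<nu>) = X"
  unfolding pos_part_measure_def by (intro space_measure_of) (auto dest: borel_on_subset)

lemma sets_pos_part [simp]: "sets (pos_part_measure X \<nu>) = borel_on X"
  unfolding pos_part_measure_def using sigma_algebra.sets_measure_of_eq[OF sigma_algebra_borel_on] by blast

lemma emeasure_pos_part:
  assumes \<nu>: "\<nu> \<in> signed_measures X" and A: "A \<in> borel_on X"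
  shows "emeasure (pos_part_measure X \<nu>) A = ennreal (pos_variation X \<nu> A)"
  unfolding pos_part_measure_def
proof (rule emeasure_measure_of_sigma[OF sigma_algebra_borel_on _ _ A])
  show "positive (borel_on X) (\<lambda>A. ennreal (pos_variation X \<nu> A))"
    using \<nu> by (simp add: positive_def)
  show "countably_additive (borel_on X) (\<lambda>A. ennreal (pos_variation X \<nu> A))"
  proof (unfold countably_additive_def, intro allI impI)
    fix A :: "nat \<Rightarrow> 'a set" assume A: "range A \<subseteq> borel_on X" "disjoint_family A"
    have s: "(\<lambda>i. pos_variation X \<nu> (A i)) sums pos_variation X \<nu> (\<Union>i. A i)"
      by (rule pos_variation_sums[OF \<nu> A])
    show "(\<Sum>i. ennreal (pos_variation X \<nu> (A i))) = ennreal (pos_variation X \<nu> (\<Union>i. A i))"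
      using suminf_ennreal2[OF pos_variation_nonneg[OF \<nu>] sums_summable[OF s]] sums_unique[OF s]
      by simp
  qed
qed

lemma measure_pos_part:
  "\<nu> \<in> signed_measures X \<Longrightarrow> A \<in> borel_on X
    \<Longrightarrow> measure (pos_part_measure X \<nu>) A = pos_variation X \<nu> A"
  by (simp add: measure_def emeasure_pos_part pos_variation_nonneg)

lemma finite_measure_pos_part: "\<nu> \<in> signed_measures X \<Longrightarrow> finite_measure (pos_part_measure X \<nu>)"
  by (rule finite_measureI) (simp add: emeasure_pos_part)

lemma positive_measures_signed: "\<nu> \<in> positive_measures X \<Longrightarrow> \<nu> \<in> signed_measures X"
  by (simp add: positive_measures_def)

lemma positive_measures_nonneg: "\<nu> \<in> positive_measures X \<Longrightarrow> 0 \<le> \<nu> A"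
  by (simp add: positive_measures_def)

lemma pos_variation_positive:
  assumes \<nu>: "\<nu> \<in> positive_measures X" and A: "A \<in> borel_on X"
  shows "pos_variation X \<nu> A = \<nu> A" "pos_variation X (\<lambda>B. - \<nu> B) A = 0"
proof -
  have s: "\<nu> \<in> signed_measures X" using \<nu> by (rule positive_measures_signed)
  have "pos_variation X (\<lambda>B. - \<nu> B) A \<le> 0"
    by (rule pos_variation_least) (simp add: positive_measures_nonneg[OF \<nu>])
  then show "pos_variation X (\<lambda>B. - \<nu> B) A = 0"
    using pos_variation_nonneg[OF signed_measures_uminus[OF s]] by (metis order_antisym)
  with pos_variation_diff[OF s A] show "pos_variation X \<nu> A = \<nu> A" by simp
qed

lemma tv_norm_positive: "\<nu> \<in> positive_measures X \<Longrightarrow> tv_norm X \<nu> = \<nu> X"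
  by (simp add: tv_norm_def total_variation_def pos_variation_positive)

lemma tv_norm_nonneg: "\<nu> \<in> signed_measures X \<Longrightarrow> 0 \<le> tv_norm X \<nu>"
  by (simp add: tv_norm_def total_variation_def pos_variation_nonneg signed_measures_uminus)

lemma positive_measures_lincomb:
  "\<mu> \<in> positive_measures X \<Longrightarrow> \<nu> \<in> positive_measures X \<Longrightarrow> 0 \<le> a \<Longrightarrow> 0 \<le> b
    \<Longrightarrow> (\<lambda>A. a * \<mu> A + b * \<nu> A) \<in> positive_measures X"
  by (auto simp: positive_measures_def intro: signed_measures_lincomb)

text \<open>The two positive measures dominate the two variations of their difference.\<close>

lemma tv_norm_scaled_diff_le:
  assumes "\<mu> \<in> positive_measures X" "\<nu> \<in> positive_measures X" "0 \<le> t"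
  shows "tv_norm X (\<lambda>A. t * (\<mu> A - \<nu> A)) \<le> t * (tv_norm X \<mu> + tv_norm X \<nu>)"
proof -
  have le: "\<sigma> B \<le> \<sigma> X" if "\<sigma> \<in> positive_measures X" "B \<in> borel_on X" for \<sigma> B
    using pos_variation_upper[OF positive_measures_signed[OF that(1)] that(2) borel_on_subset[OF that(2)]]
    by (simp add: pos_variation_positive(1)[OF that(1)])
  have aux: "pos_variation X (\<lambda>A. t * (\<mu> A - \<nu> A)) X \<le> t * \<mu> X"
    if "\<mu> \<in> positive_measures X" "\<nu> \<in> positive_measures X" for \<mu> \<nu>
  proof (rule pos_variation_least)
    fix B assume "B \<in> borel_on X"
    then have "\<mu> B - \<nu> B \<le> \<mu> X"
      using le[OF that(1), of B] positive_measures_nonneg[OF that(2), of B] by linarith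
    then show "t * (\<mu> B - \<nu> B) \<le> t * \<mu> X" using assms(3) by (rule mult_left_mono)
  qed
  have "(\<lambda>B. - (t * (\<mu> B - \<nu> B))) = (\<lambda>B. t * (\<nu> B - \<mu> B))" by (auto simp: algebra_simps)
  then show ?thesis
    using aux[OF assms(1,2)] aux[OF assms(2,1)] assms
    by (simp add: tv_norm_def[of X "\<lambda>A. t * (\<mu> A - \<nu> A)"] total_variation_def tv_norm_positive distrib_left)
qed

section \<open>The duality pairing\<close>

text \<open>The pairing is defined through the two variations of \<open>\<nu>\<close>, which do not depend
  linearly on \<open>\<nu>\<close>. A linear relation between finitely many measures passes to their integrals, and
  this turns \<open>\<nu>\<^sup>+ - \<nu>\<^sup>- = \<nu>\<close> into linearity of the pairing in \<open>\<nu>\<close>. The relation is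
  proved for nonnegative functions by monotone approximation and extended to bounded ones by adding a constant. Coefficients and
  measures come in a list because concrete lists of them are summed by simplification.\<close>

lemma sum_list_integral_eq_0:
  fixes f :: "'a \<Rightarrow> real" and cs :: "(real \<times> 'a measure) list"
  assumes M: "\<And>p. p \<in> set cs \<Longrightarrow> finite_measure (snd p) \<and> sets (snd p) = sets N"
    and rel: "\<And>A. A \<in> sets N \<Longrightarrow> (\<Sum>p\<leftarrow>cs. fst p * measure (snd p) A) = 0"
    and f: "f \<in> borel_measurable N" and bound: "\<And>x. x \<in> space N \<Longrightarrow> \<bar>f x\<bar> \<le> C"
  shows "(\<Sum>p\<leftarrow>cs. fst p * (\<integral>x. f x \<partial>snd p)) = 0"
proof -
  let ?P = "\<lambda>u. (\<Sum>p\<leftarrow>cs. fst p * (\<integral>x. u x \<partial>snd p)) = (0::real)"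
  let ?I = "\<lambda>u. \<forall>p\<in>set cs. integrable (snd p) u"
  have space: "space (snd p) = space N" if "p \<in> set cs" for p
    using M[OF that] sets_eq_imp_space_eq by blast
  have meas: "u \<in> borel_measurable (snd p)" if "u \<in> borel_measurable N" "p \<in> set cs"
    for u :: "'a \<Rightarrow> real" and p
    using that M[OF that(2)] measurable_cong_sets by blast
  have nonneg: "?I u \<longrightarrow> ?P u" if "u \<in> borel_measurable N" "\<And>x. 0 \<le> u x" for u :: "'a \<Rightarrow> real"
    using that
  proof (induction rule: borel_measurable_induct_real)
    case (set A)
    have "(\<Sum>p\<leftarrow>cs. fst p * (\<integral>x. indicator A x \<partial>snd p)) = (\<Sum>p\<leftarrow>cs. fst p * measure (snd p) A)"
      using M set by (intro arg_cong[where f=sum_list] map_cong refl) auto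
    then show ?case using rel[OF set] by simp
  next
    case (mult u c)
    show ?case
    \<comment> \<open>For \<open>c = 0\<close> integrability of \<open>c * u\<close> says nothing about \<open>u\<close>.\<close>
    proof (cases "c = 0")
      case False
      show ?thesis
      proof
        assume "?I (\<lambda>x. c * u x)"
        then have P: "?P u" using mult.IH False by auto
        have "(\<Sum>p\<leftarrow>cs. fst p * (\<integral>x. c * u x \<partial>snd p))
            = (\<Sum>p\<leftarrow>cs. c * (fst p * (\<integral>x. u x \<partial>snd p)))"
          by (simp add: mult.left_commute)
        also have "\<dots> = c * (\<Sum>p\<leftarrow>cs. fst p * (\<integral>x. u x \<partial>snd p))"
          by (rule sum_list_const_mult)
        finally show "?P (\<lambda>x. c * u x)" unfolding P by simp
      qed
    qed simp
  next
    case (add u v)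
    show ?case
    proof
      assume I: "?I (\<lambda>x. v x + u x)"
      have Iu: "?I u" and Iv: "?I v"
      proof safe
        fix p assume p: "p \<in> set cs"
        have i: "integrable (snd p) (\<lambda>x. v x + u x)" using I p by blast
        show "integrable (snd p) u"
          by (rule Bochner_Integration.integrable_bound[OF i meas[OF add.hyps(1) p]])
            (intro AE_I2, simp add: add.hyps(2) add.hyps(4))
        show "integrable (snd p) v"
          by (rule Bochner_Integration.integrable_bound[OF i meas[OF add.hyps(3) p]])
            (intro AE_I2, simp add: add.hyps(2) add.hyps(4))
      qed
      have "(\<Sum>p\<leftarrow>cs. fst p * (\<integral>x. v x + u x \<partial>snd p))
          = (\<Sum>p\<leftarrow>cs. fst p * (\<integral>x. v x \<partial>snd p) + fst p * (\<integral>x. u x \<partial>snd p))"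
        using Iu Iv
        by (intro arg_cong[where f=sum_list] map_cong refl) (auto simp: distrib_left)
      then show "?P (\<lambda>x. v x + u x)"
        using add.IH Iu Iv by (simp add: sum_list_addf)
    qed
  next
    case (seq U)
    show ?case
    proof
      assume I: "?I u"
      have le: "U i x \<le> u x" if "x \<in> space N" for i x
        using seq.hyps(3) seq.hyps(4)[OF that] by (intro incseq_le) (auto simp: incseq_def le_fun_def)
      have IU: "?I (U i)" for i
      proof
        fix p assume p: "p \<in> set cs"
        have "integrable (snd p) u" using I p by blast
        then show "integrable (snd p) (U i)"
          by (rule Bochner_Integration.integrable_bound[OF _ meas[OF seq.hyps(1) p]])
            (auto intro!: AE_I2 simp: seq.hyps(2) le space[OF p] order_trans[OF seq.hyps(2) le])
      qed
      have "(\<lambda>i. \<Sum>p\<leftarrow>cs. fst p * (\<integral>x. U i x \<partial>snd p)) \<longlonglongrightarrow> (\<Sum>p\<leftarrow>cs. fst p * (\<integral>x. u x \<partial>snd p))"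
      proof -
        have "(\<lambda>i. \<integral>x. U i x \<partial>snd p) \<longlonglongrightarrow> (\<integral>x. u x \<partial>snd p)" if p: "p \<in> set cs" for p
        proof (rule integral_dominated_convergence[where w=u])
          show iu: "integrable (snd p) u" using I p by blast
          then show "u \<in> borel_measurable (snd p)" by simp
          show "AE x in snd p. (\<lambda>i. U i x) \<longlonglongrightarrow> u x"
            using seq.hyps(4) space[OF p] by (intro AE_I2) simp
          show "AE x in snd p. norm (U i x) \<le> u x" for i
            using seq.hyps(2) le space[OF p] by (intro AE_I2) simp
          show "U i \<in> borel_measurable (snd p)" for i
            using meas[OF seq.hyps(1) p] .
        qed
        then show ?thesis
        proof (induction cs)
          case (Cons p cs)
          have "(\<lambda>i. \<integral>x. U i x \<partial>snd p) \<longlonglongrightarrow> (\<integral>x. u x \<partial>snd p)"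
            by (rule Cons.prems) simp
          moreover have "(\<lambda>i. \<Sum>p\<leftarrow>cs. fst p * (\<integral>x. U i x \<partial>snd p)) \<longlonglongrightarrow> (\<Sum>p\<leftarrow>cs. fst p * (\<integral>x. u x \<partial>snd p))"
            using Cons by simp
          ultimately show ?case by (simp add: tendsto_add tendsto_mult_left)
        qed simp
      qed
      moreover have "(\<Sum>p\<leftarrow>cs. fst p * (\<integral>x. U i x \<partial>snd p)) = 0" for i
        using seq.IH IU by blast
      ultimately show "?P u" by (simp add: LIMSEQ_const_iff)
    qed
  qed
  define u where "u x = max 0 (f x + C)" for x
  have u: "u \<in> borel_measurable N" using f unfolding u_def by measurable
  have int: "integrable (snd p) u \<and> integrable (snd p) (\<lambda>x. C)" if p: "p \<in> set cs" for p
  proof -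
    interpret finite_measure "snd p" using M[OF p] by simp
    have "integrable (snd p) u"
    proof (rule integrable_const_bound[where B="2 * \<bar>C\<bar>"])
      show "AE x in snd p. norm (u x) \<le> 2 * \<bar>C\<bar>"
      proof (rule AE_I2)
        fix x assume "x \<in> space (snd p)"
        then have "\<bar>f x\<bar> \<le> C" using bound space[OF p] by simp
        then show "norm (u x) \<le> 2 * \<bar>C\<bar>" by (simp add: u_def)
      qed
    qed (rule meas[OF u p])
    then show ?thesis by simp
  qed
  have "?P u" using nonneg[OF u] int by (auto simp: u_def)
  moreover have "?P (\<lambda>x. 1)"
  proof -
    have "(\<Sum>p\<leftarrow>cs. fst p * (\<integral>x. 1 \<partial>snd p)) = (\<Sum>p\<leftarrow>cs. fst p * measure (snd p) (space N))"
      by (intro arg_cong[where f=sum_list] map_cong refl) (use space in auto)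
    then show ?thesis using rel[of "space N"] by simp
  qed
  moreover have "(\<Sum>p\<leftarrow>cs. fst p * (\<integral>x. f x \<partial>snd p))
      = (\<Sum>p\<leftarrow>cs. fst p * (\<integral>x. u x \<partial>snd p) - C * (fst p * (\<integral>x. 1 \<partial>snd p)))"
  proof (intro arg_cong[where f=sum_list] map_cong refl)
    fix p assume p: "p \<in> set cs"
    have "(\<integral>x. f x \<partial>snd p) = (\<integral>x. u x - C \<partial>snd p)"
    proof (rule Bochner_Integration.integral_cong[OF refl])
      fix x assume "x \<in> space (snd p)"
      then have "\<bar>f x\<bar> \<le> C" using bound space[OF p] by simp
      then show "f x = u x - C" by (simp add: u_def)
    qed
    also have "\<dots> = (\<integral>x. u x \<partial>snd p) - C * (\<integral>x. 1 \<partial>snd p)"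
      using int[OF p] by simp
    finally have *: "(\<integral>x. f x \<partial>snd p) = (\<integral>x. u x \<partial>snd p) - C * (\<integral>x. 1 \<partial>snd p)" .
    show "fst p * (\<integral>x. f x \<partial>snd p)
        = fst p * (\<integral>x. u x \<partial>snd p) - C * (fst p * (\<integral>x. 1 \<partial>snd p))"
      unfolding * by (simp add: right_diff_distrib mult.left_commute)
  qed
  ultimately show ?thesis
    by (simp only: sum_list_subtractf sum_list_const_mult)
qed

lemma continuous_on_measurable_pos_part:
  fixes f :: "'a::topological_space \<Rightarrow> real"
  shows "continuous_on X f \<Longrightarrow> f \<in> borel_measurable (pos_part_measure X \<nu>)"
  using borel_measurable_continuous_on_restrict[of X f] measurable_cong_sets[OF sets_pos_part[of X \<nu>] refl]
  by blast

lemma continuous_on_compact_bounded: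
  fixes f :: "'a::topological_space \<Rightarrow> real"
  assumes "compact X" "continuous_on X f"
  obtains C where "0 \<le> C" "\<And>x. x \<in> X \<Longrightarrow> \<bar>f x\<bar> \<le> C"
proof -
  have "bounded (f ` X)" using assms by (intro compact_imp_bounded compact_continuous_image)
  then obtain C where "\<And>x. x \<in> X \<Longrightarrow> \<bar>f x\<bar> \<le> C" by (auto simp: bounded_iff)
  then show ?thesis using that[of "max C 0"] by force
qed

lemma integrable_pos_part:
  fixes f :: "'a::topological_space \<Rightarrow> real"
  assumes "compact X" "continuous_on X f" "\<nu> \<in> signed_measures X"
  shows "integrable (pos_part_measure X \<nu>) f"
proof -
  interpret finite_measure "pos_part_measure X \<nu>" using assms(3) by (rule finite_measure_pos_part)
  obtain C where "\<And>x. x \<in> X \<Longrightarrow> \<bar>f x\<bar> \<le> C"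
    using continuous_on_compact_bounded[OF assms(1,2)] by blast
  then show ?thesis
    by (intro integrable_const_bound[where B=C] continuous_on_measurable_pos_part assms AE_I2) simp
qed

lemma pairing_lincomb:
  assumes X: "compact X" and f: "continuous_on X f"
    and \<mu>: "\<mu> \<in> signed_measures X" and \<nu>: "\<nu> \<in> signed_measures X"
  shows "pairing X f (\<lambda>A. a * \<mu> A + b * \<nu> A) = a * pairing X f \<mu> + b * pairing X f \<nu>"
proof -
  define \<sigma> where "\<sigma> A = a * \<mu> A + b * \<nu> A" for A
  have \<sigma>: "\<sigma> \<in> signed_measures X" unfolding \<sigma>_def by (rule signed_measures_lincomb[OF \<mu> \<nu>])
  obtain C where C: "\<And>x. x \<in> X \<Longrightarrow> \<bar>f x\<bar> \<le> C"
    using continuous_on_compact_bounded[OF X f] by blast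
  let ?p = "\<lambda>\<nu>. pos_part_measure X \<nu>" and ?n = "\<lambda>\<nu>. pos_part_measure X (\<lambda>A. - \<nu> A)"
  \<comment> \<open>The relation \<open>\<sigma> = a \<mu> + b \<nu>\<close>, written with the six variations.\<close>
  let ?cs = "[(1, ?p \<sigma>), (-1, ?n \<sigma>), (-a, ?p \<mu>), (a, ?n \<mu>), (-b, ?p \<nu>), (b, ?n \<nu>)]"
  have "(\<Sum>p\<leftarrow>?cs. fst p * (\<integral>x. f x \<partial>snd p)) = 0"
  proof (rule sum_list_integral_eq_0[where N="restrict_space borel X" and C=C])
    show "finite_measure (snd p) \<and> sets (snd p) = borel_on X" if "p \<in> set ?cs" for p
      using that \<sigma> \<mu> \<nu> by (auto simp: finite_measure_pos_part signed_measures_uminus)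
    show "(\<Sum>p\<leftarrow>?cs. fst p * measure (snd p) A) = 0" if A: "A \<in> borel_on X" for A
    proof -
      have "pos_variation X \<sigma> A - pos_variation X (\<lambda>A. - \<sigma> A) A
          = a * (pos_variation X \<mu> A - pos_variation X (\<lambda>A. - \<mu> A) A)
            + b * (pos_variation X \<nu> A - pos_variation X (\<lambda>A. - \<nu> A) A)"
        unfolding pos_variation_diff[OF \<sigma> A] pos_variation_diff[OF \<mu> A] pos_variation_diff[OF \<nu> A]
        by (simp add: \<sigma>_def)
      then show ?thesis
        by (simp add: measure_pos_part \<sigma> \<mu> \<nu> A signed_measures_uminus algebra_simps)
    qed
    show "f \<in> borel_measurable (restrict_space borel X)"
      by (rule borel_measurable_continuous_on_restrict[OF f])
    show "\<bar>f x\<bar> \<le> C" if "x \<in> space (restrict_space borel X)" for x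
      using that C by (simp add: space_restrict_space)
  qed
  then show ?thesis unfolding \<sigma>_def[symmetric] pairing_def by (simp add: algebra_simps)
qed

lemma pairing_diff:
  assumes "compact X" "continuous_on X f" "\<mu> \<in> signed_measures X" "\<nu> \<in> signed_measures X"
  shows "pairing X f (\<lambda>A. \<mu> A - \<nu> A) = pairing X f \<mu> - pairing X f \<nu>"
  using pairing_lincomb[OF assms, of 1 "-1"] by simp

lemma pairing_add_fun:
  assumes "compact X" "continuous_on X f" "continuous_on X h" "\<nu> \<in> signed_measures X"
  shows "pairing X (\<lambda>x. a * f x + b * h x) \<nu> = a * pairing X f \<nu> + b * pairing X h \<nu>"
  using assms signed_measures_uminus[OF assms(4)]
  by (simp add: pairing_def integrable_pos_part algebra_simps)

lemma pairing_zero_fun [simp]: "pairing X (\<lambda>x. 0) \<nu> = 0"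
  by (simp add: pairing_def)

lemma pairing_sum_fun:
  assumes "compact X" "\<nu> \<in> signed_measures X" "finite I" "\<And>i. i \<in> I \<Longrightarrow> continuous_on X (f i)"
  shows "pairing X (\<lambda>x. \<Sum>i\<in>I. c i * f i x) \<nu> = (\<Sum>i\<in>I. c i * pairing X (f i) \<nu>)"
  using assms(3,4)
proof (induction I)
  case (insert i I)
  have "continuous_on X (\<lambda>x. \<Sum>i\<in>I. c i * f i x)"
    using insert by (intro continuous_intros) auto
  then show ?case
    using pairing_add_fun[OF assms(1), of "f i" "\<lambda>x. \<Sum>i\<in>I. c i * f i x" \<nu> "c i" 1] insert assms(2)
    by simp
qed simp

lemma pairing_const_1:
  assumes "\<nu> \<in> signed_measures X"
  shows "pairing X (\<lambda>x. 1) \<nu> = \<nu> X"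
  using pos_variation_diff[OF assms, of X]
  by (simp add: pairing_def measure_pos_part assms signed_measures_uminus)

lemma pairing_bound:
  assumes X: "compact X" and f: "continuous_on X f" and \<nu>: "\<nu> \<in> signed_measures X"
    and C: "\<And>x. x \<in> X \<Longrightarrow> \<bar>f x\<bar> \<le> C"
  shows "\<bar>pairing X f \<nu>\<bar> \<le> C * tv_norm X \<nu>"
proof -
  have aux: "\<bar>\<integral>x. f x \<partial>pos_part_measure X \<mu>\<bar> \<le> C * pos_variation X \<mu> X"
    if \<mu>: "\<mu> \<in> signed_measures X" for \<mu>
  proof -
    interpret finite_measure "pos_part_measure X \<mu>" using \<mu> by (rule finite_measure_pos_part)
    have "\<bar>\<integral>x. f x \<partial>pos_part_measure X \<mu>\<bar> \<le> (\<integral>x. \<bar>f x\<bar> \<partial>pos_part_measure X \<mu>)"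
      by (rule integral_abs_bound)
    also have "\<dots> \<le> (\<integral>x. C \<partial>pos_part_measure X \<mu>)"
      using C integrable_pos_part[OF X f \<mu>] by (intro integral_mono) auto
    also have "\<dots> = C * pos_variation X \<mu> X"
      by (simp add: measure_pos_part[OF \<mu>] mult.commute)
    finally show ?thesis .
  qed
  show ?thesis
    using aux[OF \<nu>] aux[OF signed_measures_uminus[OF \<nu>]]
    unfolding pairing_def tv_norm_def total_variation_def distrib_left by linarith
qed

lemma pairing_positive:
  assumes f: "continuous_on X f" and \<nu>: "\<nu> \<in> positive_measures X"
  shows "pairing X f \<nu> = (\<integral>x. f x \<partial>pos_part_measure X \<nu>)"
proof -
  let ?M = "pos_part_measure X (\<lambda>A. - \<nu> A)"
  have s: "(\<lambda>A. - \<nu> A) \<in> signed_measures X"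
    using \<nu> by (intro signed_measures_uminus positive_measures_signed)
  have "emeasure ?M X = 0"
    by (simp add: emeasure_pos_part s pos_variation_positive[OF \<nu>])
  then have "AE x in ?M. f x = 0"
    by (intro AE_I[of _ _ X]) auto
  then have "(\<integral>x. f x \<partial>?M) = (\<integral>x. 0 \<partial>?M)"
    by (intro integral_cong_AE continuous_on_measurable_pos_part f) auto
  then show ?thesis by (simp add: pairing_def)
qed

lemma pairing_mono:
  assumes "compact X" "continuous_on X f" "continuous_on X h" "\<nu> \<in> positive_measures X"
    and "\<And>x. x \<in> X \<Longrightarrow> f x \<le> h x"
  shows "pairing X f \<nu> \<le> pairing X h \<nu>"
  using assms by (auto simp: pairing_positive intro!: integral_mono integrable_pos_part positive_measures_signed)

subsection \<open>Atomic measures\<close>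

lemma dirac_positive: "dirac X x \<in> positive_measures X"
proof -
  have "(\<lambda>i. dirac X x (A i)) sums dirac X x (\<Union>i. A i)"
    if A: "range A \<subseteq> borel_on X" "disjoint_family A" for A :: "nat \<Rightarrow> 'a set"
  proof (cases "\<exists>n. x \<in> A n")
    case True
    then obtain n where n: "x \<in> A n" by blast
    have "(\<lambda>i. dirac X x (A i)) = (\<lambda>i. if i = n then 1 else 0)"
    proof
      fix i
      have "x \<notin> A i" if "i \<noteq> n"
        using A(2) n that unfolding disjoint_family_on_def by blast
      then show "dirac X x (A i) = (if i = n then 1 else 0)"
        using A(1) n by (auto simp: dirac_def)
    qed
    moreover have "(\<Union>i. A i) \<in> borel_on X" using A(1) by (rule sets.countable_nat_UN)
    ultimately show ?thesis
      using sums_single[of n "\<lambda>_. 1::real"] n by (auto simp: dirac_def)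
  qed (simp add: dirac_def)
  moreover have "dirac X x A = 0" if "A \<notin> borel_on X" for A
    using that by (simp add: dirac_def)
  moreover have "0 \<le> dirac X x A" for A by (simp add: dirac_def)
  ultimately show ?thesis by (simp add: positive_measures_def signed_measures_def)
qed

lemma pairing_dirac:
  assumes f: "continuous_on X f" and x: "x \<in> X"
  shows "pairing X f (dirac X x) = f x"
proof -
  let ?M = "pos_part_measure X (dirac X x)"
  have d: "dirac X x \<in> signed_measures X" by (rule positive_measures_signed[OF dirac_positive])
  have m: "emeasure ?M A = ennreal (dirac X x A)" if "A \<in> borel_on X" for A
    using that by (simp add: emeasure_pos_part d pos_variation_positive dirac_positive)
  have fM: "f \<in> borel_measurable ?M" by (rule continuous_on_measurable_pos_part[OF f])
  \<comment> \<open>The set where \<open>f\<close> differs from \<open>f x\<close> is Borel because \<open>f\<close> is measurable, and it misses the atom.\<close>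
  have "{y \<in> space ?M. f y \<noteq> f x} \<in> sets ?M" using fM by measurable
  then have A: "{y \<in> X. f y \<noteq> f x} \<in> borel_on X" by simp
  have "AE y in ?M. f y = f x"
    by (rule AE_I[of _ _ "{y \<in> X. f y \<noteq> f x}"]) (use A m[OF A] in \<open>auto simp: dirac_def\<close>)
  then have "(\<integral>y. f y \<partial>?M) = (\<integral>y. f x \<partial>?M)"
    by (intro integral_cong_AE fM) auto
  also have "\<dots> = f x"
    using m[of X] x by (simp add: measure_def dirac_def)
  finally show ?thesis by (simp add: pairing_positive[OF f dirac_positive])
qed

lemma sum_dirac_signed: "finite I \<Longrightarrow> (\<lambda>A. \<Sum>i\<in>I. t i * dirac X (y i) A) \<in> signed_measures X"
proof (induction I rule: finite_induct)
  case (insert i I)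
  then show ?case
    using signed_measures_lincomb[OF positive_measures_signed[OF dirac_positive[of X "y i"]] insert.IH, of "t i" 1]
    by simp
qed (simp add: signed_measures_zero)

lemma sum_dirac_positive:
  assumes "finite I" "\<And>i. i \<in> I \<Longrightarrow> 0 \<le> t i"
  shows "(\<lambda>A. \<Sum>i\<in>I. t i * dirac X (y i) A) \<in> positive_measures X"
proof -
  have "0 \<le> (\<Sum>i\<in>I. t i * dirac X (y i) A)" for A
    using assms by (intro sum_nonneg mult_nonneg_nonneg positive_measures_nonneg[OF dirac_positive])
  then show ?thesis using sum_dirac_signed[OF assms(1)] by (simp add: positive_measures_def)
qed

lemma pairing_sum_dirac:
  assumes X: "compact X" and f: "continuous_on X f" and "finite I" "\<And>i. i \<in> I \<Longrightarrow> y i \<in> X"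
  shows "pairing X f (\<lambda>A. \<Sum>i\<in>I. t i * dirac X (y i) A) = (\<Sum>i\<in>I. t i * f (y i))"
  using assms(3,4)
proof (induction I rule: finite_induct)
  case empty
  show ?case
    using pairing_lincomb[OF X f signed_measures_zero signed_measures_zero, of 0 0] by simp
next
  case (insert i I)
  then show ?case
    using pairing_lincomb[OF X f positive_measures_signed[OF dirac_positive[of X "y i"]]
        sum_dirac_signed[of I t X y], of "t i" 1]
    by (simp add: pairing_dirac[OF f])
qed

lemma atomic_positive:
  "finite P \<Longrightarrow> (\<And>x. x \<in> P \<Longrightarrow> 0 \<le> w x) \<Longrightarrow> atomic X P w \<in> positive_measures X"
  unfolding atomic_def by (rule sum_dirac_positive)

lemma pairing_atomic:
  "compact X \<Longrightarrow> continuous_on X f \<Longrightarrow> finite P \<Longrightarrow> P \<subseteq> X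
    \<Longrightarrow> pairing X f (atomic X P w) = (\<Sum>x\<in>P. w x * f x)"
  unfolding atomic_def by (rule pairing_sum_dirac) auto

section \<open>The weak* topology\<close>

lemma topspace_weak_star [simp]: "topspace (weak_star X) = signed_measures X"
proof -
  have "signed_measures X \<in> {{\<omega> \<in> signed_measures X. pairing X f \<omega> \<in> V} | f V. continuous_on X f \<and> open V}"
    by (auto intro!: exI[of _ "\<lambda>x. 0"] exI[of _ UNIV])
  then show ?thesis unfolding weak_star_def topology_generated_by_topspace by blast
qed

lemma continuous_map_pairing:
  assumes "continuous_on X f"
  shows "continuous_map (weak_star X) euclideanreal (pairing X f)"
  unfolding continuous_map_def
proof (intro conjI allI impI)
  fix V :: "real set" assume "openin euclideanreal V"
  then have "{\<omega> \<in> signed_measures X. pairing X f \<omega> \<in> V}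
      \<in> {{\<omega> \<in> signed_measures X. pairing X f \<omega> \<in> V} | f V. continuous_on X f \<and> open V}"
    using assms by auto
  then have "openin (weak_star X) {\<omega> \<in> signed_measures X. pairing X f \<omega> \<in> V}"
    unfolding weak_star_def by (rule topology_generated_by_Basis)
  then show "openin (weak_star X) {\<omega> \<in> topspace (weak_star X). pairing X f \<omega> \<in> V}" by simp
qed simp

lemma continuous_map_into_weak_star:
  assumes "\<And>p. p \<in> topspace T \<Longrightarrow> h p \<in> signed_measures X"
    and "\<And>f. continuous_on X f \<Longrightarrow> continuous_map T euclideanreal (\<lambda>p. pairing X f (h p))"
  shows "continuous_map T (weak_star X) h"
  unfolding weak_star_def
proof (rule continuous_on_generated_topo)
  fix U assume "U \<in> {{\<omega> \<in> signed_measures X. pairing X f \<omega> \<in> V} | f V. continuous_on X f \<and> open V}"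
  then obtain f V where f: "continuous_on X f" and V: "open V"
    and U: "U = {\<omega> \<in> signed_measures X. pairing X f \<omega> \<in> V}" by blast
  have "openin T {p \<in> topspace T. pairing X f (h p) \<in> V}"
    using openin_continuous_map_preimage[OF assms(2)[OF f]] V by simp
  moreover have "{p \<in> topspace T. pairing X f (h p) \<in> V} = h -` U \<inter> topspace T"
    using assms(1) U by auto
  ultimately show "openin T (h -` U \<inter> topspace T)" by simp
next
  show "h ` topspace T \<subseteq> \<Union> {{\<omega> \<in> signed_measures X. pairing X f \<omega> \<in> V} | f V. continuous_on X f \<and> open V}"
    using topspace_weak_star[of X] assms(1)
    unfolding weak_star_def topology_generated_by_topspace by blast
qed

text \<open>The indicator of a closed set \<open>C\<close> is the bounded pointwise limit of the functions
  \<open>max 0 (1 - n * infdist x C)\<close>, so pairings with continuous functions determine the two variations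
  on closed sets, a generator of the Borel sets that is stable under intersection.\<close>

lemma signed_measure_eqI:
  fixes X :: "'a::metric_space set"
  assumes X: "compact X" and \<mu>: "\<mu> \<in> signed_measures X" and \<nu>: "\<nu> \<in> signed_measures X"
    and eq: "\<And>f. continuous_on X f \<Longrightarrow> pairing X f \<mu> = pairing X f \<nu>"
  shows "\<mu> = \<nu>"
proof -
  define \<sigma> where "\<sigma> A = \<mu> A - \<nu> A" for A
  have \<sigma>: "\<sigma> \<in> signed_measures X" unfolding \<sigma>_def by (rule signed_measures_diff[OF \<mu> \<nu>])
  let ?p = "pos_part_measure X \<sigma>" and ?n = "pos_part_measure X (\<lambda>A. - \<sigma> A)"
  interpret p: finite_measure ?p by (rule finite_measure_pos_part[OF \<sigma>])
  interpret n: finite_measure ?n by (rule finite_measure_pos_part[OF signed_measures_uminus[OF \<sigma>]])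
  have int: "(\<integral>x. f x \<partial>?p) = (\<integral>x. f x \<partial>?n)" if f: "continuous_on X f" for f :: "'a \<Rightarrow> real"
    using pairing_diff[OF X f \<mu> \<nu>] eq[OF f] unfolding \<sigma>_def[symmetric] by (simp add: pairing_def)
  have closed: "measure ?p (C \<inter> X) = measure ?n (C \<inter> X)" if C: "closed C" "C \<noteq> {}" for C
  proof -
    define F where "F n x = max 0 (1 - real n * infdist x C)" for n x
    have F: "continuous_on X (F n)" for n
      unfolding F_def by (intro continuous_intros)
    have lim: "(\<lambda>n. F n x) \<longlonglongrightarrow> indicator C x" for x
    proof (cases "x \<in> C")
      case False
      then have pos: "0 < infdist x C"
        using C in_closed_iff_infdist_zero[of C x] infdist_nonneg[of x C] by force
      then obtain N where N: "1 < real N * infdist x C" using reals_Archimedean3 by blast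
      have "F n x = 0" if "N \<le> n" for n
      proof -
        have "real N * infdist x C \<le> real n * infdist x C" using that pos by simp
        then show ?thesis using N unfolding F_def by simp
      qed
      then have "eventually (\<lambda>n. F n x = 0) sequentially" by (auto simp: eventually_sequentially)
      then show ?thesis using False by (simp add: tendsto_eventually)
    qed (simp add: F_def)
    have CX: "C \<inter> X \<in> borel_on X"
      using C(1) by (auto simp: sets_restrict_space)
    have conv: "(\<lambda>n. \<integral>x. F n x \<partial>pos_part_measure X \<tau>) \<longlonglongrightarrow> measure (pos_part_measure X \<tau>) (C \<inter> X)"
      if \<tau>: "\<tau> \<in> signed_measures X" for \<tau>
    proof -
      let ?M = "pos_part_measure X \<tau>"
      interpret finite_measure ?M by (rule finite_measure_pos_part[OF \<tau>])
      have "(\<lambda>n. \<integral>x. F n x \<partial>?M) \<longlonglongrightarrow> (\<integral>x. indicator (C \<inter> X) x \<partial>?M)"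
      proof (rule integral_dominated_convergence[where w="\<lambda>_. 1"])
        show "AE x in ?M. (\<lambda>n. F n x) \<longlonglongrightarrow> indicator (C \<inter> X) x"
          using lim by (intro AE_I2) (simp add: indicator_def)
        show "AE x in ?M. norm (F n x) \<le> 1" for n
          by (intro AE_I2) (simp add: F_def infdist_nonneg)
        show "(\<lambda>x. indicator (C \<inter> X) x :: real) \<in> borel_measurable ?M"
          by (rule borel_measurable_indicator) (simp add: CX)
      qed (simp_all add: continuous_on_measurable_pos_part[OF F])
      then show ?thesis using CX by simp
    qed
    show ?thesis
      using conv[OF \<sigma>] conv[OF signed_measures_uminus[OF \<sigma>]] int[OF F] LIMSEQ_unique by auto
  qed
  have ambient: "measure ?p (A \<inter> X) = measure ?n (A \<inter> X)" if A: "A \<in> sets borel" for A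
  proof -
    have id: "(\<lambda>x. x) \<in> measurable (pos_part_measure X \<tau>) borel" for \<tau>
      using measurable_restrict_space1[of "\<lambda>x. x" borel borel X] measurable_cong_sets[OF sets_pos_part refl]
      by auto
    have "distr ?p borel (\<lambda>x. x) = distr ?n borel (\<lambda>x. x)"
    proof (rule measure_eqI_generator_eq[where E="Collect closed" and \<Omega>=UNIV and A="\<lambda>_. UNIV"])
      show "emeasure (distr ?p borel (\<lambda>x. x)) C = emeasure (distr ?n borel (\<lambda>x. x)) C" if "C \<in> Collect closed" for C
        using that closed[of C]
        by (cases "C = {}") (auto simp: emeasure_distr id p.emeasure_eq_measure n.emeasure_eq_measure)
      show "emeasure (distr ?p borel (\<lambda>x. x)) UNIV \<noteq> \<infinity>"
        by (simp add: emeasure_distr id p.emeasure_eq_measure)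
    qed (auto simp: Int_stable_def borel_eq_closed)
    then have "emeasure (distr ?p borel (\<lambda>x. x)) A = emeasure (distr ?n borel (\<lambda>x. x)) A" by simp
    then show ?thesis
      using A by (simp add: emeasure_distr id p.emeasure_eq_measure n.emeasure_eq_measure)
  qed
  have "\<sigma> A = 0" for A
  proof (cases "A \<in> borel_on X")
    case True
    then obtain B where "B \<in> sets borel" "A = B \<inter> X" by (auto simp: sets_restrict_space)
    then have "measure ?p A = measure ?n A" using ambient by simp
    then show ?thesis
      using pos_variation_diff[OF \<sigma> True]
      by (simp add: measure_pos_part[OF _ True] \<sigma> signed_measures_uminus)
  qed (rule signed_measure_outside[OF \<sigma>])
  then show ?thesis unfolding \<sigma>_def by auto
qed

lemma Hausdorff_weak_star:
  fixes X :: "'a::metric_space set"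
  assumes X: "compact X"
  shows "Hausdorff_space (weak_star X)"
  unfolding Hausdorff_space_def
proof (intro allI impI)
  fix \<mu> \<nu> assume a: "\<mu> \<in> topspace (weak_star X) \<and> \<nu> \<in> topspace (weak_star X) \<and> \<mu> \<noteq> \<nu>"
  then obtain f where f: "continuous_on X f" and ne: "pairing X f \<mu> \<noteq> pairing X f \<nu>"
    using signed_measure_eqI[OF X] by auto
  from hausdorff[OF ne] obtain V W where "open V" "open W" "pairing X f \<mu> \<in> V" "pairing X f \<nu> \<in> W" "V \<inter> W = {}"
    by blast
  then show "\<exists>U V. openin (weak_star X) U \<and> openin (weak_star X) V \<and> \<mu> \<in> U \<and> \<nu> \<in> V \<and> disjnt U V"
    using a openin_continuous_map_preimage[OF continuous_map_pairing[OF f], of V]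
      openin_continuous_map_preimage[OF continuous_map_pairing[OF f], of W]
    by (intro exI[of _ "{\<omega> \<in> topspace (weak_star X). pairing X f \<omega> \<in> V}"]
        exI[of _ "{\<omega> \<in> topspace (weak_star X). pairing X f \<omega> \<in> W}"]) (auto simp: disjnt_def)
qed

subsection \<open>Accumulation points\<close>

text \<open>In a Hausdorff space \<open>K\<close> is closed, and an accumulation point ignores the entry with index \<open>0\<close>.\<close>

lemma accumulation_point_in_compact:
  fixes X :: "'a::metric_space set"
  assumes X: "compact X" and K: "compactin (weak_star X) K" and \<omega>: "\<And>k. 1 \<le> k \<Longrightarrow> \<omega> k \<in> K"
    and \<nu>: "weak_star_accumulation_point X \<omega> \<nu>"
  shows "\<nu> \<in> K"
proof (rule ccontr)
  assume "\<nu> \<notin> K"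
  have "closedin (weak_star X) K"
    using compactin_imp_closedin[OF Hausdorff_weak_star[OF X] K] .
  then have "openin (weak_star X) (signed_measures X - K)"
    by (metis closedin_def topspace_weak_star)
  then have "\<exists>\<^sub>\<infinity>k. \<omega> k \<in> signed_measures X - K"
    using \<nu> \<open>\<nu> \<notin> K\<close> unfolding weak_star_accumulation_point_def by blast
  then obtain k where "1 \<le> k" "\<omega> k \<in> signed_measures X - K"
    unfolding INFM_nat_le by blast
  then show False using \<omega> by blast
qed

text \<open>Otherwise each point of \<open>K\<close> has a neighbourhood that is visited finitely often, and finitely many of these
  neighbourhoods cover \<open>K\<close>.\<close>

lemma accumulation_point_exists:
  assumes K: "compactin (weak_star X) K" and \<omega>: "\<And>k. 1 \<le> k \<Longrightarrow> \<omega> k \<in> K"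
  shows "\<exists>\<nu>. weak_star_accumulation_point X \<omega> \<nu>"
proof (rule ccontr)
  assume "\<not> ?thesis"
  then have "\<exists>U. openin (weak_star X) U \<and> \<nu> \<in> U \<and> finite {k. \<omega> k \<in> U}" if "\<nu> \<in> signed_measures X" for \<nu>
    using that unfolding weak_star_accumulation_point_def frequently_cofinite by blast
  then obtain U where U: "\<And>\<nu>. \<nu> \<in> signed_measures X \<Longrightarrow> openin (weak_star X) (U \<nu>) \<and> \<nu> \<in> U \<nu> \<and> finite {k. \<omega> k \<in> U \<nu>}"
    by metis
  have KS: "K \<subseteq> signed_measures X" using compactin_subset_topspace[OF K] by simp
  have "\<exists>\<F>. finite \<F> \<and> \<F> \<subseteq> U ` K \<and> K \<subseteq> \<Union>\<F>"
    using K U KS unfolding compactin_def by (auto elim!: allE[of _ "U ` K"])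
  then obtain \<F> where \<F>: "finite \<F>" "\<F> \<subseteq> U ` K" "K \<subseteq> \<Union>\<F>" by blast
  have "finite (\<Union>V\<in>\<F>. {k. \<omega> k \<in> V})"
    using \<F>(1,2) U KS by blast
  moreover have "{1..} \<subseteq> (\<Union>V\<in>\<F>. {k. \<omega> k \<in> V})"
    using \<omega> \<F>(3) by fastforce
  ultimately show False using infinite_Ici finite_subset by blast
qed

text \<open>For finitely many test functions the basic weak* neighbourhoods of \<open>\<nu>\<close> with radius \<open>1 / (j + 1)\<close>
  turn an accumulation point into the limit along a sequence of indices.\<close>

lemma accumulation_point_approx:
  assumes \<nu>: "weak_star_accumulation_point X \<omega> \<nu>" and F: "finite F" "\<And>f. f \<in> F \<Longrightarrow> continuous_on X f"
  shows "\<exists>r. \<forall>j. j \<le> r j \<and> (\<forall>f\<in>F. \<bar>pairing X f (\<omega> (r j)) - pairing X f \<nu>\<bar> < inverse (real (Suc j)))"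
proof -
  have "\<exists>k\<ge>j. \<forall>f\<in>F. \<bar>pairing X f (\<omega> k) - pairing X f \<nu>\<bar> < inverse (real (Suc j))" for j
  proof -
    let ?U = "\<lambda>f. {\<mu> \<in> topspace (weak_star X). pairing X f \<mu> \<in> ball (pairing X f \<nu>) (inverse (real (Suc j)))}"
    have "openin (weak_star X) (?U f)" if "f \<in> F" for f
      by (rule openin_continuous_map_preimage[OF continuous_map_pairing[OF F(2)[OF that]]]) simp
    then have "openin (weak_star X) (topspace (weak_star X) \<inter> \<Inter> (?U ` F))"
      using F(1) by (intro openin_Int_Inter openin_topspace) auto
    moreover have "\<nu> \<in> topspace (weak_star X) \<inter> \<Inter> (?U ` F)"
      using \<nu> by (auto simp: weak_star_accumulation_point_def)
    ultimately have "\<exists>\<^sub>\<infinity>k. \<omega> k \<in> topspace (weak_star X) \<inter> \<Inter> (?U ` F)"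
      using \<nu> unfolding weak_star_accumulation_point_def by blast
    then obtain k where "k \<ge> j" "\<omega> k \<in> topspace (weak_star X) \<inter> \<Inter> (?U ` F)"
      unfolding INFM_nat_le by blast
    then show ?thesis by (intro exI[of _ k]) (auto simp: dist_real_def abs_minus_commute)
  qed
  then show ?thesis by metis
qed

subsection \<open>Measures with few atoms\<close>

lemma supp_subset_finite:
  fixes X :: "'a::t1_space set"
  assumes \<nu>: "\<nu> \<in> positive_measures X" and P: "finite P" and null: "\<nu> (X - P) = 0"
  shows "supp X \<nu> \<subseteq> P"
proof
  fix x assume x: "x \<in> supp X \<nu>"
  show "x \<in> P"
  proof (rule ccontr)
    assume "x \<notin> P"
    moreover have o: "open (- P)" using P by (simp add: finite_imp_closed open_Compl)
    ultimately have "0 < total_variation X \<nu> (- P \<inter> X)"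
      using x unfolding supp_def by blast
    moreover have "- P \<inter> X = X - P" by blast
    moreover have "- P \<inter> X \<in> borel_on X"
      using o by (auto simp: sets_restrict_space)
    ultimately show False
      using pos_variation_positive[OF \<nu>, of "X - P"] null by (simp add: total_variation_def)
  qed
qed

text \<open>Weights may vanish and points may coincide, so that the sets below are closed under limits.\<close>

definition few_atoms :: "'a::topological_space set \<Rightarrow> nat \<Rightarrow> real \<Rightarrow> ('a set \<Rightarrow> real) set" where
  "few_atoms X N C = (\<lambda>p A. \<Sum>i<N. snd (p i) * dirac X (fst (p i)) A) ` ({..<N} \<rightarrow>\<^sub>E X \<times> {0..C})"

lemma few_atoms_positive: "\<nu> \<in> few_atoms X N C \<Longrightarrow> \<nu> \<in> positive_measures X"
proof -
  assume "\<nu> \<in> few_atoms X N C"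
  then obtain p where p: "p \<in> {..<N} \<rightarrow>\<^sub>E X \<times> {0..C}"
    and \<nu>: "\<nu> = (\<lambda>A. \<Sum>i<N. snd (p i) * dirac X (fst (p i)) A)"
    unfolding few_atoms_def by blast
  have "0 \<le> snd (p i)" if "i < N" for i
    using PiE_mem[OF p, of i] that by (auto simp: mem_Times_iff)
  then show ?thesis unfolding \<nu> by (intro sum_dirac_positive) auto
qed

lemma few_atoms_supp:
  fixes X :: "'a::t1_space set"
  assumes "\<nu> \<in> few_atoms X N C"
  shows "finite (supp X \<nu>) \<and> card (supp X \<nu>) \<le> N"
proof -
  obtain p where \<nu>: "\<nu> = (\<lambda>A. \<Sum>i<N. snd (p i) * dirac X (fst (p i)) A)"
    using assms unfolding few_atoms_def by blast
  let ?P = "(fst \<circ> p) ` {..<N}"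
  have "\<nu> (X - ?P) = 0" unfolding \<nu> by (intro sum.neutral) (auto simp: dirac_def)
  then have sub: "supp X \<nu> \<subseteq> ?P"
    by (intro supp_subset_finite few_atoms_positive[OF assms]) auto
  then have "card (supp X \<nu>) \<le> card ?P" by (intro card_mono) auto
  also have "\<dots> \<le> N" using card_image_le[of "{..<N}" "fst \<circ> p"] by simp
  finally show ?thesis using sub finite_subset by blast
qed

lemma atomic_in_few_atoms:
  assumes X: "X \<noteq> {}" and P: "finite P" "P \<subseteq> X" "card P \<le> N" and w: "\<And>x. x \<in> P \<Longrightarrow> 0 \<le> w x \<and> w x \<le> C"
    and C: "0 \<le> C"
  shows "atomic X P w \<in> few_atoms X N C"
proof -
  obtain h where h: "bij_betw h {..<card P} P"
    using ex_bij_betw_nat_finite[OF P(1)] by (auto simp: atLeast0LessThan)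
  obtain a where a: "a \<in> X" using X by blast
  define p where "p = restrict (\<lambda>i. if i < card P then (h i, w (h i)) else (a, 0)) {..<N}"
  have hP: "h i \<in> P" if "i < card P" for i using h that by (auto simp: bij_betw_def)
  have "p \<in> {..<N} \<rightarrow>\<^sub>E X \<times> {0..C}"
    using hP subsetD[OF P(2) hP] w a C unfolding p_def by auto
  moreover have "atomic X P w A = (\<Sum>i<N. snd (p i) * dirac X (fst (p i)) A)" for A
  proof -
    have "atomic X P w A = (\<Sum>i<card P. w (h i) * dirac X (h i) A)"
      unfolding atomic_def by (rule sum.reindex_bij_betw[OF h, symmetric])
    also have "\<dots> = (\<Sum>i<N. snd (p i) * dirac X (fst (p i)) A)"
      by (rule sum.mono_neutral_cong_left) (use P(3) in \<open>auto simp: p_def\<close>)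
    finally show ?thesis .
  qed
  ultimately show ?thesis unfolding few_atoms_def by (intro image_eqI[of _ _ p]) auto
qed

text \<open>The measures are parametrized continuously by their points and weights, which range over a compact product. In place of
  general weak* compactness of balls, this also bounds the number of atoms of the limits.\<close>

lemma compactin_few_atoms:
  fixes X :: "'a::metric_space set"
  assumes X: "compact X"
  shows "compactin (weak_star X) (few_atoms X N C)"
proof -
  let ?S = "X \<times> {0..C}"
  let ?T = "product_topology (\<lambda>_. top_of_set ?S) {..<N}"
  have top: "topspace ?T = ({..<N} \<rightarrow>\<^sub>E ?S)" by simp
  have "compact ?S" using X by (simp add: compact_Times)
  then have "compactin (top_of_set ?S) ?S" by (simp add: compactin_subtopology)
  then have "compactin ?T (topspace ?T)" unfolding top compactin_PiE by blast
  moreover have "continuous_map ?T (weak_star X) (\<lambda>p A. \<Sum>i<N. snd (p i) * dirac X (fst (p i)) A)"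
  proof (rule continuous_map_into_weak_star)
    fix p assume p: "p \<in> topspace ?T"
    show "(\<lambda>A. \<Sum>i<N. snd (p i) * dirac X (fst (p i)) A) \<in> signed_measures X"
      by (rule sum_dirac_signed) simp
  next
    fix f :: "'a \<Rightarrow> real" assume f: "continuous_on X f"
    have "continuous_map ?T euclideanreal (\<lambda>p. \<Sum>i<N. snd (p i) * f (fst (p i)))"
    proof (rule continuous_map_sum)
      fix i assume "i \<in> {..<N}"
      then have "continuous_map ?T (top_of_set ?S) (\<lambda>p. p i)"
        by (rule continuous_map_product_projection)
      moreover have "continuous_map (top_of_set ?S) euclideanreal (\<lambda>y. snd y * f (fst y))"
        using f by (auto intro!: continuous_intros continuous_on_compose2[OF f])
      ultimately show "continuous_map ?T euclideanreal (\<lambda>p. snd (p i) * f (fst (p i)))"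
        using continuous_map_compose[of ?T "top_of_set ?S" "\<lambda>p. p i" euclideanreal "\<lambda>y. snd y * f (fst y)"]
        by (simp add: o_def)
    qed simp
    moreover have "pairing X f (\<lambda>A. \<Sum>i<N. snd (p i) * dirac X (fst (p i)) A) = (\<Sum>i<N. snd (p i) * f (fst (p i)))"
      if "p \<in> topspace ?T" for p
      using that by (intro pairing_sum_dirac[OF X f]) (auto simp: PiE_iff mem_Times_iff)
    ultimately show "continuous_map ?T euclideanreal
        (\<lambda>p. pairing X f (\<lambda>A. \<Sum>i<N. snd (p i) * dirac X (fst (p i)) A))"
      by (rule continuous_map_eq[OF _ sym])
  qed
  ultimately show ?thesis
    unfolding few_atoms_def top[symmetric] by (rule image_compactin)
qed

section \<open>The information operator\<close>

lemma inner_matrix_vector: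
  fixes M :: "real^'n^'n"
  shows "y \<bullet> (M *v y) = (\<Sum>k\<in>UNIV. \<Sum>l\<in>UNIV. M $ k $ l * (y $ k * y $ l))"
  by (simp add: inner_vec_def matrix_vector_mult_def sum_distrib_left mult_ac)

lemma inner_matrix:
  fixes M A :: "real^'n^'n"
  shows "M \<bullet> A = (\<Sum>k\<in>UNIV. \<Sum>l\<in>UNIV. M $ k $ l * A $ k $ l)"
  by (simp add: inner_vec_def)

lemma continuous_on_entry_product:
  fixes g :: "'a::topological_space \<Rightarrow> real^'n"
  shows "continuous_on X g \<Longrightarrow> continuous_on X (\<lambda>x. g x $ k * g x $ l)"
  by (intro continuous_intros)

lemma continuous_on_quadratic_form:
  fixes g :: "'a::topological_space \<Rightarrow> real^'n"
  shows "continuous_on X g \<Longrightarrow> continuous_on X (\<lambda>x. g x \<bullet> (M *v g x))"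
  unfolding inner_matrix_vector by (intro continuous_intros)

text \<open>This is the chain rule behind the identification of the derivative of \<open>\<psi>\<close> with the function \<open>dpsi\<close>:
  a linear functional of the information matrix is a pairing.\<close>

lemma info_op_inner:
  assumes "compact X" "continuous_on X g" "\<nu> \<in> signed_measures X"
  shows "M \<bullet> info_op X g \<nu> = pairing X (\<lambda>x. g x \<bullet> (M *v g x)) \<nu>"
proof -
  have "pairing X (\<lambda>x. g x \<bullet> (M *v g x)) \<nu>
      = pairing X (\<lambda>x. \<Sum>k\<in>UNIV. 1 * (\<Sum>l\<in>UNIV. M $ k $ l * (g x $ k * g x $ l))) \<nu>"
    by (simp add: inner_matrix_vector)
  also have "\<dots> = (\<Sum>k\<in>UNIV. 1 * pairing X (\<lambda>x. \<Sum>l\<in>UNIV. M $ k $ l * (g x $ k * g x $ l)) \<nu>)"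
    using assms by (intro pairing_sum_fun) (auto intro!: continuous_intros)
  also have "\<dots> = (\<Sum>k\<in>UNIV. \<Sum>l\<in>UNIV. M $ k $ l * pairing X (\<lambda>x. g x $ k * g x $ l) \<nu>)"
    using assms by (simp add: pairing_sum_fun continuous_on_entry_product)
  finally show ?thesis by (simp add: inner_matrix info_op_def)
qed

lemma info_op_lincomb:
  assumes "compact X" "continuous_on X g" "\<mu> \<in> signed_measures X" "\<nu> \<in> signed_measures X"
  shows "info_op X g (\<lambda>A. a * \<mu> A + b * \<nu> A) = a *\<^sub>R info_op X g \<mu> + b *\<^sub>R info_op X g \<nu>"
  using pairing_lincomb[OF assms(1) continuous_on_entry_product[OF assms(2)] assms(3,4)]
  by (simp add: info_op_def vec_eq_iff)

lemma info_op_diff: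
  assumes "compact X" "continuous_on X g" "\<mu> \<in> signed_measures X" "\<nu> \<in> signed_measures X"
  shows "info_op X g (\<lambda>A. \<mu> A - \<nu> A) = info_op X g \<mu> - info_op X g \<nu>"
  using info_op_lincomb[OF assms, of 1 "-1"] by simp

lemma info_op_atomic:
  assumes "compact X" "continuous_on X g" "finite P" "P \<subseteq> X"
  shows "info_op X g (atomic X P w) = (\<Sum>x\<in>P. w x *\<^sub>R info_op X g (dirac X x))"
  using assms(4)
  by (simp add: info_op_def vec_eq_iff pairing_atomic[OF assms(1) continuous_on_entry_product[OF assms(2)] assms(3,4)])
    (auto intro!: sum.cong simp: pairing_dirac[OF continuous_on_entry_product[OF assms(2)]])

lemma info_op_Sym: "info_op X g \<nu> \<in> Sym"
  by (simp add: Sym_def info_op_def transpose_def mult.commute)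

lemma info_op_NND:
  assumes X: "compact X" and g: "continuous_on X g" and \<nu>: "\<nu> \<in> positive_measures X"
  shows "info_op X g \<nu> \<in> NND"
proof -
  have "0 \<le> y \<bullet> (info_op X g \<nu> *v y)" for y
  proof -
    define M where "M = (\<chi> k l. y $ k * y $ l)"
    have "y \<bullet> (info_op X g \<nu> *v y) = M \<bullet> info_op X g \<nu>"
      by (simp add: inner_matrix_vector inner_matrix M_def mult.commute)
    also have "\<dots> = pairing X (\<lambda>x. g x \<bullet> (M *v g x)) \<nu>"
      by (rule info_op_inner[OF X g positive_measures_signed[OF \<nu>]])
    also have "\<dots> \<ge> pairing X (\<lambda>x. 0) \<nu>"
    proof (rule pairing_mono[OF X _ continuous_on_quadratic_form[OF g] \<nu>])
      fix x
      have "g x \<bullet> (M *v g x) = (\<Sum>k\<in>UNIV. y $ k * g x $ k) * (\<Sum>l\<in>UNIV. y $ l * g x $ l)"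
        unfolding inner_matrix_vector sum_product by (intro sum.cong refl) (simp add: M_def mult_ac)
      then show "0 \<le> g x \<bullet> (M *v g x)" by simp
    qed simp
    finally show ?thesis by simp
  qed
  then show ?thesis by (simp add: NND_def info_op_Sym)
qed

lemma info_op_norm_le:
  assumes X: "compact X" and g: "continuous_on X g"
  obtains C where "0 < C" "\<And>\<nu>. \<nu> \<in> signed_measures X \<Longrightarrow> norm (info_op X g \<nu>) \<le> C * tv_norm X \<nu>"
proof -
  have "\<exists>B. 0 \<le> B \<and> (\<forall>x\<in>X. \<bar>g x $ k * g x $ l\<bar> \<le> B)" for k l
    using continuous_on_compact_bounded[OF X continuous_on_entry_product[OF g, of k l]] by metis
  then obtain B where B: "\<And>k l. 0 \<le> B k l" "\<And>k l x. x \<in> X \<Longrightarrow> \<bar>g x $ k * g x $ l\<bar> \<le> B k l"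
    by metis
  define C where "C = (\<Sum>k\<in>UNIV. \<Sum>l\<in>UNIV. B k l)"
  have "norm (info_op X g \<nu>) \<le> (C + 1) * tv_norm X \<nu>" if \<nu>: "\<nu> \<in> signed_measures X" for \<nu>
  proof -
    have "norm (info_op X g \<nu>) \<le> (\<Sum>k\<in>UNIV. norm (info_op X g \<nu> $ k))"
      by (simp add: norm_vec_def L2_set_le_sum)
    also have "\<dots> \<le> (\<Sum>k\<in>UNIV. \<Sum>l\<in>UNIV. \<bar>info_op X g \<nu> $ k $ l\<bar>)"
      by (intro sum_mono norm_le_l1_cart)
    also have "\<dots> \<le> (\<Sum>k\<in>UNIV. \<Sum>l\<in>UNIV. B k l * tv_norm X \<nu>)"
      using pairing_bound[OF X continuous_on_entry_product[OF g] \<nu> B(2)]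
      by (intro sum_mono) (simp add: info_op_def)
    also have "\<dots> = C * tv_norm X \<nu>" by (simp add: C_def sum_distrib_right)
    also have "\<dots> \<le> (C + 1) * tv_norm X \<nu>" using tv_norm_nonneg[OF \<nu>] by (simp add: distrib_right)
    finally show ?thesis .
  qed
  moreover have "0 < C + 1" using B(1) unfolding C_def by (intro add_nonneg_pos sum_nonneg) auto
  ultimately show ?thesis using that by blast
qed

section \<open>Independent atoms and the removal procedure\<close>

text \<open>The symmetric matrices are spanned by the indicator matrices of the unordered pairs
  \<open>{k, l}\<close>, singletons included.\<close>

lemma dim_Sym_le: "dim (Sym :: (real^'n^'n) set) \<le> CARD('n) * (CARD('n) + 1) div 2"
proof -
  define I where "I = {K :: 'n set. card K = 1} \<union> {K. card K = 2}"
  define E :: "'n set \<Rightarrow> real^'n^'n" where "E K = (\<chi> k l. if {k, l} = K then 1 else 0)" for K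
  have pair: "{k, l} \<in> I" for k l :: 'n
    by (cases "k = l") (auto simp: I_def)
  have "card I = (CARD('n) choose 1) + (CARD('n) choose 2)"
    unfolding I_def using n_subsets[of "UNIV :: 'n set" 1] n_subsets[of "UNIV :: 'n set" 2]
    by (subst card_Un_disjoint) auto
  also have "\<dots> = CARD('n) * (CARD('n) + 1) div 2"
    by (simp add: choose_two algebra_simps) (cases "CARD('n)"; simp)
  finally have card: "card I = CARD('n) * (CARD('n) + 1) div 2" .
  have "A \<in> span (E ` I)" if A: "A \<in> Sym" for A :: "real^'n^'n"
  proof -
    define c where "c K = (SOME a. \<exists>k l. K = {k, l} \<and> a = A $ k $ l)" for K
    have c: "c {k, l} = A $ k $ l" for k l
    proof -
      have sym: "A $ i $ j = A $ j $ i" for i j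
        using A unfolding Sym_def transpose_def by (auto simp: vec_eq_iff)
      have "\<exists>i j. {k, l} = {i, j} \<and> c {k, l} = A $ i $ j"
        unfolding c_def by (rule someI_ex) blast
      then show ?thesis using sym by (auto simp: doubleton_eq_iff)
    qed
    have "A = (\<Sum>K\<in>I. c K *\<^sub>R E K)"
    proof (simp add: vec_eq_iff, intro allI)
      fix k l
      have "(\<Sum>K\<in>I. c K * E K $ k $ l) = (\<Sum>K\<in>I. if K = {k, l} then c K else 0)"
        by (intro sum.cong) (auto simp: E_def)
      also have "\<dots> = A $ k $ l" using pair c by (simp add: sum.delta)
      finally show "A $ k $ l = (\<Sum>K\<in>I. c K * E K $ k $ l)" ..
    qed
    then show ?thesis by (metis (mono_tags, lifting) span_sum span_scale span_base imageI)
  qed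
  then have "dim (Sym :: (real^'n^'n) set) \<le> card (E ` I)"
    by (intro dim_le_card) auto
  also have "\<dots> \<le> card I" by (rule card_image_le) simp
  finally show ?thesis using card by simp
qed

lemma independent_family_card_le:
  fixes g :: "'a::topological_space \<Rightarrow> real^'n"
  assumes P: "finite P" and ind: "\<not> dependent_family X g P"
  shows "card P \<le> CARD('n) * (CARD('n) + 1) div 2"
proof -
  let ?f = "\<lambda>x. info_op X g (dirac X x)"
  have inj: "inj_on ?f P"
  proof (rule ccontr)
    assume "\<not> inj_on ?f P"
    then obtain x y where xy: "x \<in> P" "y \<in> P" "x \<noteq> y" "?f x = ?f y" by (auto simp: inj_on_def)
    \<comment> \<open>Two points with the same matrix are related with coefficients \<open>1\<close> and \<open>-1\<close>.\<close>
    define c :: "'a \<Rightarrow> real" where "c z = (if z = x then 1 else 0) + (if z = y then -1 else 0)" for z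
    have "(\<Sum>z\<in>P. c z *\<^sub>R ?f z) = (\<Sum>z\<in>P. (if z = x then ?f z else 0) + (if z = y then - ?f z else 0))"
      by (intro sum.cong) (auto simp: c_def)
    also have "\<dots> = 0" using P xy by (simp add: sum.distrib)
    finally have "(\<Sum>z\<in>P. c z *\<^sub>R ?f z) = 0" .
    moreover have "c x \<noteq> 0" using xy by (simp add: c_def)
    ultimately show False using ind xy(1) unfolding dependent_family_def by blast
  qed
  have "independent (?f ` P)"
  proof
    assume "dependent (?f ` P)"
    then obtain u where u: "\<exists>v\<in>?f ` P. u v \<noteq> 0" "(\<Sum>v\<in>?f ` P. u v *\<^sub>R v) = 0"
      using P by (auto simp: dependent_finite)
    then have "(\<Sum>x\<in>P. u (?f x) *\<^sub>R ?f x) = 0" by (simp add: sum.reindex[OF inj])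
    then show False using ind u(1) unfolding dependent_family_def by auto
  qed
  then have "card (?f ` P) \<le> dim (Sym :: (real^'n^'n) set)"
    by (intro independent_card_le_dim) (auto simp: info_op_Sym)
  then show ?thesis using dim_Sym_le[where 'n='n] card_image[OF inj] by linarith
qed

lemma atomic_whole:
  "P \<subseteq> X \<Longrightarrow> atomic X P w X = (\<Sum>x\<in>P. w x)"
  unfolding atomic_def by (intro sum.cong) (auto simp: dirac_def)

text \<open>The ratio test picks the largest multiple of the null relation \<open>c\<close> that can be subtracted
  without making a weight negative. The relation leaves the information matrix unchanged, and its sign
  convention lets the mass only decrease.\<close>

lemma removal_step_invariants:
  fixes g :: "'a::topological_space \<Rightarrow> real^'n"
  assumes X: "compact X" and g: "continuous_on X g"
    and P: "finite P" "P \<subseteq> X" "\<forall>x\<in>P. 0 < w x"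
    and c: "\<exists>x\<in>P. c x \<noteq> 0" "(\<Sum>x\<in>P. c x *\<^sub>R info_op X g (dirac X x)) = 0" "0 \<le> (\<Sum>x\<in>P. c x)"
    and \<mu>: "\<mu> = Max ((\<lambda>x. c x / w x) ` P)" and w': "w' = (\<lambda>x. w x - c x / \<mu>)"
  shows "info_op X g (atomic X {x \<in> P. 0 < w' x} w') = info_op X g (atomic X P w)"
    and "atomic X {x \<in> P. 0 < w' x} w' X \<le> atomic X P w X"
proof -
  have le: "c x / w x \<le> \<mu>" if "x \<in> P" for x
    unfolding \<mu> using that P(1) by (intro Max_ge) auto
  have "\<exists>x\<in>P. 0 < c x"
  proof (rule ccontr)
    assume "\<not> ?thesis"
    then have np: "\<And>x. x \<in> P \<Longrightarrow> c x \<le> 0" by force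
    then have "(\<Sum>x\<in>P. c x) = 0" using c(3) by (simp add: order_antisym sum_nonpos)
    then have "\<forall>x\<in>P. c x = 0" using sum_nonneg_eq_0_iff[OF P(1), of "\<lambda>x. - c x"] np by (simp add: sum_negf)
    then show False using c(1) by blast
  qed
  then obtain y where y: "y \<in> P" "0 < c y" by blast
  then have \<mu>0: "0 < \<mu>" using le[OF y(1)] P(3) by (smt (verit) divide_pos_pos)
  have nonneg: "0 \<le> w' x" if "x \<in> P" for x
  proof -
    have "0 < w x" using P(3) that by blast
    then have "c x \<le> \<mu> * w x" using le[OF that] by (simp add: field_simps)
    then show ?thesis using \<mu>0 by (simp add: w' field_simps)
  qed
  have drop: "(\<Sum>x\<in>{x \<in> P. 0 < w' x}. w' x *\<^sub>R F x) = (\<Sum>x\<in>P. w' x *\<^sub>R F x)" for F :: "'a \<Rightarrow> 'b::real_vector"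
    using P(1) nonneg by (intro sum.mono_neutral_left) (auto simp: order_less_le)
  have "info_op X g (atomic X {x \<in> P. 0 < w' x} w') = (\<Sum>x\<in>P. w' x *\<^sub>R info_op X g (dirac X x))"
    using P by (subst info_op_atomic[OF X g]) (auto simp: drop)
  also have "\<dots> = (\<Sum>x\<in>P. w x *\<^sub>R info_op X g (dirac X x)) - (1 / \<mu>) *\<^sub>R (\<Sum>x\<in>P. c x *\<^sub>R info_op X g (dirac X x))"
    by (simp add: w' scaleR_left_diff_distrib sum_subtractf scaleR_sum_right)
  also have "\<dots> = info_op X g (atomic X P w)"
    using c(2) P by (simp add: info_op_atomic[OF X g])
  finally show "info_op X g (atomic X {x \<in> P. 0 < w' x} w') = info_op X g (atomic X P w)" .
  have "atomic X {x \<in> P. 0 < w' x} w' X = (\<Sum>x\<in>P. w' x)"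
    using drop[of "\<lambda>_. 1 :: real"] P(2) by (subst atomic_whole) auto
  also have "\<dots> = (\<Sum>x\<in>P. w x) - (\<Sum>x\<in>P. c x) / \<mu>"
    by (simp add: w' sum_subtractf sum_divide_distrib)
  also have "\<dots> \<le> (\<Sum>x\<in>P. w x)" using c(3) \<mu>0 by simp
  finally show "atomic X {x \<in> P. 0 < w' x} w' X \<le> atomic X P w X"
    using P(2) by (simp add: atomic_whole)
qed

lemma removal_invariants:
  fixes g :: "'a::topological_space \<Rightarrow> real^'n"
  assumes X: "compact X" and g: "continuous_on X g" and r: "removal X g \<omega> \<omega>'"
  shows "info_op X g \<omega>' = info_op X g \<omega> \<and> \<omega>' X \<le> \<omega> X \<and>
    (\<exists>P w. finite P \<and> P \<subseteq> X \<and> (\<forall>x\<in>P. 0 < w x) \<and> card P \<le> CARD('n) * (CARD('n) + 1) div 2 \<and>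
      \<omega>' = atomic X P w)"
  using r
proof (induction rule: removal.induct)
  case (stop P w)
  then show ?case using independent_family_card_le[of P X g] by blast
next
  case (step P w c \<mu> w_new \<omega>')
  note inv = removal_step_invariants[OF X g step.hyps(1,2,3,5,6,7,8,9)]
  then show ?case using step.IH by fastforce
qed

section \<open>Design criteria\<close>

lemma PD_subset_NND: "PD \<subseteq> NND"
proof
  fix A :: "real^'n^'n" assume A: "A \<in> PD"
  have "0 \<le> x \<bullet> (A *v x)" for x
    using A by (cases "x = 0") (auto simp: PD_def intro: less_imp_le)
  then show "A \<in> NND" using A by (simp add: PD_def NND_def)
qed

lemma NND_subset_Sym: "NND \<subseteq> Sym"
  by (auto simp: NND_def)

lemma quadratic_lincomb:
  fixes A B :: "real^'n^'n"
  shows "x \<bullet> ((a *\<^sub>R A + b *\<^sub>R B) *v x) = a * (x \<bullet> (A *v x)) + b * (x \<bullet> (B *v x))"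
  by (simp add: inner_vec_def matrix_vector_mult_def sum_distrib_left sum.distrib distrib_left distrib_right mult_ac)

lemma lincomb_Sym: "A \<in> Sym \<Longrightarrow> B \<in> Sym \<Longrightarrow> a *\<^sub>R A + b *\<^sub>R B \<in> Sym"
  by (auto simp: Sym_def transpose_def vec_eq_iff)

lemma lincomb_NND: "A \<in> NND \<Longrightarrow> B \<in> NND \<Longrightarrow> 0 \<le> a \<Longrightarrow> 0 \<le> b \<Longrightarrow> a *\<^sub>R A + b *\<^sub>R B \<in> NND"
  by (auto simp: NND_def lincomb_Sym quadratic_lincomb)

lemma lincomb_PD:
  assumes A: "A \<in> PD" and B: "B \<in> NND" and ab: "0 < a" "0 \<le> b"
  shows "a *\<^sub>R A + b *\<^sub>R B \<in> PD"
proof -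
  have "0 < a * (x \<bullet> (A *v x)) + b * (x \<bullet> (B *v x))" if "x \<noteq> 0" for x
    using assms that by (intro add_pos_nonneg) (auto simp: PD_def NND_def)
  then show ?thesis using A B by (simp add: PD_def NND_def lincomb_Sym quadratic_lincomb)
qed

lemma segment_eq: "A + t *\<^sub>R (B - A) = (1 - t) *\<^sub>R A + t *\<^sub>R (B :: 'a::real_vector)"
  by (simp add: algebra_simps)

lemma closed_NND: "closed (NND :: (real^'n^'n) set)"
proof -
  have "NND = (\<Inter>k l. {A :: real^'n^'n. A $ l $ k = A $ k $ l}) \<inter> (\<Inter>x. {A. 0 \<le> x \<bullet> (A *v x)})"
    unfolding NND_def Sym_def transpose_def vec_eq_iff by auto
  also have "closed \<dots>"
  proof (intro closed_Int closed_INT ballI)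
    show "closed {A :: real^'n^'n. A $ l $ k = A $ k $ l}" for k l
      by (intro closed_Collect_eq continuous_intros)
    show "closed {A :: real^'n^'n. 0 \<le> x \<bullet> (A *v x)}" for x
      unfolding inner_vec_def matrix_vector_mult_def
      by (intro closed_Collect_le) (auto intro!: continuous_intros)
  qed
  finally show ?thesis .
qed

lemma design_criterion_nonneg: "design_criterion \<Psi> \<Psi>' \<Longrightarrow> A \<in> NND \<Longrightarrow> 0 \<le> \<Psi> A"
  by (simp add: design_criterion_def)

lemma design_criterion_PD_iff:
  assumes "design_criterion \<Psi> \<Psi>'" "A \<in> Sym"
  shows "A \<in> PD \<longleftrightarrow> \<Psi> A < \<infinity>"
proof -
  have "{N \<in> Sym. \<Psi> N < \<infinity>} = PD" using assms(1) by (simp add: design_criterion_def)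
  then show ?thesis using assms(2) by blast
qed

lemma design_criterion_real:
  assumes "design_criterion \<Psi> \<Psi>'" "A \<in> PD"
  shows "\<Psi> A = ereal (real_of_ereal (\<Psi> A))"
proof -
  have "A \<in> NND" "A \<in> Sym" using assms(2) PD_subset_NND NND_subset_Sym by blast+
  then have "0 \<le> \<Psi> A" "\<Psi> A < \<infinity>"
    using design_criterion_nonneg[OF assms(1)] design_criterion_PD_iff[OF assms(1)] assms(2) by blast+
  then show ?thesis by (cases "\<Psi> A") auto
qed

lemma design_criterion_convex:
  assumes "design_criterion \<Psi> \<Psi>'" "A \<in> NND" "B \<in> NND" "0 \<le> t" "t \<le> 1"
  shows "\<Psi> (A + t *\<^sub>R (B - A)) \<le> ereal (1 - t) * \<Psi> A + ereal t * \<Psi> B"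
proof -
  have "\<forall>A\<in>NND. \<forall>B\<in>NND. \<forall>t\<in>{0..1}.
      \<Psi> ((1 - t) *\<^sub>R A + t *\<^sub>R B) \<le> ereal (1 - t) * \<Psi> A + ereal t * \<Psi> B"
    using assms(1) by (simp add: design_criterion_def)
  from bspec[OF bspec[OF bspec[OF this assms(2)] assms(3)], of t] assms(4,5)
  show ?thesis by (simp only: segment_eq) simp
qed

lemma design_criterion_lsc:
  assumes \<Psi>: "design_criterion \<Psi> \<Psi>'"
    and N: "\<And>j. N j \<in> NND" "N \<longlonglongrightarrow> A" and le: "\<And>j. \<Psi> (N j) \<le> ereal (a j)" and a: "a \<longlonglongrightarrow> b"
  shows "\<Psi> A \<le> ereal b"
proof (rule ccontr)
  have A: "A \<in> NND" using closed_NND N by (rule closed_sequentially)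
  assume "\<not> ?thesis"
  then have "ereal b < \<Psi> A" by simp
  then obtain c where c: "b < c" "ereal c < \<Psi> A"
    using ereal_dense2[of "ereal b" "\<Psi> A"] by auto
  have "\<Psi> A \<le> Liminf (at A within NND) \<Psi>" using \<Psi> A by (simp add: design_criterion_def)
  with c(2) have "ereal c < Liminf (at A within NND) \<Psi>" by (rule less_le_trans)
  then have "eventually (\<lambda>B. ereal c < \<Psi> B) (at A within NND)" by (rule less_LiminfD)
  then obtain d where d: "0 < d" "\<And>B. B \<in> NND \<Longrightarrow> B \<noteq> A \<Longrightarrow> dist B A < d \<Longrightarrow> ereal c < \<Psi> B"
    unfolding eventually_at by blast
  have "eventually (\<lambda>j. dist (N j) A < d) sequentially" using tendstoD[OF N(2) d(1)] .
  moreover have "eventually (\<lambda>j. a j < c) sequentially" using order_tendstoD(2)[OF a c(1)] .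
  ultimately have "eventually (\<lambda>j. False) sequentially"
  proof eventually_elim
    case (elim j)
    \<comment> \<open>The lower limit leaves out the point \<open>A\<close> itself.\<close>
    have "ereal c < \<Psi> (N j)" using d(2)[OF N(1)] elim(1) c(2) by (cases "N j = A") auto
    also have "\<dots> \<le> ereal (a j)" by (rule le)
    finally show False using elim(2) by simp
  qed
  then show False by simp
qed

text \<open>As \<open>\<Psi>\<close> is infinite on the boundary of the positive definite matrices, lower semicontinuity keeps the sublevel
  sets away from it.\<close>

lemma compact_sublevel:
  assumes \<Psi>: "design_criterion \<Psi> \<Psi>'"
  shows "compact {A \<in> NND. \<Psi> A \<le> ereal a \<and> norm A \<le> r}" and "{A \<in> NND. \<Psi> A \<le> ereal a \<and> norm A \<le> r} \<subseteq> PD"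
proof -
  let ?K = "{A \<in> NND. \<Psi> A \<le> ereal a \<and> norm A \<le> r}"
  have "closed ?K"
    unfolding closed_sequential_limits
  proof (intro allI impI)
    fix N A assume N: "(\<forall>j. N j \<in> ?K) \<and> N \<longlonglongrightarrow> A"
    then have "A \<in> NND" using closed_sequentially[OF closed_NND] by blast
    moreover have "\<Psi> A \<le> ereal a"
      by (rule design_criterion_lsc[OF \<Psi>, of N _ "\<lambda>_. a"]) (use N in auto)
    moreover have "norm A \<le> r"
      by (rule Lim_norm_ubound[of sequentially N]) (use N in auto)
    ultimately show "A \<in> ?K" by simp
  qed
  moreover have "bounded ?K" by (auto simp: bounded_iff)
  ultimately show "compact ?K" by (simp add: compact_eq_bounded_closed)
  show "?K \<subseteq> PD"
  proof
    fix A assume A: "A \<in> ?K"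
    then have "A \<in> Sym" "\<Psi> A < \<infinity>" using NND_subset_Sym by (auto intro: le_less_trans)
    then show "A \<in> PD" using design_criterion_PD_iff[OF \<Psi>] by blast
  qed
qed

lemma line_derivative:
  assumes \<Psi>: "design_criterion \<Psi> \<Psi>'" and PD: "\<And>t. t \<in> T \<Longrightarrow> A + t *\<^sub>R D \<in> PD" and t: "t \<in> T"
  shows "((\<lambda>t. real_of_ereal (\<Psi> (A + t *\<^sub>R D))) has_real_derivative \<Psi>' (A + t *\<^sub>R D) \<bullet> D) (at t within T)"
proof -
  let ?f = "\<lambda>B. real_of_ereal (\<Psi> B)"
  have "(?f has_derivative (\<lambda>H. \<Psi>' (A + t *\<^sub>R D) \<bullet> H)) (at (A + t *\<^sub>R D) within PD)"
    using \<Psi> PD[OF t] by (simp add: design_criterion_def)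
  then have "(?f has_derivative (\<lambda>H. \<Psi>' (A + t *\<^sub>R D) \<bullet> H)) (at (A + t *\<^sub>R D) within (\<lambda>t. A + t *\<^sub>R D) ` T)"
    by (rule has_derivative_subset) (use PD in auto)
  moreover have "((\<lambda>t. A + t *\<^sub>R D) has_derivative (\<lambda>h. h *\<^sub>R D)) (at t within T)"
    by (auto intro!: derivative_eq_intros)
  ultimately have "((\<lambda>t. ?f (A + t *\<^sub>R D)) has_derivative (\<lambda>h. \<Psi>' (A + t *\<^sub>R D) \<bullet> (h *\<^sub>R D))) (at t within T)"
    by (rule has_derivative_in_compose[rotated])
  then show ?thesis by (simp add: has_field_derivative_def mult_commute_abs)
qed

text \<open>By convexity the difference quotients at \<open>0\<close> along the segment are at most the increment over the whole segment.\<close>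

lemma gradient_inequality:
  assumes \<Psi>: "design_criterion \<Psi> \<Psi>'" and A: "A \<in> PD" and B: "B \<in> PD"
  shows "real_of_ereal (\<Psi> A) + \<Psi>' A \<bullet> (B - A) \<le> real_of_ereal (\<Psi> B)"
proof -
  let ?f = "\<lambda>t. real_of_ereal (\<Psi> (A + t *\<^sub>R (B - A)))"
  have NND: "A \<in> NND" "B \<in> NND" using A B PD_subset_NND by blast+
  have PD: "A + t *\<^sub>R (B - A) \<in> PD" if "t \<in> {0..1}" for t
    using lincomb_PD[OF A NND(2), of "1 - t" t] B that unfolding segment_eq by (cases "t = 1") auto
  have "(?f has_real_derivative \<Psi>' A \<bullet> (B - A)) (at 0 within {0..1})"
    using line_derivative[OF \<Psi> PD, of "{0..1}" 0] by simp
  then have "((\<lambda>t. (?f t - ?f 0) / (t - 0)) \<longlongrightarrow> \<Psi>' A \<bullet> (B - A)) (at 0 within {0..1})"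
    unfolding has_field_derivative_iff .
  moreover have "eventually (\<lambda>t. (?f t - ?f 0) / (t - 0) \<le> ?f 1 - ?f 0) (at 0 within {0..1})"
    unfolding eventually_at
  proof (intro exI[of _ 1] conjI ballI impI)
    fix t :: real assume t: "t \<in> {0..1}" "t \<noteq> 0 \<and> dist t 0 < 1"
    have "\<Psi> (A + t *\<^sub>R (B - A)) \<le> ereal (1 - t) * \<Psi> A + ereal t * \<Psi> B"
      using t by (intro design_criterion_convex[OF \<Psi> NND]) auto
    also have "\<dots> = ereal ((1 - t) * real_of_ereal (\<Psi> A) + t * real_of_ereal (\<Psi> B))"
      by (subst design_criterion_real[OF \<Psi> A], subst design_criterion_real[OF \<Psi> B]) simp
    finally have "?f t \<le> (1 - t) * ?f 0 + t * ?f 1"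
      using design_criterion_real[OF \<Psi> PD[OF t(1)]] by (metis add_0_right diff_add_cancel add.commute ereal_less_eq(3) scaleR_one scaleR_zero_left)
    then have "?f t - ?f 0 \<le> t * (?f 1 - ?f 0)" by (simp add: algebra_simps)
    then show "(?f t - ?f 0) / (t - 0) \<le> ?f 1 - ?f 0" using t by (simp add: field_simps)
  qed simp
  moreover have "at (0::real) within {0..1} \<noteq> bot"
    by (simp add: at_within_Icc_at_right)
  ultimately have "\<Psi>' A \<bullet> (B - A) \<le> ?f 1 - ?f 0" by (intro tendsto_upperbound)
  then show ?thesis by simp
qed

text \<open>The mean value theorem for the difference between \<open>\<Psi>\<close> along the line and the quadratic model, whose
  derivative is nonpositive. Derivatives are taken within the interval because \<open>\<Psi>\<close> is differentiable within
  \<open>PD\<close> only.\<close>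

lemma taylor_upper:
  assumes \<Psi>: "design_criterion \<Psi> \<Psi>'" and s: "0 \<le> s" and PD: "\<And>t. t \<in> {0..s} \<Longrightarrow> A + t *\<^sub>R D \<in> PD"
    and lip: "\<And>t. t \<in> {0..s} \<Longrightarrow> \<bar>\<Psi>' (A + t *\<^sub>R D) \<bullet> D - \<Psi>' A \<bullet> D\<bar> \<le> C * t"
  shows "real_of_ereal (\<Psi> (A + s *\<^sub>R D)) \<le> real_of_ereal (\<Psi> A) + s * (\<Psi>' A \<bullet> D) + C * s\<^sup>2 / 2"
proof -
  let ?f = "\<lambda>t. real_of_ereal (\<Psi> (A + t *\<^sub>R D)) - t * (\<Psi>' A \<bullet> D) - C * t\<^sup>2 / 2"
  let ?d = "\<lambda>t. \<Psi>' (A + t *\<^sub>R D) \<bullet> D - \<Psi>' A \<bullet> D - C * t"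
  have der: "(?f has_derivative (\<lambda>h. h * ?d t)) (at t within {0..s})" if "t \<in> {0..s}" for t
  proof -
    have "(?f has_real_derivative ?d t) (at t within {0..s})"
      using line_derivative[OF \<Psi> PD that]
      by (auto intro!: derivative_eq_intros)
    then show ?thesis by (simp add: has_field_derivative_def mult_commute_abs)
  qed
  have "\<exists>t\<in>{0..s}. ?f s - ?f 0 = (s - 0) * ?d t"
    by (rule mvt_very_simple[OF s]) (use der in auto)
  then obtain t where t: "t \<in> {0..s}" "?f s - ?f 0 = s * ?d t" by auto
  have "?d t \<le> 0" using lip[OF t(1)] by (simp add: abs_le_iff)
  then have "?f s - ?f 0 \<le> 0" unfolding t(2) using s by (rule mult_nonneg_nonpos[rotated])
  then show ?thesis by simp
qed

text \<open>Let \<open>k s = \<Psi> (A + s (B - A)) + s e\<close>, so that \<open>- \<phi>\<close> is the slope of \<open>k\<close> at \<open>0\<close>. As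
  \<open>k\<close> is convex, \<open>k s \<le> k 0\<close> puts the whole segment into the sublevel set of \<open>k 0\<close>, where the
  gradient is Lipschitz, and the quadratic model gives the claim. If \<open>k s > k 0\<close>, then
  \<open>k\<close> returns to the value \<open>k 0\<close> at some earlier point, at which the quadratic model still predicts a strict decrease.
  At the end \<open>s = 1\<close> the value of \<open>\<Psi>\<close> may be infinite, and lower semicontinuity supplies
  a finite value above \<open>k 0\<close> before it.\<close>

lemma sufficient_decrease:
  fixes A B :: "real^'n^'n"
  assumes \<Psi>: "design_criterion \<Psi> \<Psi>'" and A: "A \<in> PD" and B: "B \<in> NND"
    and \<phi>: "\<phi> = - (\<Psi>' A \<bullet> (B - A)) - e" "0 < \<phi>" and \<alpha>: "0 < \<alpha>" and C: "0 \<le> C"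
    and lip: "\<And>t. 0 \<le> t \<Longrightarrow> t \<le> 1 \<Longrightarrow> \<Psi> (A + t *\<^sub>R (B - A)) \<le> ereal (real_of_ereal (\<Psi> A) - t * e) \<Longrightarrow>
        \<bar>\<Psi>' (A + t *\<^sub>R (B - A)) \<bullet> (B - A) - \<Psi>' A \<bullet> (B - A)\<bar> \<le> C * t"
    and s: "0 \<le> s" "s \<le> 1" "C * s \<le> 2 * (1 - \<alpha>) * \<phi>"
  shows "\<Psi> (A + s *\<^sub>R (B - A)) \<le> ereal (real_of_ereal (\<Psi> A) - s * e - \<alpha> * s * \<phi>)"
proof -
  let ?N = "\<lambda>t. A + t *\<^sub>R (B - A)"
  define f where "f t = real_of_ereal (\<Psi> (?N t))" for t
  have f0: "f 0 = real_of_ereal (\<Psi> A)" by (simp add: f_def)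
  have A': "A \<in> NND" using A PD_subset_NND by blast
  have NND: "?N t \<in> NND" if "0 \<le> t" "t \<le> 1" for t
    using lincomb_NND[OF A' B, of "1 - t" t] that unfolding segment_eq by simp
  have PD: "?N t \<in> PD" if "0 \<le> t" "t < 1" for t
    using lincomb_PD[OF A B, of "1 - t" t] that unfolding segment_eq by simp
  have real: "\<Psi> (?N t) = ereal (f t)" if "?N t \<in> PD" for t
    unfolding f_def by (rule design_criterion_real[OF \<Psi> that])
  have model: "f t \<le> f 0 - t * e - t * \<phi> + C * t\<^sup>2 / 2"
    if t: "0 \<le> t" "t \<le> 1" and le: "\<Psi> (?N t) \<le> ereal (f 0 - t * e)" for t
  proof -
    have "\<Psi> (?N t) < \<infinity>" using le by (rule le_less_trans) simp
    then have Nt: "?N t \<in> PD"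
      using design_criterion_PD_iff[OF \<Psi>] NND[OF t] NND_subset_Sym by blast
    have "?N r \<in> PD \<and> \<Psi> (?N r) \<le> ereal (f 0 - r * e)" if r: "r \<in> {0..t}" for r
    proof (cases "t = 0")
      case True
      then show ?thesis using r Nt le by simp
    next
      case False
      define q where "q = r / t"
      have q: "0 \<le> q" "q \<le> 1" "r = q * t" using r False t by (auto simp: q_def)
      have Nr: "?N r = A + q *\<^sub>R (?N t - A)" by (simp add: q(3))
      have ft: "f t \<le> f 0 - t * e" using le real[OF Nt] by simp
      have "\<Psi> (?N r) \<le> ereal (1 - q) * \<Psi> A + ereal q * \<Psi> (?N t)"
        unfolding Nr by (rule design_criterion_convex[OF \<Psi> A' NND[OF t] q(1,2)])
      also have "\<dots> = ereal ((1 - q) * f 0 + q * f t)"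
        unfolding real[OF Nt] f0 by (subst design_criterion_real[OF \<Psi> A]) simp
      also have "\<dots> \<le> ereal ((1 - q) * f 0 + q * (f 0 - t * e))"
        using mult_left_mono[OF ft q(1)] by simp
      also have "\<dots> = ereal (f 0 - r * e)" by (simp add: q(3) algebra_simps)
      finally have le: "\<Psi> (?N r) \<le> ereal (f 0 - r * e)" .
      then have "\<Psi> (?N r) < \<infinity>" by (rule le_less_trans) simp
      then have "?N r \<in> PD"
        using design_criterion_PD_iff[OF \<Psi>] NND[of r] NND_subset_Sym r t by auto
      with le show ?thesis by blast
    qed
    then have "f t \<le> f 0 + t * (\<Psi>' A \<bullet> (B - A)) + C * t\<^sup>2 / 2"
      unfolding f_def using taylor_upper[OF \<Psi> t(1), of A "B - A" C] lip t f0 by simp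
    then show ?thesis by (simp add: \<phi>(1) algebra_simps)
  qed
  have "\<Psi> (?N s) \<le> ereal (f 0 - s * e)"
  proof (rule ccontr)
    assume neg: "\<not> ?thesis"
    \<comment> \<open>A point before \<open>1\<close>, hence with finite value, at which \<open>k\<close> exceeds \<open>k 0\<close>.\<close>
    have "\<exists>u. 0 < u \<and> u \<le> s \<and> u < 1 \<and> f 0 - u * e < f u"
    proof (rule ccontr)
      assume no: "\<not> ?thesis"
      have s0: "s \<noteq> 0" using neg real[of 0] A by auto
      have "s = 1"
      proof (rule ccontr)
        assume "s \<noteq> 1"
        then have "0 < s" "s < 1" using s s0 by auto
        then have "f s \<le> f 0 - s * e" using no by force
        then show False using neg real[OF PD] \<open>0 < s\<close> \<open>s < 1\<close> by simp
      qed
      define t where "t j = 1 - 1 / real (Suc (Suc j))" for j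
      have t: "0 < t j" "t j < 1" for j by (auto simp: t_def field_simps)
      have "(\<lambda>j. 1 / real (Suc (Suc j))) \<longlonglongrightarrow> 0"
        by (rule LIMSEQ_Suc[OF LIMSEQ_Suc[OF lim_1_over_n]])
      then have "t \<longlonglongrightarrow> 1 - 0" unfolding t_def by (intro tendsto_intros)
      then have tlim: "t \<longlonglongrightarrow> 1" by simp
      have "\<Psi> (?N 1) \<le> ereal (f 0 - 1 * e)"
      proof (rule design_criterion_lsc[OF \<Psi>, of "\<lambda>j. ?N (t j)" _ "\<lambda>j. f 0 - t j * e"])
        show "?N (t j) \<in> NND" for j using NND[of "t j"] t[of j] by simp
        show "(\<lambda>j. ?N (t j)) \<longlonglongrightarrow> ?N 1" by (intro tendsto_intros tlim)
        show "\<Psi> (?N (t j)) \<le> ereal (f 0 - t j * e)" for j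
          using no t[of j] real[OF PD, of "t j"] \<open>s = 1\<close> by force
        show "(\<lambda>j. f 0 - t j * e) \<longlonglongrightarrow> f 0 - 1 * e" by (intro tendsto_intros tlim)
      qed
      then show False using neg \<open>s = 1\<close> by simp
    qed
    then obtain u where u: "0 < u" "u \<le> s" "u < 1" "f 0 - u * e < f u" by blast
    let ?k = "\<lambda>t. f t + t * e"
    have der: "(?k has_real_derivative \<Psi>' (?N t) \<bullet> (B - A) + e) (at t within {0..u})" if "t \<in> {0..u}" for t
      unfolding f_def
      using line_derivative[OF \<Psi>, of "{0..u}" A "B - A" t] PD u that
      by (auto intro!: derivative_eq_intros)
    have "(?k has_real_derivative - \<phi>) (at 0 within {0..u})" using der[of 0] u by (simp add: \<phi>(1) add.commute)
    from has_real_derivative_neg_dec_right[OF this]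
    obtain d where d: "0 < d" "\<And>h. 0 < h \<Longrightarrow> h \<in> {0..u} \<Longrightarrow> h < d \<Longrightarrow> ?k h < ?k 0"
      using \<phi>(2) by auto
    define h where "h = min (u / 2) (d / 2)"
    have h: "0 < h" "h < u" "h < d" using u d by (auto simp: h_def min_def)
    have "continuous_on {h..u} ?k"
      using DERIV_continuous_on[OF der] continuous_on_subset[of "{0..u}" ?k "{h..u}"] h by auto
    then obtain t where t: "h \<le> t" "t \<le> u" "?k t = ?k 0"
      using IVT'[of ?k h "?k 0" u] d(2)[of h] h u by auto
    have tt: "0 < t" "t < 1" "t \<le> s" using t h u by auto
    have ft: "f t = f 0 - t * e" using t(3) by simp
    have "f t \<le> f 0 - t * e - t * \<phi> + C * t\<^sup>2 / 2"
      by (rule model) (use tt real[OF PD, of t] ft in auto)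
    then have "t * (2 * \<phi>) \<le> t * (C * t)" using ft by (simp add: power2_eq_square mult_ac)
    then have "2 * \<phi> \<le> C * t" using tt(1) by simp
    also have "\<dots> \<le> C * s" using tt(3) C by (rule mult_left_mono)
    also have "\<dots> \<le> 2 * (1 - \<alpha>) * \<phi>" by (rule s(3))
    finally have "\<alpha> * \<phi> \<le> 0" by (simp add: algebra_simps)
    then show False using \<alpha> \<phi>(2) by (simp add: mult_le_0_iff)
  qed
  from model[OF s(1,2) this] this
  have le: "f s \<le> f 0 - s * e - s * \<phi> + C * s\<^sup>2 / 2" and fin: "\<Psi> (?N s) < \<infinity>"
    by (auto intro: le_less_trans)
  have "C * s\<^sup>2 / 2 \<le> s * ((1 - \<alpha>) * \<phi>)"
    using mult_left_mono[OF s(3) s(1)] by (simp add: power2_eq_square algebra_simps)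
  then have "f s \<le> f 0 - s * e - \<alpha> * s * \<phi>" using le by (simp add: algebra_simps)
  moreover have "?N s \<in> PD"
    using fin design_criterion_PD_iff[OF \<Psi>] NND[OF s(1,2)] NND_subset_Sym by blast
  ultimately show ?thesis using real f0 by simp
qed

section \<open>The modified mass penalty\<close>

text \<open>The modified penalty adds a multiple of the squared excess over \<open>M0\<close>; in this form its convexity and
  \<open>t \<le> phi M0 t\<close> are visible.\<close>

lemma phi_eq: "0 < M0 \<Longrightarrow> phi M0 t = t + (max 0 (t - M0))\<^sup>2 / (2 * M0)"
  by (auto simp: phi_def max_def power2_eq_square field_simps)

lemma phi_id: "t \<le> M0 \<Longrightarrow> phi M0 t = t"
  by (simp add: phi_def)

lemma phi_ge: "0 < M0 \<Longrightarrow> t \<le> phi M0 t"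
  by (simp add: phi_eq)

lemma phi_convex:
  assumes M0: "0 < M0" and s: "0 \<le> s" "s \<le> 1"
  shows "phi M0 ((1 - s) * a + s * b) \<le> (1 - s) * phi M0 a + s * phi M0 b"
proof -
  let ?m = "\<lambda>t. max 0 (t - M0)"
  have 1: "(1 - s) * (a - M0) \<le> (1 - s) * ?m a" "s * (b - M0) \<le> s * ?m b"
    using s by (auto intro!: mult_left_mono)
  have "?m ((1 - s) * a + s * b) \<le> (1 - s) * ?m a + s * ?m b"
  proof (rule max.boundedI)
    show "0 \<le> (1 - s) * ?m a + s * ?m b" using s by simp
    show "(1 - s) * a + s * b - M0 \<le> (1 - s) * ?m a + s * ?m b" using 1 by (simp add: algebra_simps)
  qed
  then have "(?m ((1 - s) * a + s * b))\<^sup>2 \<le> ((1 - s) * ?m a + s * ?m b)\<^sup>2"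
    by (intro power_mono) auto
  also have "\<dots> = (1 - s) * (?m a)\<^sup>2 + s * (?m b)\<^sup>2 - s * (1 - s) * (?m a - ?m b)\<^sup>2"
    by (simp add: power2_eq_square algebra_simps)
  also have "\<dots> \<le> (1 - s) * (?m a)\<^sup>2 + s * (?m b)\<^sup>2"
    using s by simp
  finally have "(?m ((1 - s) * a + s * b))\<^sup>2 / (2 * M0) \<le> ((1 - s) * (?m a)\<^sup>2 + s * (?m b)\<^sup>2) / (2 * M0)"
    using M0 by (simp add: divide_right_mono)
  then have "(?m ((1 - s) * a + s * b))\<^sup>2 / (2 * M0)
      \<le> (1 - s) * ((?m a)\<^sup>2 / (2 * M0)) + s * ((?m b)\<^sup>2 / (2 * M0))"
    by (simp add: add_divide_distrib)
  moreover have "(1 - s) * phi M0 a + s * phi M0 b = ((1 - s) * a + s * b)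
      + ((1 - s) * ((?m a)\<^sup>2 / (2 * M0)) + s * ((?m b)\<^sup>2 / (2 * M0)))"
    unfolding phi_eq[OF M0] distrib_left by linarith
  ultimately show ?thesis unfolding phi_eq[OF M0] by linarith
qed

text \<open>The inserted weight maximizes \<open>a t - \<beta> phi M0 t\<close> over \<open>t \<ge> 0\<close>: for \<open>a > \<beta>\<close> the
  quadratic branch has its vertex at \<open>M0 a / \<beta>\<close>.\<close>

lemma phi_maximizer:
  assumes M0: "0 < M0" and \<beta>: "0 < \<beta>" and t: "0 \<le> t"
  shows "a * t - \<beta> * phi M0 t
    \<le> a * (if a \<le> \<beta> then 0 else M0 / \<beta> * a) - \<beta> * phi M0 (if a \<le> \<beta> then 0 else M0 / \<beta> * a)"
proof (cases "a \<le> \<beta>")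
  case True
  have "a * t \<le> \<beta> * t" using True t by (rule mult_right_mono)
  also have "\<dots> \<le> \<beta> * phi M0 t" using phi_ge[OF M0] \<beta> by simp
  finally show ?thesis using True M0 by (simp add: phi_id)
next
  case False
  let ?\<theta> = "M0 / \<beta> * a"
  have \<theta>: "M0 < ?\<theta>" using False M0 \<beta> by (simp add: field_simps)
  then have opt: "a * ?\<theta> - \<beta> * phi M0 ?\<theta> = M0 * (a\<^sup>2 - \<beta>\<^sup>2) / (2 * \<beta>)"
    using M0 \<beta> by (simp add: phi_def power2_eq_square field_simps)
  have "a * t - \<beta> * phi M0 t \<le> M0 * (a\<^sup>2 - \<beta>\<^sup>2) / (2 * \<beta>)"
  proof (cases "t \<le> M0")
    case True
    have "a * t - \<beta> * phi M0 t = (a - \<beta>) * t" using True by (simp add: phi_id algebra_simps)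
    also have "\<dots> \<le> (a - \<beta>) * M0" using True False by (intro mult_left_mono) auto
    also have "\<dots> \<le> (a - \<beta>) * M0 * ((a + \<beta>) / (2 * \<beta>))"
      using False M0 \<beta> by (intro mult_le_cancel_left1[THEN iffD2]) (auto simp: field_simps)
    also have "\<dots> = M0 * (a\<^sup>2 - \<beta>\<^sup>2) / (2 * \<beta>)" by (simp add: power2_eq_square algebra_simps)
    finally show ?thesis .
  next
    case F: False
    have "M0 * (a\<^sup>2 - \<beta>\<^sup>2) / (2 * \<beta>) - (a * t - \<beta> * phi M0 t) = \<beta> * (t - ?\<theta>)\<^sup>2 / (2 * M0)"
      using F M0 \<beta> by (simp add: phi_def power2_eq_square field_simps)
    moreover have "0 \<le> \<beta> * (t - ?\<theta>)\<^sup>2 / (2 * M0)" using M0 \<beta> by simp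
    ultimately show ?thesis by linarith
  qed
  then show ?thesis using False opt by simp
qed

section \<open>A single iteration\<close>

locale design_problem =
  fixes X :: "'a::metric_space set" and g :: "'a \<Rightarrow> real^'n" and I0 :: "real^'n^'n"
    and \<Psi> :: "real^'n^'n \<Rightarrow> ereal" and \<Psi>' :: "real^'n^'n \<Rightarrow> real^'n^'n" and \<beta> :: real
  assumes X: "compact X" "X \<noteq> {}" and g: "continuous_on X g" and I0: "I0 \<in> NND"
    and \<Psi>: "design_criterion \<Psi> \<Psi>'" and \<beta>: "0 < \<beta>"
begin

abbreviation J :: "('a set \<Rightarrow> real) \<Rightarrow> real^'n^'n" where "J \<omega> \<equiv> info_op X g \<omega> + I0"
abbreviation F :: "('a set \<Rightarrow> real) \<Rightarrow> ereal" where "F \<equiv> objective X g I0 \<Psi> \<beta>"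
abbreviation d\<psi> :: "('a set \<Rightarrow> real) \<Rightarrow> 'a \<Rightarrow> real" where "d\<psi> \<equiv> dpsi X g I0 \<Psi>'"
abbreviation gap :: "real \<Rightarrow> ('a set \<Rightarrow> real) \<Rightarrow> real" where "gap \<equiv> primal_dual_gap X g I0 \<Psi>' \<beta>"

lemma J_NND: "\<omega> \<in> positive_measures X \<Longrightarrow> J \<omega> \<in> NND"
  using lincomb_NND[OF info_op_NND[OF X(1) g] I0, of \<omega> 1 1] by simp

lemma J_PD: "\<omega> \<in> positive_measures X \<Longrightarrow> \<Psi> (J \<omega>) < \<infinity> \<Longrightarrow> J \<omega> \<in> PD"
  using design_criterion_PD_iff[OF \<Psi>] J_NND NND_subset_Sym by blast

lemma F_PD: "J \<omega> \<in> PD \<Longrightarrow> F \<omega> = ereal (real_of_ereal (\<Psi> (J \<omega>)) + \<beta> * tv_norm X \<omega>)"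
  unfolding objective_def psi_def by (subst design_criterion_real[OF \<Psi>]) auto

lemma F_finite_PD:
  assumes "\<omega> \<in> positive_measures X" "F \<omega> < \<infinity>"
  shows "J \<omega> \<in> PD"
  using assms by (intro J_PD) (auto simp: objective_def psi_def)

lemma F_ge_mass: "\<omega> \<in> positive_measures X \<Longrightarrow> ereal (\<beta> * tv_norm X \<omega>) \<le> F \<omega>"
  using add_right_mono[OF design_criterion_nonneg[OF \<Psi> J_NND], of \<omega> "ereal (\<beta> * tv_norm X \<omega>)"]
  by (simp add: objective_def psi_def)

lemma continuous_on_dpsi: "continuous_on X (d\<psi> \<omega>)"
  unfolding dpsi_def by (rule continuous_on_quadratic_form[OF g])

lemma pairing_dpsi: "\<nu> \<in> signed_measures X \<Longrightarrow> pairing X (d\<psi> \<omega>) \<nu> = \<Psi>' (J \<omega>) \<bullet> info_op X g \<nu>"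
  unfolding dpsi_def by (rule info_op_inner[OF X(1) g, symmetric])

lemma dpsi_eq_inner: "x \<in> X \<Longrightarrow> d\<psi> \<omega> x = \<Psi>' (J \<omega>) \<bullet> info_op X g (dirac X x)"
  using pairing_dpsi[OF positive_measures_signed[OF dirac_positive], of \<omega> x]
    pairing_dirac[OF continuous_on_dpsi, of x \<omega>] by simp

lemma segment_positive:
  assumes "\<omega> \<in> positive_measures X" "v \<in> positive_measures X" "0 \<le> s" "s \<le> 1"
  shows "(\<lambda>A. \<omega> A + s * (v A - \<omega> A)) \<in> positive_measures X"
    and "tv_norm X (\<lambda>A. \<omega> A + s * (v A - \<omega> A)) = (1 - s) * tv_norm X \<omega> + s * tv_norm X v"
proof -
  have eq: "(\<lambda>A. \<omega> A + s * (v A - \<omega> A)) = (\<lambda>A. (1 - s) * \<omega> A + s * v A)"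
    by (auto simp: algebra_simps)
  show pos: "(\<lambda>A. \<omega> A + s * (v A - \<omega> A)) \<in> positive_measures X"
    unfolding eq using assms by (intro positive_measures_lincomb) auto
  show "tv_norm X (\<lambda>A. \<omega> A + s * (v A - \<omega> A)) = (1 - s) * tv_norm X \<omega> + s * tv_norm X v"
    unfolding tv_norm_positive[OF pos] using assms by (simp add: tv_norm_positive algebra_simps)
qed

lemma J_segment:
  assumes "\<omega> \<in> positive_measures X" "v \<in> positive_measures X"
  shows "J (\<lambda>A. \<omega> A + s * (v A - \<omega> A)) = J \<omega> + s *\<^sub>R (J v - J \<omega>)"
proof -
  have eq: "(\<lambda>A. \<omega> A + s * (v A - \<omega> A)) = (\<lambda>A. (1 - s) * \<omega> A + s * v A)"
    by (auto simp: algebra_simps)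
  show ?thesis unfolding eq
    using info_op_lincomb[OF X(1) g positive_measures_signed[OF assms(1)] positive_measures_signed[OF assms(2)],
        of "1 - s" s]
    by (simp add: algebra_simps)
qed

subsection \<open>The primal-dual gap\<close>

text \<open>The measure \<open>v\<close> of \<open>insertion_step\<close> as a function of the iterate and the chosen point.\<close>

definition inserted :: "real \<Rightarrow> ('a set \<Rightarrow> real) \<Rightarrow> 'a \<Rightarrow> 'a set \<Rightarrow> real" where
  "inserted M0 \<omega> x = (\<lambda>A. (if d\<psi> \<omega> x \<ge> - \<beta> then 0 else - (M0 / \<beta>) * d\<psi> \<omega> x) * dirac X x A)"

lemma inserted_weight_nonneg:
  "0 < M0 \<Longrightarrow> 0 \<le> (if d\<psi> \<omega> x \<ge> - \<beta> then 0 else - (M0 / \<beta>) * d\<psi> \<omega> x)"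
proof (cases "d\<psi> \<omega> x \<ge> - \<beta>")
  case False
  assume "0 < M0"
  then have "0 \<le> - (M0 / \<beta>) * d\<psi> \<omega> x" using False \<beta> by (intro mult_nonpos_nonpos) auto
  then show ?thesis using False by simp
qed simp

lemma inserted_positive: "0 < M0 \<Longrightarrow> inserted M0 \<omega> x \<in> positive_measures X"
  using positive_measures_lincomb[OF dirac_positive dirac_positive inserted_weight_nonneg[of M0 \<omega> x] order_refl, of X x x]
  by (simp add: inserted_def)

lemma tv_norm_inserted:
  "0 < M0 \<Longrightarrow> x \<in> X \<Longrightarrow> tv_norm X (inserted M0 \<omega> x) = (if d\<psi> \<omega> x \<ge> - \<beta> then 0 else - (M0 / \<beta>) * d\<psi> \<omega> x)"
  by (subst tv_norm_positive[OF inserted_positive]) (auto simp: inserted_def dirac_def)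

text \<open>A competitor of mass \<open>t\<close> contributes at least \<open>t min d\<psi>\<close> to the pairing, with equality if it sits at a
  minimizer; what remains is the maximization of \<open>- t min d\<psi> - \<beta> phi M0 t\<close>.\<close>

lemma gap_attained:
  assumes \<omega>: "\<omega> \<in> positive_measures X" and M0: "0 < M0" and x: "is_arg_min (d\<psi> \<omega>) (\<lambda>y. y \<in> X) x"
  defines "v \<equiv> inserted M0 \<omega> x"
  shows "gap M0 \<omega> = \<Psi>' (J \<omega>) \<bullet> (J \<omega> - J v) + \<beta> * tv_norm X \<omega> - \<beta> * phi M0 (tv_norm X v)"
    and "\<And>u. u \<in> positive_measures X \<Longrightarrow>
      \<Psi>' (J \<omega>) \<bullet> (J \<omega> - J u) + \<beta> * tv_norm X \<omega> - \<beta> * phi M0 (tv_norm X u) \<le> gap M0 \<omega>"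
proof -
  have xX: "x \<in> X" and min: "\<And>y. y \<in> X \<Longrightarrow> d\<psi> \<omega> x \<le> d\<psi> \<omega> y"
    using x by (auto simp: is_arg_min_linorder)
  have v: "v \<in> positive_measures X" unfolding v_def by (rule inserted_positive[OF M0])
  let ?h = "\<lambda>u. pairing X (d\<psi> \<omega>) (\<lambda>A. \<omega> A - u A) + \<beta> * tv_norm X \<omega> - \<beta> * phi M0 (tv_norm X u)"
  have h: "?h u = \<Psi>' (J \<omega>) \<bullet> (J \<omega> - J u) + \<beta> * tv_norm X \<omega> - \<beta> * phi M0 (tv_norm X u)"
    and h': "?h u = pairing X (d\<psi> \<omega>) \<omega> + \<beta> * tv_norm X \<omega> + (- pairing X (d\<psi> \<omega>) u - \<beta> * phi M0 (tv_norm X u))"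
    if "u \<in> positive_measures X" for u
  proof -
    have s: "\<omega> \<in> signed_measures X" "u \<in> signed_measures X"
      using \<omega> that by (auto intro: positive_measures_signed)
    show "?h u = \<Psi>' (J \<omega>) \<bullet> (J \<omega> - J u) + \<beta> * tv_norm X \<omega> - \<beta> * phi M0 (tv_norm X u)"
      by (simp add: pairing_dpsi[OF signed_measures_diff[OF s]] info_op_diff[OF X(1) g s])
    show "?h u = pairing X (d\<psi> \<omega>) \<omega> + \<beta> * tv_norm X \<omega> + (- pairing X (d\<psi> \<omega>) u - \<beta> * phi M0 (tv_norm X u))"
      by (simp add: pairing_diff[OF X(1) continuous_on_dpsi s])
  qed
  have pv: "pairing X (d\<psi> \<omega>) v = tv_norm X v * d\<psi> \<omega> x"
    using pairing_lincomb[OF X(1) continuous_on_dpsi positive_measures_signed[OF dirac_positive]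
        positive_measures_signed[OF dirac_positive], of \<omega> "tv_norm X v" x 0 x]
      pairing_dirac[OF continuous_on_dpsi xX]
    unfolding v_def tv_norm_inserted[OF M0 xX] by (simp add: inserted_def)
  have le: "?h u \<le> ?h v" if u: "u \<in> positive_measures X" for u
  proof -
    have su: "u \<in> signed_measures X" using u by (rule positive_measures_signed)
    have "d\<psi> \<omega> x * tv_norm X u = pairing X (\<lambda>y. d\<psi> \<omega> x * 1 + 0 * 1) u"
      using pairing_add_fun[OF X(1) _ _ su, of "\<lambda>_. 1" "\<lambda>_. 1" "d\<psi> \<omega> x" 0]
      by (simp add: pairing_const_1[OF su] tv_norm_positive[OF u])
    also have "\<dots> \<le> pairing X (d\<psi> \<omega>) u"
      by (rule pairing_mono[OF X(1) _ continuous_on_dpsi u]) (use min in auto)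
    finally have "- pairing X (d\<psi> \<omega>) u - \<beta> * phi M0 (tv_norm X u)
        \<le> (- d\<psi> \<omega> x) * tv_norm X u - \<beta> * phi M0 (tv_norm X u)" by simp
    also have "\<dots> \<le> (- d\<psi> \<omega> x) * tv_norm X v - \<beta> * phi M0 (tv_norm X v)"
      using phi_maximizer[OF M0 \<beta> tv_norm_nonneg[OF su], of "- d\<psi> \<omega> x"]
      unfolding v_def tv_norm_inserted[OF M0 xX]
      by (cases "- \<beta> \<le> d\<psi> \<omega> x") (simp_all add: minus_le_iff)
    finally show ?thesis unfolding h'[OF u] h'[OF v] pv by (simp add: mult.commute)
  qed
  have sup: "gap M0 \<omega> = ?h v"
    unfolding primal_dual_gap_def
  proof (rule cSup_eq_maximum)
    show "?h v \<in> ?h ` positive_measures X" using v by blast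
    show "y \<le> ?h v" if "y \<in> ?h ` positive_measures X" for y using that le by blast
  qed
  then show "gap M0 \<omega> = \<Psi>' (J \<omega>) \<bullet> (J \<omega> - J v) + \<beta> * tv_norm X \<omega> - \<beta> * phi M0 (tv_norm X v)"
    using h[OF v] by simp
  show "\<Psi>' (J \<omega>) \<bullet> (J \<omega> - J u) + \<beta> * tv_norm X \<omega> - \<beta> * phi M0 (tv_norm X u) \<le> gap M0 \<omega>"
    if "u \<in> positive_measures X" for u
    using le[OF that] unfolding sup h[OF that, symmetric] .
qed

lemma dpsi_minimizer_exists: "\<exists>x. is_arg_min (d\<psi> \<omega>) (\<lambda>y. y \<in> X) x"
  using continuous_attains_inf[OF X continuous_on_dpsi, of \<omega>] by (auto simp: is_arg_min_linorder)

lemma gap_nonneg: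
  assumes "\<omega> \<in> positive_measures X" "0 < M0" "tv_norm X \<omega> \<le> M0"
  shows "0 \<le> gap M0 \<omega>"
proof -
  obtain x where "is_arg_min (d\<psi> \<omega>) (\<lambda>y. y \<in> X) x" using dpsi_minimizer_exists by blast
  from gap_attained(2)[OF assms(1,2) this assms(1)] show ?thesis using assms(3) by (simp add: phi_id)
qed

text \<open>Competitors of mass at most \<open>M0\<close> enter the gap with the true penalty and are handled by convexity; heavier
  ones already cost more than \<open>\<beta> M0\<close>.\<close>

lemma F_minus_gap_le:
  assumes \<omega>: "\<omega> \<in> positive_measures X" and M0: "0 < M0" and F\<omega>: "F \<omega> \<le> ereal (\<beta> * M0)"
    and \<nu>: "\<nu> \<in> positive_measures X"
  shows "F \<omega> - ereal (gap M0 \<omega>) \<le> F \<nu>"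
proof (cases "F \<nu> < \<infinity>")
  case False
  then show ?thesis by (simp add: less_top)
next
  case True
  have PD: "J \<omega> \<in> PD" using F\<omega> by (intro F_finite_PD[OF \<omega>]) (auto intro: le_less_trans)
  have mass: "tv_norm X \<omega> \<le> M0" using order_trans[OF F_ge_mass[OF \<omega>] F\<omega>] \<beta> by simp
  have PD\<nu>: "J \<nu> \<in> PD" using F_finite_PD[OF \<nu> True] .
  obtain x where x: "is_arg_min (d\<psi> \<omega>) (\<lambda>y. y \<in> X) x" using dpsi_minimizer_exists by blast
  show ?thesis
  proof (cases "tv_norm X \<nu> \<le> M0")
    case True
    have "\<Psi>' (J \<omega>) \<bullet> (J \<omega> - J \<nu>) + \<beta> * tv_norm X \<omega> - \<beta> * tv_norm X \<nu> \<le> gap M0 \<omega>"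
      using gap_attained(2)[OF \<omega> M0 x \<nu>] True by (simp add: phi_id)
    moreover have "real_of_ereal (\<Psi> (J \<omega>)) + \<Psi>' (J \<omega>) \<bullet> (J \<nu> - J \<omega>) \<le> real_of_ereal (\<Psi> (J \<nu>))"
      by (rule gradient_inequality[OF \<Psi> PD PD\<nu>])
    ultimately show ?thesis by (simp add: F_PD PD PD\<nu> inner_diff_right)
  next
    case False
    have "F \<omega> - ereal (gap M0 \<omega>) \<le> ereal (\<beta> * M0)"
      using F\<omega> gap_nonneg[OF \<omega> M0 mass] by (simp add: F_PD PD)
    also have "\<dots> \<le> ereal (\<beta> * tv_norm X \<nu>)" using False \<beta> by simp
    also have "\<dots> \<le> F \<nu>" by (rule F_ge_mass[OF \<nu>])
    finally show ?thesis .
  qed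
qed

subsection \<open>Step size and decrease\<close>

text \<open>\<open>sufficient_decrease\<close> applies along the segment to the inserted measure, with the convex upper bound
  \<open>(1 - s) tv_norm X \<omega> + s phi M0 (tv_norm X v)\<close> of the mass penalty, which is affine in \<open>s\<close>. As soon as
  the resulting bound is at most \<open>F \<omega>\<close>, it puts the measure on the segment into the sublevel set, where the derivative is Lipschitz; the distance
  of the end points is at most \<open>M0 + c\<close>.\<close>

lemma armijo_holds:
  assumes \<omega>: "\<omega> \<in> sublevel X g I0 \<Psi> \<beta> \<omega>1" and F1: "F \<omega>1 = ereal (\<beta> * M0)" and M0: "0 < M0"
    and x: "is_arg_min (d\<psi> \<omega>) (\<lambda>y. y \<in> X) x"
    and L: "0 < L" "dpsi_lipschitz X g I0 \<Psi>' (sublevel X g I0 \<Psi> \<beta> \<omega>1) L"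
    and c: "tv_norm X (inserted M0 \<omega> x) \<le> c" and \<alpha>: "0 < \<alpha>" and gap: "0 < gap M0 \<omega>"
    and s: "0 \<le> s" "s \<le> 1" "L * (M0 + c)\<^sup>2 * s \<le> 2 * (1 - \<alpha>) * gap M0 \<omega>"
  shows "armijo X g I0 \<Psi> \<Psi>' \<beta> M0 \<alpha> \<omega> (inserted M0 \<omega> x) s"
proof -
  define v where "v = inserted M0 \<omega> x"
  define D where "D = J v - J \<omega>"
  define e where "e = \<beta> * (phi M0 (tv_norm X v) - tv_norm X \<omega>)"
  define \<omega>s where "\<omega>s t = (\<lambda>A. \<omega> A + t * (v A - \<omega> A))" for t
  have pos: "\<omega> \<in> positive_measures X" and F\<omega>: "F \<omega> \<le> ereal (\<beta> * M0)"
    using \<omega> F1 by (auto simp: sublevel_def)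
  have v: "v \<in> positive_measures X" unfolding v_def by (rule inserted_positive[OF M0])
  have PD: "J \<omega> \<in> PD" using F\<omega> by (intro F_finite_PD[OF pos]) (auto intro: le_less_trans)
  have mass: "tv_norm X \<omega> \<le> M0" using order_trans[OF F_ge_mass[OF pos] F\<omega>] \<beta> by simp
  have sum: "tv_norm X v + tv_norm X \<omega> \<le> M0 + c" using mass c by (simp add: v_def)
  have sum0: "0 \<le> tv_norm X v + tv_norm X \<omega>"
    using v pos by (intro add_nonneg_nonneg tv_norm_nonneg positive_measures_signed)
  have gap_eq: "gap M0 \<omega> = - (\<Psi>' (J \<omega>) \<bullet> D) - e"
    using gap_attained(1)[OF pos M0 x] unfolding v_def[symmetric] D_def e_def
    by (simp add: inner_diff_right algebra_simps)
  have Js: "J (\<omega>s t) = J \<omega> + t *\<^sub>R D" for t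
    unfolding \<omega>s_def D_def by (rule J_segment[OF pos v])
  have \<omega>s_pos: "\<omega>s t \<in> positive_measures X"
    and \<omega>s_mass: "tv_norm X (\<omega>s t) = (1 - t) * tv_norm X \<omega> + t * tv_norm X v" if "0 \<le> t" "t \<le> 1" for t
    unfolding \<omega>s_def using segment_positive[OF pos v that] by auto
  have lip: "\<bar>\<Psi>' (J \<omega> + t *\<^sub>R D) \<bullet> D - \<Psi>' (J \<omega>) \<bullet> D\<bar> \<le> L * (M0 + c)\<^sup>2 * t"
    if t: "0 \<le> t" "t \<le> 1" and le: "\<Psi> (J \<omega> + t *\<^sub>R D) \<le> ereal (real_of_ereal (\<Psi> (J \<omega>)) - t * e)" for t
  proof -
    have "\<beta> * tv_norm X (\<omega>s t) \<le> \<beta> * ((1 - t) * tv_norm X \<omega> + t * phi M0 (tv_norm X v))"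
      unfolding \<omega>s_mass[OF t] using \<beta> t phi_ge[OF M0]
      by (intro mult_left_mono add_left_mono) auto
    also have "\<dots> = \<beta> * tv_norm X \<omega> + t * e" by (simp add: e_def algebra_simps)
    finally have "F (\<omega>s t) \<le> ereal (real_of_ereal (\<Psi> (J \<omega>)) - t * e) + ereal (\<beta> * tv_norm X \<omega> + t * e)"
      using le unfolding objective_def psi_def Js by (intro add_mono) auto
    also have "\<dots> = F \<omega>" by (simp add: F_PD[OF PD])
    finally have "\<omega>s t \<in> sublevel X g I0 \<Psi> \<beta> \<omega>1"
      using \<omega> \<omega>s_pos[OF t] by (auto simp: sublevel_def)
    then have "sup_norm X (\<lambda>y. d\<psi> (\<omega>s t) y - d\<psi> \<omega> y) \<le> L * tv_norm X (\<lambda>A. \<omega>s t A - \<omega> A)"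
      using L(2) \<omega> unfolding dpsi_lipschitz_def by blast
    also have "\<dots> = L * tv_norm X (\<lambda>A. t * (v A - \<omega> A))" by (simp add: \<omega>s_def)
    also have "\<dots> \<le> L * (t * (M0 + c))"
      using L(1) order_trans[OF tv_norm_scaled_diff_le[OF v pos t(1)] mult_left_mono[OF sum t(1)]]
      by (intro mult_left_mono) auto
    finally have sup: "sup_norm X (\<lambda>y. d\<psi> (\<omega>s t) y - d\<psi> \<omega> y) \<le> L * (t * (M0 + c))" .
    have cont: "continuous_on X (\<lambda>y. d\<psi> (\<omega>s t) y - d\<psi> \<omega> y)"
      by (intro continuous_intros continuous_on_dpsi)
    obtain b where b: "\<And>y. y \<in> X \<Longrightarrow> \<bar>d\<psi> (\<omega>s t) y - d\<psi> \<omega> y\<bar> \<le> b"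
      using continuous_on_compact_bounded[OF X(1) cont] by blast
    have bound: "\<bar>d\<psi> (\<omega>s t) y - d\<psi> \<omega> y\<bar> \<le> L * (t * (M0 + c))" if "y \<in> X" for y
    proof (rule order_trans[OF _ sup])
      show "\<bar>d\<psi> (\<omega>s t) y - d\<psi> \<omega> y\<bar> \<le> sup_norm X (\<lambda>y. d\<psi> (\<omega>s t) y - d\<psi> \<omega> y)"
        unfolding sup_norm_def using that b by (intro cSUP_upper) (auto intro!: bdd_aboveI2)
    qed
    have sd: "(\<lambda>A. v A - \<omega> A) \<in> signed_measures X"
      using v pos by (intro signed_measures_diff positive_measures_signed)
    have infoD: "info_op X g (\<lambda>A. v A - \<omega> A) = D"
      using info_op_diff[OF X(1) g positive_measures_signed[OF v] positive_measures_signed[OF pos]]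
      by (simp add: D_def)
    have "\<Psi>' (J \<omega> + t *\<^sub>R D) \<bullet> D - \<Psi>' (J \<omega>) \<bullet> D
        = pairing X (\<lambda>y. 1 * d\<psi> (\<omega>s t) y + (-1) * d\<psi> \<omega> y) (\<lambda>A. v A - \<omega> A)"
      unfolding pairing_add_fun[OF X(1) continuous_on_dpsi continuous_on_dpsi sd] pairing_dpsi[OF sd] infoD Js
      by simp
    also have "\<dots> = pairing X (\<lambda>y. d\<psi> (\<omega>s t) y - d\<psi> \<omega> y) (\<lambda>A. v A - \<omega> A)" by simp
    finally have "\<bar>\<Psi>' (J \<omega> + t *\<^sub>R D) \<bullet> D - \<Psi>' (J \<omega>) \<bullet> D\<bar> \<le> L * (t * (M0 + c)) * tv_norm X (\<lambda>A. v A - \<omega> A)"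
      using pairing_bound[OF X(1) cont sd bound] by simp
    also have "\<dots> \<le> L * (t * (M0 + c)) * (M0 + c)"
    proof (rule mult_left_mono)
      show "tv_norm X (\<lambda>A. v A - \<omega> A) \<le> M0 + c"
        using tv_norm_scaled_diff_le[OF v pos, of 1] sum by simp
      show "0 \<le> L * (t * (M0 + c))" using L(1) t(1) sum sum0 by simp
    qed
    also have "\<dots> = L * (M0 + c)\<^sup>2 * t" by (simp add: power2_eq_square mult_ac)
    finally show ?thesis .
  qed
  have "\<Psi> (J \<omega> + s *\<^sub>R (J v - J \<omega>))
      \<le> ereal (real_of_ereal (\<Psi> (J \<omega>)) - s * e - \<alpha> * s * gap M0 \<omega>)"
    by (rule sufficient_decrease[OF \<Psi> PD J_NND[OF v], of _ _ _ "L * (M0 + c)\<^sup>2"])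
      (use gap_eq gap \<alpha> L(1) s lip in \<open>auto simp: D_def\<close>)
  then have \<Psi>s: "\<Psi> (J (\<omega>s s)) \<le> ereal (real_of_ereal (\<Psi> (J \<omega>)) - s * e - \<alpha> * s * gap M0 \<omega>)"
    by (simp add: Js D_def)
  have "\<beta> * phi M0 (tv_norm X (\<omega>s s)) \<le> \<beta> * ((1 - s) * phi M0 (tv_norm X \<omega>) + s * phi M0 (tv_norm X v))"
    unfolding \<omega>s_mass[OF s(1,2)] using \<beta> phi_convex[OF M0 s(1,2)] by simp
  also have "\<dots> = \<beta> * tv_norm X \<omega> + s * e" using mass by (simp add: e_def phi_id algebra_simps)
  finally have mod: "objective_mod X g I0 \<Psi> \<beta> M0 (\<omega>s s)
      \<le> ereal (real_of_ereal (\<Psi> (J \<omega>)) - s * e - \<alpha> * s * gap M0 \<omega>) + ereal (\<beta> * tv_norm X \<omega> + s * e)"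
    using \<Psi>s unfolding objective_mod_def psi_def by (intro add_mono) auto
  have mod\<omega>: "objective_mod X g I0 \<Psi> \<beta> M0 \<omega> = ereal (real_of_ereal (\<Psi> (J \<omega>)) + \<beta> * tv_norm X \<omega>)"
    using F_PD[OF PD] mass by (simp add: objective_mod_def objective_def phi_id)
  show ?thesis
    unfolding armijo_def v_def[symmetric] \<omega>s_def[symmetric] mod\<omega>
    using mod by (cases "objective_mod X g I0 \<Psi> \<beta> M0 (\<omega>s s)") auto
qed

text \<open>The objective is nowhere above the modified one and agrees with it for mass at most \<open>M0\<close>, so the decrease
  granted by the line search holds for the objective itself; the removal can only lower it further.\<close>

lemma insertion_step_decrease:
  assumes \<omega>: "\<omega> \<in> positive_measures X" and F\<omega>: "F \<omega> \<le> ereal (\<beta> * M0)" and M0: "0 < M0"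
    and \<gamma>: "0 < \<gamma>" "\<gamma> < 1" and step: "insertion_step X g I0 \<Psi> \<Psi>' \<beta> M0 \<alpha> \<gamma> \<omega> x v m \<omega>'"
  shows "F \<omega>' \<le> F \<omega> - ereal (\<alpha> * \<gamma> ^ m * gap M0 \<omega>)"
    and "\<exists>P w. finite P \<and> P \<subseteq> X \<and> (\<forall>y\<in>P. 0 < w y) \<and> card P \<le> CARD('n) * (CARD('n) + 1) div 2 \<and>
      \<omega>' = atomic X P w"
proof -
  define s where "s = \<gamma> ^ m"
  define h where "h = (\<lambda>A. \<omega> A + s * (v A - \<omega> A))"
  have s: "0 \<le> s" "s \<le> 1" using \<gamma> by (auto simp: s_def power_le_one)
  have v: "v \<in> positive_measures X"
    using step inserted_positive[OF M0, of \<omega> x] by (simp add: insertion_step_def inserted_def)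
  have arm: "armijo X g I0 \<Psi> \<Psi>' \<beta> M0 \<alpha> \<omega> v s" and rem: "removal X g h \<omega>'"
    using step by (auto simp: insertion_step_def s_def h_def algebra_simps)
  have h: "h \<in> positive_measures X" unfolding h_def by (rule segment_positive(1)[OF \<omega> v s])
  note inv = removal_invariants[OF X(1) g rem]
  then obtain P w where P: "finite P" "P \<subseteq> X" "\<forall>y\<in>P. 0 < w y" "card P \<le> CARD('n) * (CARD('n) + 1) div 2"
    "\<omega>' = atomic X P w" by blast
  then show "\<exists>P w. finite P \<and> P \<subseteq> X \<and> (\<forall>y\<in>P. 0 < w y) \<and> card P \<le> CARD('n) * (CARD('n) + 1) div 2 \<and>
      \<omega>' = atomic X P w" by blast
  have pos': "\<omega>' \<in> positive_measures X" unfolding P(5) using P by (intro atomic_positive) (auto intro: less_imp_le)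
  have PD: "J \<omega> \<in> PD" using F\<omega> by (intro F_finite_PD[OF \<omega>]) (auto intro: le_less_trans)
  have mass: "tv_norm X \<omega> \<le> M0" using order_trans[OF F_ge_mass[OF \<omega>] F\<omega>] \<beta> by simp
  have mod\<omega>: "objective_mod X g I0 \<Psi> \<beta> M0 \<omega> = F \<omega>"
    using mass by (simp add: objective_mod_def objective_def phi_id)
  have "tv_norm X \<omega>' \<le> phi M0 (tv_norm X h)"
    using inv phi_ge[OF M0, of "h X"] by (simp add: tv_norm_positive[OF h] tv_norm_positive[OF pos'])
  then have "F \<omega>' \<le> objective_mod X g I0 \<Psi> \<beta> M0 h"
    unfolding objective_def objective_mod_def psi_def using inv \<beta> by (intro add_mono) auto
  also have "\<dots> \<le> F \<omega> - ereal (\<alpha> * s * gap M0 \<omega>)"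
    using arm unfolding armijo_def h_def[symmetric] mod\<omega> F_PD[OF PD]
    by (cases "objective_mod X g I0 \<Psi> \<beta> M0 h") auto
  finally show "F \<omega>' \<le> F \<omega> - ereal (\<alpha> * \<gamma> ^ m * gap M0 \<omega>)" by (simp add: s_def)
qed

text \<open>Either the full step is accepted or the previous trial step \<open>\<gamma> ^ (m - 1)\<close> was too long for the guarantee.\<close>

lemma step_size_bound:
  assumes \<omega>: "\<omega> \<in> sublevel X g I0 \<Psi> \<beta> \<omega>1" and F1: "F \<omega>1 = ereal (\<beta> * M0)" and M0: "0 < M0"
    and L: "0 < L" "dpsi_lipschitz X g I0 \<Psi>' (sublevel X g I0 \<Psi> \<beta> \<omega>1) L"
    and c: "0 < c" "tv_norm X v \<le> c" and \<alpha>: "0 < \<alpha>" and gap: "0 < gap M0 \<omega>" and \<gamma>: "0 < \<gamma>" "\<gamma> < 1"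
    and step: "insertion_step X g I0 \<Psi> \<Psi>' \<beta> M0 \<alpha> \<gamma> \<omega> x v m \<omega>'"
  shows "min 1 (2 * \<gamma> * (1 - \<alpha>) / (L * (M0 + c)\<^sup>2) * gap M0 \<omega>) \<le> \<gamma> ^ m"
proof (cases m)
  case (Suc j)
  have v: "v = inserted M0 \<omega> x" and x: "is_arg_min (d\<psi> \<omega>) (\<lambda>y. y \<in> X) x"
    and no: "\<not> armijo X g I0 \<Psi> \<Psi>' \<beta> M0 \<alpha> \<omega> v (\<gamma> ^ j)"
    using step Suc by (auto simp: insertion_step_def inserted_def)
  have "\<not> L * (M0 + c)\<^sup>2 * \<gamma> ^ j \<le> 2 * (1 - \<alpha>) * gap M0 \<omega>"
    using armijo_holds[OF \<omega> F1 M0 x L c(2)[unfolded v] \<alpha> gap, of "\<gamma> ^ j"] no \<gamma>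
    unfolding v by (auto simp: power_le_one)
  then have "\<gamma> * (2 * (1 - \<alpha>) * gap M0 \<omega>) \<le> \<gamma> * (L * (M0 + c)\<^sup>2 * \<gamma> ^ j)"
    using \<gamma> by (intro mult_left_mono) auto
  moreover have "0 < L * (M0 + c)\<^sup>2" using L(1) M0 c(1) by simp
  ultimately have "2 * \<gamma> * (1 - \<alpha>) / (L * (M0 + c)\<^sup>2) * gap M0 \<omega> \<le> \<gamma> ^ m"
    by (simp add: Suc field_simps)
  then show ?thesis by simp
qed simp

end

section \<open>Rate of convergence\<close>

text \<open>Since \<open>r\<close> decreases, the recursion gives \<open>a (k + 1) \<le> a k - q (a k)\<^sup>2\<close> for \<open>a k = r k / r 1\<close>, and
  \<open>y - q y\<^sup>2\<close> is increasing on \<open>[0, 1]\<close> because \<open>2 q \<le> 1\<close>.\<close>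

lemma sublinear_rate:
  fixes r :: "nat \<Rightarrow> real"
  assumes r0: "\<And>k. 1 \<le> k \<Longrightarrow> 0 \<le> r k"
    and rec: "\<And>k. 1 \<le> k \<Longrightarrow> r (k + 1) \<le> r k - \<alpha> * min 1 (\<kappa> * r k) * r k"
    and \<alpha>: "0 < \<alpha>" "\<alpha> \<le> 1 / 2" and \<kappa>: "0 < \<kappa>" and k: "1 \<le> k"
  defines "q \<equiv> \<alpha> * min (\<kappa> * r 1) 1"
  shows "r k \<le> r 1 / (1 + q * (real k - 1))"
proof -
  have q: "0 \<le> q" "2 * q \<le> 1"
  proof -
    show "0 \<le> q" using r0[of 1] \<alpha> \<kappa> by (simp add: q_def)
    have "q \<le> \<alpha> * 1" unfolding q_def using \<alpha> by (intro mult_left_mono) auto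
    then show "2 * q \<le> 1" using \<alpha> by simp
  qed
  have "r k \<le> r 1 \<and> r k \<le> r 1 / (1 + q * (real k - 1))"
    using k
  proof (induction k rule: dec_induct)
    case base
    then show ?case by simp
  next
    case (step k)
    have rk: "0 \<le> r k" "r k \<le> r 1" using step r0 by auto
    show ?case
    proof (cases "r 1 = 0")
      case True
      then have "r k = 0" using rk by simp
      then show ?thesis using rec[OF step.hyps(1)] True by simp
    next
      case False
      then have r1: "0 < r 1" using r0[of 1] by simp
      define a where "a = r k / r 1"
      define d where "d = 1 + q * (real k - 1)"
      have d: "1 \<le> d" using q step.hyps by (simp add: d_def)
      have a: "0 \<le> a" "a \<le> 1" "a \<le> 1 / d"
        using rk r1 step.IH by (auto simp: a_def d_def field_simps)
      have "q * a \<le> \<alpha> * min 1 (\<kappa> * r k)"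
      proof -
        have "min (\<kappa> * r 1) 1 * a \<le> min 1 (\<kappa> * r k)"
        proof (rule min.boundedI)
          have "min (\<kappa> * r 1) 1 * a \<le> 1 * a" using a by (intro mult_right_mono) auto
          then show "min (\<kappa> * r 1) 1 * a \<le> 1" using a by simp
          have "min (\<kappa> * r 1) 1 * a \<le> \<kappa> * r 1 * a" using a by (intro mult_right_mono) auto
          then show "min (\<kappa> * r 1) 1 * a \<le> \<kappa> * r k" using r1 by (simp add: a_def)
        qed
        then show ?thesis using \<alpha> by (simp add: q_def mult.assoc)
      qed
      then have "q * a * r k \<le> \<alpha> * min 1 (\<kappa> * r k) * r k" using rk by (intro mult_right_mono) auto
      then have dec: "r (k + 1) \<le> r k - q * a * r k" using rec[OF step.hyps(1)] by linarith
      have "r k - q * a * r k = r 1 * (a - q * a\<^sup>2)"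
      proof -
        have "r k = r 1 * a" using r1 by (simp add: a_def)
        then show ?thesis by (simp add: power2_eq_square algebra_simps)
      qed
      then have le: "r (k + 1) \<le> r 1 * (a - q * a\<^sup>2)" using dec by simp
      have mono: "a - q * a\<^sup>2 \<le> y - q * y\<^sup>2" if "a \<le> y" "y \<le> 1" for y
      proof -
        have "q * (y + a) \<le> q * 2" using that a q by (intro mult_left_mono) auto
        then have "0 \<le> (y - a) * (1 - q * (y + a))" using that q by (intro mult_nonneg_nonneg) auto
        then show ?thesis by (simp add: power2_eq_square algebra_simps)
      qed
      have "a - q * a\<^sup>2 \<le> 1 / d - q * (1 / d)\<^sup>2" by (rule mono) (use a d in auto)
      also have "\<dots> = (d - q) / d\<^sup>2" using d by (simp add: power2_eq_square field_simps)
      also have "\<dots> \<le> 1 / (d + q)"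
      proof -
        have "(d - q) * (d + q) \<le> d\<^sup>2" by (simp add: power2_eq_square algebra_simps)
        then show ?thesis using d q by (simp add: field_simps)
      qed
      finally have "r (k + 1) \<le> r 1 * (1 / (d + q))"
        using le r1 by (meson mult_left_mono order_trans less_imp_le)
      then have "r (Suc k) \<le> r 1 / (1 + q * (real (Suc k) - 1))"
        by (simp add: d_def algebra_simps)
      moreover have "r (Suc k) \<le> r 1"
      proof -
        have "0 \<le> q * a * r k" using q a rk by simp
        then show ?thesis using dec rk by simp
      qed
      ultimately show ?thesis by simp
    qed
  qed
  then show ?thesis by simp
qed

lemma rate_tendsto_0:
  fixes b q :: real
  assumes "0 \<le> q" "q = 0 \<Longrightarrow> b = 0"
  shows "(\<lambda>k. b / (1 + q * (real k - 1))) \<longlonglongrightarrow> 0"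
proof (cases "q = 0")
  case False
  then have q: "0 < q" using assms by simp
  have "filterlim (\<lambda>k. q * real k) at_top sequentially"
    by (rule filterlim_tendsto_pos_mult_at_top[OF tendsto_const q filterlim_real_sequentially])
  then have "filterlim (\<lambda>k. (1 - q) + q * real k) at_top sequentially"
    by (rule filterlim_tendsto_add_at_top[OF tendsto_const])
  then have "(\<lambda>k. b / ((1 - q) + q * real k)) \<longlonglongrightarrow> 0"
    by (rule tendsto_divide_0[OF tendsto_const filterlim_at_top_imp_at_infinity])
  then show ?thesis by (simp add: algebra_simps)
qed (use assms in simp)

section \<open>Constants on the sublevel set\<close>

context design_problem
begin

text \<open>On the sublevel set both \<open>\<Psi>\<close> and the mass are bounded, hence so are the information matrices.\<close>

lemma sublevel_info_compact:
  assumes F1: "F \<omega>1 = ereal (\<beta> * M0)"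
  obtains K where "compact K" "K \<subseteq> PD" "\<And>\<omega>. \<omega> \<in> sublevel X g I0 \<Psi> \<beta> \<omega>1 \<Longrightarrow> J \<omega> \<in> K"
proof -
  obtain C where C: "0 < C" "\<And>\<nu>. \<nu> \<in> signed_measures X \<Longrightarrow> norm (info_op X g \<nu>) \<le> C * tv_norm X \<nu>"
    using info_op_norm_le[OF X(1) g] by blast
  have "J \<omega> \<in> {A \<in> NND. \<Psi> A \<le> ereal (\<beta> * M0) \<and> norm A \<le> C * M0 + norm I0}"
    if \<omega>: "\<omega> \<in> sublevel X g I0 \<Psi> \<beta> \<omega>1" for \<omega>
  proof -
    have pos: "\<omega> \<in> positive_measures X" and F\<omega>: "F \<omega> \<le> ereal (\<beta> * M0)"
      using \<omega> F1 by (auto simp: sublevel_def)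
    have s: "\<omega> \<in> signed_measures X" using pos by (rule positive_measures_signed)
    have mass: "tv_norm X \<omega> \<le> M0" using order_trans[OF F_ge_mass[OF pos] F\<omega>] \<beta> by simp
    have "norm (J \<omega>) \<le> norm (info_op X g \<omega>) + norm I0" by (rule norm_triangle_ineq)
    also have "\<dots> \<le> C * M0 + norm I0"
      using C(2)[OF s] mult_left_mono[OF mass, of C] C(1) by linarith
    finally have "norm (J \<omega>) \<le> C * M0 + norm I0" .
    moreover have "\<Psi> (J \<omega>) \<le> F \<omega>"
      using \<beta> tv_norm_nonneg[OF s] add_left_mono[of 0 "ereal (\<beta> * tv_norm X \<omega>)" "\<Psi> (J \<omega>)"]
      by (simp add: objective_def psi_def)
    ultimately show ?thesis using F\<omega> J_NND[OF pos] by auto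
  qed
  then show ?thesis by (rule that[OF compact_sublevel[OF \<Psi>]])
qed

lemma info_op_norm_bounds:
  obtains C where "0 < C" "\<And>\<nu>. \<nu> \<in> signed_measures X \<Longrightarrow> norm (info_op X g \<nu>) \<le> C * tv_norm X \<nu>"
    and "\<And>y. y \<in> X \<Longrightarrow> norm (info_op X g (dirac X y)) \<le> C"
proof -
  obtain C where C: "0 < C" "\<And>\<nu>. \<nu> \<in> signed_measures X \<Longrightarrow> norm (info_op X g \<nu>) \<le> C * tv_norm X \<nu>"
    using info_op_norm_le[OF X(1) g] by blast
  have "norm (info_op X g (dirac X y)) \<le> C" if "y \<in> X" for y
    using C(2)[OF positive_measures_signed[OF dirac_positive[of X y]]] that
    by (simp add: tv_norm_positive[OF dirac_positive] dirac_def)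
  with C show ?thesis by (intro that[of C])
qed

text \<open>The derivative is composed of the information operator, the gradient \<open>\<Psi>'\<close>, which is Lipschitz on a compact set
  of information matrices, and a linear map.\<close>

lemma dpsi_lipschitz_exists:
  assumes F1: "F \<omega>1 = ereal (\<beta> * M0)"
  shows "\<exists>L>0. dpsi_lipschitz X g I0 \<Psi>' (sublevel X g I0 \<Psi> \<beta> \<omega>1) L"
proof -
  let ?E = "sublevel X g I0 \<Psi> \<beta> \<omega>1"
  obtain K where K: "compact K" "K \<subseteq> PD" "\<And>\<omega>. \<omega> \<in> ?E \<Longrightarrow> J \<omega> \<in> K"
    using sublevel_info_compact[OF F1] by blast
  obtain L where L: "L-lipschitz_on K \<Psi>'" using \<Psi> K(1,2) unfolding design_criterion_def by meson
  obtain C where C: "0 < C" "\<And>\<nu>. \<nu> \<in> signed_measures X \<Longrightarrow> norm (info_op X g \<nu>) \<le> C * tv_norm X \<nu>"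
    "\<And>y. y \<in> X \<Longrightarrow> norm (info_op X g (dirac X y)) \<le> C"
    using info_op_norm_bounds by blast
  have L0: "0 \<le> L" using L by (rule lipschitz_on_nonneg)
  have "sup_norm X (\<lambda>y. d\<psi> \<omega> y - d\<psi> \<nu> y) \<le> (L * C * C + 1) * tv_norm X (\<lambda>A. \<omega> A - \<nu> A)"
    if \<omega>: "\<omega> \<in> ?E" and \<nu>: "\<nu> \<in> ?E" for \<omega> \<nu>
  proof -
    have s: "\<omega> \<in> signed_measures X" "\<nu> \<in> signed_measures X"
      using \<omega> \<nu> by (auto simp: sublevel_def intro: positive_measures_signed)
    let ?t = "tv_norm X (\<lambda>A. \<omega> A - \<nu> A)"
    have t: "0 \<le> ?t" by (rule tv_norm_nonneg[OF signed_measures_diff[OF s]])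
    have "norm (J \<omega> - J \<nu>) \<le> C * ?t"
      using C(2)[OF signed_measures_diff[OF s]] by (simp add: info_op_diff[OF X(1) g s])
    moreover have "norm (\<Psi>' (J \<omega>) - \<Psi>' (J \<nu>)) \<le> L * norm (J \<omega> - J \<nu>)"
      using lipschitz_onD[OF L K(3)[OF \<omega>] K(3)[OF \<nu>]] by (simp add: dist_norm)
    ultimately have d: "norm (\<Psi>' (J \<omega>) - \<Psi>' (J \<nu>)) \<le> L * (C * ?t)"
      using mult_left_mono[OF _ L0] order_trans by blast
    have "\<bar>d\<psi> \<omega> y - d\<psi> \<nu> y\<bar> \<le> (L * C * C + 1) * ?t" if y: "y \<in> X" for y
    proof -
      have "\<bar>d\<psi> \<omega> y - d\<psi> \<nu> y\<bar> = \<bar>(\<Psi>' (J \<omega>) - \<Psi>' (J \<nu>)) \<bullet> info_op X g (dirac X y)\<bar>"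
        by (simp add: dpsi_eq_inner[OF y] inner_diff_left)
      also have "\<dots> \<le> norm (\<Psi>' (J \<omega>) - \<Psi>' (J \<nu>)) * norm (info_op X g (dirac X y))"
        by (rule Cauchy_Schwarz_ineq2)
      also have "\<dots> \<le> L * (C * ?t) * C"
        using d C(3)[OF y] L0 C(1) t by (intro mult_mono) auto
      also have "\<dots> \<le> (L * C * C + 1) * ?t" using t by (simp add: algebra_simps)
      finally show ?thesis .
    qed
    then show ?thesis unfolding sup_norm_def using X(2) by (intro cSUP_least)
  qed
  moreover have "0 < L * C * C + 1" using L0 C(1) by (intro add_nonneg_pos) auto
  ultimately show ?thesis unfolding dpsi_lipschitz_def by blast
qed

lemma inserted_bound_exists:
  assumes F1: "F \<omega>1 = ereal (\<beta> * M0)" and M0: "0 < M0"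
  shows "\<exists>c>0. \<forall>\<omega>\<in>sublevel X g I0 \<Psi> \<beta> \<omega>1. \<forall>y\<in>X. tv_norm X (inserted M0 \<omega> y) \<le> c"
proof -
  let ?E = "sublevel X g I0 \<Psi> \<beta> \<omega>1"
  obtain K where K: "compact K" "K \<subseteq> PD" "\<And>\<omega>. \<omega> \<in> ?E \<Longrightarrow> J \<omega> \<in> K"
    using sublevel_info_compact[OF F1] by blast
  have "continuous_on PD \<Psi>'" using \<Psi> by (simp add: design_criterion_def)
  then have "bounded (\<Psi>' ` K)"
    using K by (intro compact_imp_bounded compact_continuous_image) (auto intro: continuous_on_subset)
  then obtain b where b: "0 < b" "\<And>A. A \<in> K \<Longrightarrow> norm (\<Psi>' A) \<le> b" by (auto simp: bounded_pos)
  obtain C where C: "0 < C" "\<And>y. y \<in> X \<Longrightarrow> norm (info_op X g (dirac X y)) \<le> C"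
    using info_op_norm_bounds by metis
  have "tv_norm X (inserted M0 \<omega> y) \<le> M0 / \<beta> * (b * C)" if \<omega>: "\<omega> \<in> ?E" and y: "y \<in> X" for \<omega> y
  proof -
    have "\<bar>d\<psi> \<omega> y\<bar> \<le> norm (\<Psi>' (J \<omega>)) * norm (info_op X g (dirac X y))"
      unfolding dpsi_eq_inner[OF y] by (rule Cauchy_Schwarz_ineq2)
    also have "\<dots> \<le> b * C" using b(2)[OF K(3)[OF \<omega>]] C(2)[OF y] b(1) by (intro mult_mono) auto
    finally have d: "\<bar>d\<psi> \<omega> y\<bar> \<le> b * C" .
    have "tv_norm X (inserted M0 \<omega> y) \<le> M0 / \<beta> * \<bar>d\<psi> \<omega> y\<bar>"
    proof (cases "- \<beta> \<le> d\<psi> \<omega> y")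
      case False
      then have "\<bar>d\<psi> \<omega> y\<bar> = - d\<psi> \<omega> y" using \<beta> by simp
      with False show ?thesis unfolding tv_norm_inserted[OF M0 y] by simp
    qed (use M0 \<beta> in \<open>simp add: tv_norm_inserted[OF M0 y]\<close>)
    also have "\<dots> \<le> M0 / \<beta> * (b * C)" using M0 \<beta> by (intro mult_left_mono[OF d]) simp
    finally show ?thesis .
  qed
  moreover have "0 < M0 / \<beta> * (b * C)" using M0 \<beta> b(1) C(1) by simp
  ultimately show ?thesis by blast
qed

definition minF :: real where
  "minF = real_of_ereal (INF \<nu>\<in>positive_measures X. F \<nu>)"

lemma INF_F:
  assumes "\<omega> \<in> positive_measures X" "F \<omega> < \<infinity>"
  shows "(INF \<nu>\<in>positive_measures X. F \<nu>) = ereal minF"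
proof -
  have "0 \<le> F \<nu>" if "\<nu> \<in> positive_measures X" for \<nu>
    using F_ge_mass[OF that] \<beta> tv_norm_nonneg[OF positive_measures_signed[OF that]]
    by (metis ereal_less_eq(5) mult_nonneg_nonneg less_imp_le order_trans)
  then have "0 \<le> (INF \<nu>\<in>positive_measures X. F \<nu>)" by (intro INF_greatest)
  moreover have "(INF \<nu>\<in>positive_measures X. F \<nu>) \<le> F \<omega>" using assms(1) by (rule INF_lower)
  ultimately show ?thesis
    using assms(2) unfolding minF_def by (cases "INF \<nu>\<in>positive_measures X. F \<nu>") auto
qed

end

section \<open>The iterates\<close>

locale point_insertion_run = design_problem X g I0 \<Psi> \<Psi>' \<beta>
  for X :: "'a::metric_space set" and g :: "'a \<Rightarrow> real^'n" and I0 \<Psi> \<Psi>' \<beta> +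
  fixes M0 \<alpha> \<gamma> :: real and \<omega> v :: "nat \<Rightarrow> 'a set \<Rightarrow> real" and x :: "nat \<Rightarrow> 'a" and m :: "nat \<Rightarrow> nat"
  assumes \<gamma>: "0 < \<gamma>" "\<gamma> < 1" and \<alpha>: "0 < \<alpha>" "\<alpha> \<le> 1 / 2" and M0: "0 < M0"
    and start: "\<omega> 1 \<in> positive_measures X" and F1: "F (\<omega> 1) = ereal (\<beta> * M0)"
    and run: "point_insertion X g I0 \<Psi> \<Psi>' \<beta> M0 \<alpha> \<gamma> \<omega> x v m"
begin

abbreviation E :: "('a set \<Rightarrow> real) set" where "E \<equiv> sublevel X g I0 \<Psi> \<beta> (\<omega> 1)"

lemma E_positive: "\<nu> \<in> E \<Longrightarrow> \<nu> \<in> positive_measures X"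
  and E_F_le: "\<nu> \<in> E \<Longrightarrow> F \<nu> \<le> ereal (\<beta> * M0)"
  using F1 by (auto simp: sublevel_def)

lemma E_mass: "\<nu> \<in> E \<Longrightarrow> tv_norm X \<nu> \<le> M0"
  using order_trans[OF F_ge_mass[OF E_positive] E_F_le] \<beta> by simp

lemma E_gap_nonneg: "\<nu> \<in> E \<Longrightarrow> 0 \<le> gap M0 \<nu>"
  using gap_nonneg[OF E_positive M0 E_mass] .

lemma run_step: "1 \<le> k \<Longrightarrow> 0 < gap M0 (\<omega> k) \<Longrightarrow>
    insertion_step X g I0 \<Psi> \<Psi>' \<beta> M0 \<alpha> \<gamma> (\<omega> k) (x k) (v k) (m k) (\<omega> (k + 1))"
  and run_stop: "1 \<le> k \<Longrightarrow> gap M0 (\<omega> k) = 0 \<Longrightarrow> \<omega> (k + 1) = \<omega> k"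
  using run unfolding point_insertion_def by blast+

text \<open>The start has few support points but is not written as an atomic measure, and an algorithm that stops at once
  never rewrites it; so it is listed separately.\<close>

lemma iterates:
  assumes "1 \<le> k"
  shows "\<omega> k \<in> E \<and> \<omega> k \<in> insert (\<omega> 1) (few_atoms X (CARD('n) * (CARD('n) + 1) div 2) M0)"
  using assms
proof (induction k rule: dec_induct)
  case base
  then show ?case using start by (simp add: sublevel_def)
next
  case (step k)
  then have k: "\<omega> k \<in> E" by simp
  show ?case
  proof (cases "gap M0 (\<omega> k) = 0")
    case True
    then show ?thesis using run_stop[OF step.hyps(1)] step.IH by simp
  next
    case False
    then have gap: "0 < gap M0 (\<omega> k)" using E_gap_nonneg[OF k] by simp
    note dec = insertion_step_decrease[OF E_positive[OF k] E_F_le[OF k] M0 \<gamma> run_step[OF step.hyps(1) gap]]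
    obtain P w where P: "finite P" "P \<subseteq> X" "\<forall>y\<in>P. 0 < w y" "card P \<le> (CARD('n) * (CARD('n) + 1) div 2)" "\<omega> (k + 1) = atomic X P w"
      using dec(2) by blast
    have pos: "\<omega> (k + 1) \<in> positive_measures X"
      unfolding P(5) using P by (intro atomic_positive) (auto intro: less_imp_le)
    have "F (\<omega> (k + 1)) \<le> F (\<omega> k) - ereal (\<alpha> * \<gamma> ^ m k * gap M0 (\<omega> k))" by (rule dec(1))
    also have "\<dots> \<le> F (\<omega> k)"
      using \<alpha> \<gamma> gap by (intro ereal_diff_le_self) auto
    finally have E: "\<omega> (k + 1) \<in> E" using k pos by (auto simp: sublevel_def)
    have "w y \<le> M0" if y: "y \<in> P" for y
    proof -
      have "w y \<le> (\<Sum>y\<in>P. w y)" using P y by (intro member_le_sum) (auto intro: less_imp_le)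
      also have "\<dots> = tv_norm X (\<omega> (k + 1))"
        unfolding tv_norm_positive[OF pos] using P by (simp add: atomic_whole)
      also have "\<dots> \<le> M0" by (rule E_mass[OF E])
      finally show ?thesis .
    qed
    then have "\<omega> (k + 1) \<in> few_atoms X (CARD('n) * (CARD('n) + 1) div 2) M0"
      unfolding P(5) using P M0 X(2) by (intro atomic_in_few_atoms) (auto intro: less_imp_le)
    then show ?thesis using E by simp
  qed
qed

definition r :: "nat \<Rightarrow> real" where
  "r k = real_of_ereal (F (\<omega> k)) - minF"

lemma F_iterate:
  assumes "1 \<le> k"
  shows "F (\<omega> k) = ereal (r k + minF)"
proof -
  have E: "\<omega> k \<in> E" using iterates[OF assms] by simp
  have "0 \<le> F (\<omega> k)"
    using F_ge_mass[OF E_positive[OF E]] \<beta> tv_norm_nonneg[OF positive_measures_signed[OF E_positive[OF E]]]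
    by (metis ereal_less_eq(5) mult_nonneg_nonneg less_imp_le order_trans)
  then show ?thesis using E_F_le[OF E] unfolding r_def by (cases "F (\<omega> k)") auto
qed

lemma INF_eq: "(INF \<nu>\<in>positive_measures X. F \<nu>) = ereal minF"
  by (rule INF_F[OF start]) (unfold F1, simp)

lemma minF_le: "\<nu> \<in> positive_measures X \<Longrightarrow> ereal minF \<le> F \<nu>"
  unfolding INF_eq[symmetric] by (rule INF_lower)

lemma residual_iterate: "1 \<le> k \<Longrightarrow> residual X g I0 \<Psi> \<beta> (\<omega> k) = ereal (r k)"
  unfolding residual_def INF_eq by (simp add: F_iterate)

lemma r_nonneg: "1 \<le> k \<Longrightarrow> 0 \<le> r k"
  using minF_le[OF E_positive, of "\<omega> k"] iterates[of k] by (simp add: F_iterate)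

lemma r_le_gap:
  assumes k: "1 \<le> k"
  shows "r k \<le> gap M0 (\<omega> k)"
proof -
  have E: "\<omega> k \<in> E" using iterates[OF k] by simp
  have "F (\<omega> k) - ereal (gap M0 (\<omega> k)) \<le> (INF \<nu>\<in>positive_measures X. F \<nu>)"
    by (intro INF_greatest F_minus_gap_le E_positive[OF E] M0 E_F_le[OF E])
  then show ?thesis unfolding INF_eq by (simp add: F_iterate[OF k])
qed

text \<open>The decrease is \<open>\<alpha>\<close> times step size times gap. The step size is bounded below by a function of the gap,
  and the gap by the residual.\<close>

lemma r_recursion:
  assumes L: "0 < L" "dpsi_lipschitz X g I0 \<Psi>' E L"
    and c: "0 < c" "inserted_bounded X g I0 \<Psi>' \<beta> M0 \<omega> v c" and k: "1 \<le> k"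
  defines "\<kappa> \<equiv> 2 * \<gamma> * (1 - \<alpha>) / (L * (M0 + c)\<^sup>2)"
  shows "r (k + 1) \<le> r k - \<alpha> * min 1 (\<kappa> * r k) * r k"
proof (cases "gap M0 (\<omega> k) = 0")
  case True
  then have "r k = 0" using r_le_gap[OF k] r_nonneg[OF k] by simp
  moreover have "r (k + 1) = r k" using run_stop[OF k True] by (simp add: r_def)
  ultimately show ?thesis by simp
next
  case False
  have E: "\<omega> k \<in> E" using iterates[OF k] by simp
  have gap: "0 < gap M0 (\<omega> k)" using False E_gap_nonneg[OF E] by simp
  note step = run_step[OF k gap]
  have vc: "tv_norm X (v k) \<le> c" using c(2) k gap by (simp add: inserted_bounded_def)
  have \<kappa>: "0 \<le> \<kappa>" using L(1) \<gamma> \<alpha> by (simp add: \<kappa>_def)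
  have "min 1 (\<kappa> * gap M0 (\<omega> k)) \<le> \<gamma> ^ m k"
    unfolding \<kappa>_def by (rule step_size_bound[OF E F1 M0 L c(1) vc \<alpha>(1) gap \<gamma> step])
  moreover have "min 1 (\<kappa> * r k) \<le> min 1 (\<kappa> * gap M0 (\<omega> k))"
    using mult_left_mono[OF r_le_gap[OF k] \<kappa>] by (simp add: min_def)
  ultimately have s: "min 1 (\<kappa> * r k) \<le> \<gamma> ^ m k" by linarith
  have "min 1 (\<kappa> * r k) * r k \<le> \<gamma> ^ m k * gap M0 (\<omega> k)"
    using s r_le_gap[OF k] r_nonneg[OF k] \<gamma> by (intro mult_mono) auto
  then have "\<alpha> * min 1 (\<kappa> * r k) * r k \<le> \<alpha> * \<gamma> ^ m k * gap M0 (\<omega> k)"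
    using \<alpha> by (simp add: mult.assoc)
  moreover have "F (\<omega> (k + 1)) \<le> F (\<omega> k) - ereal (\<alpha> * \<gamma> ^ m k * gap M0 (\<omega> k))"
    by (rule insertion_step_decrease(1)[OF E_positive[OF E] E_F_le[OF E] M0 \<gamma> step])
  then have "r (k + 1) \<le> r k - \<alpha> * \<gamma> ^ m k * gap M0 (\<omega> k)"
    using F_iterate[OF k] F_iterate[of "k + 1"] by simp
  ultimately show ?thesis by linarith
qed

lemma residual_rate:
  assumes L: "0 < L" "dpsi_lipschitz X g I0 \<Psi>' E L"
    and c: "0 < c" "inserted_bounded X g I0 \<Psi>' \<beta> M0 \<omega> v c" and k: "1 \<le> k"
  shows "r k \<le> r 1 / (1 + \<alpha> * min (2 * \<gamma> * (1 - \<alpha>) / (L * (M0 + c)\<^sup>2) * r 1) 1 * (real k - 1))"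
proof (rule sublinear_rate[where r=r, OF r_nonneg r_recursion[OF L c] \<alpha> _ k])
  show "0 < 2 * \<gamma> * (1 - \<alpha>) / (L * (M0 + c)\<^sup>2)" using L(1) c(1) M0 \<gamma> \<alpha> by simp
qed

lemma inserted_bounded_exists: "\<exists>c>0. inserted_bounded X g I0 \<Psi>' \<beta> M0 \<omega> v c"
proof -
  obtain c where c: "0 < c" "\<And>\<nu> y. \<nu> \<in> E \<Longrightarrow> y \<in> X \<Longrightarrow> tv_norm X (inserted M0 \<nu> y) \<le> c"
    using inserted_bound_exists[OF F1 M0] by blast
  have "tv_norm X (v k) \<le> c" if k: "1 \<le> k" and gap: "0 < gap M0 (\<omega> k)" for k
  proof -
    have "v k = inserted M0 (\<omega> k) (x k)" "x k \<in> X"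
      using run_step[OF k gap] by (auto simp: insertion_step_def inserted_def is_arg_min_def)
    then show ?thesis using c(2) iterates[OF k] by simp
  qed
  then show ?thesis using c(1) unfolding inserted_bounded_def by blast
qed

lemma r_tendsto_0: "r \<longlonglongrightarrow> 0"
proof -
  obtain L where L: "0 < L" "dpsi_lipschitz X g I0 \<Psi>' E L" using dpsi_lipschitz_exists[OF F1] by blast
  obtain c where c: "0 < c" "inserted_bounded X g I0 \<Psi>' \<beta> M0 \<omega> v c" using inserted_bounded_exists by blast
  define \<kappa> where "\<kappa> = 2 * \<gamma> * (1 - \<alpha>) / (L * (M0 + c)\<^sup>2)"
  have \<kappa>: "0 < \<kappa>" using L(1) c(1) M0 \<gamma> \<alpha> by (simp add: \<kappa>_def)
  define q where "q = \<alpha> * min (\<kappa> * r 1) 1"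
  have "0 \<le> q" "q = 0 \<Longrightarrow> r 1 = 0" using \<alpha> \<kappa> r_nonneg[of 1] by (auto simp: q_def min_def split: if_splits)
  then have lim: "(\<lambda>k. r 1 / (1 + q * (real k - 1))) \<longlonglongrightarrow> 0" by (rule rate_tendsto_0)
  show ?thesis
  proof (rule tendsto_sandwich[OF _ _ tendsto_const lim])
    show "eventually (\<lambda>k. 0 \<le> r k) sequentially"
      using r_nonneg by (auto simp: eventually_sequentially)
    show "eventually (\<lambda>k. r k \<le> r 1 / (1 + q * (real k - 1))) sequentially"
      using residual_rate[OF L c] unfolding q_def \<kappa>_def by (auto simp: eventually_sequentially)
  qed
qed

lemma compactin_iterates: "compactin (weak_star X) (insert (\<omega> 1) (few_atoms X (CARD('n) * (CARD('n) + 1) div 2) M0))"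
proof -
  have "compactin (weak_star X) {\<omega> 1}"
    using positive_measures_signed[OF start] by simp
  from compactin_Un[OF this compactin_few_atoms[OF X(1), of "CARD('n) * (CARD('n) + 1) div 2" M0]] show ?thesis by simp
qed

lemma accumulation_point_mem:
  "weak_star_accumulation_point X \<omega> \<nu> \<Longrightarrow> \<nu> \<in> insert (\<omega> 1) (few_atoms X (CARD('n) * (CARD('n) + 1) div 2) M0)"
  by (rule accumulation_point_in_compact[OF X(1) compactin_iterates]) (use iterates in auto)

text \<open>The objective is a lower semicontinuous function of the information matrix and the mass, that is, of
  finitely many pairings with continuous functions.\<close>

lemma accumulation_point_optimal:
  assumes \<nu>: "weak_star_accumulation_point X \<omega> \<nu>"
  shows "optimal_solution X g I0 \<Psi> \<beta> \<nu>"
proof -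
  have pos: "\<nu> \<in> positive_measures X"
    using accumulation_point_mem[OF \<nu>] few_atoms_positive start by blast
  define fs where "fs = insert (\<lambda>y. 1) (range (\<lambda>(k, l) y. g y $ k * g y $ l))"
  have "finite fs" unfolding fs_def by simp
  moreover have "continuous_on X f" if "f \<in> fs" for f
    using that continuous_on_entry_product[OF g] by (auto simp: fs_def)
  ultimately obtain \<rho> where \<rho>: "\<And>j. j \<le> \<rho> j"
    "\<And>j f. f \<in> fs \<Longrightarrow> \<bar>pairing X f (\<omega> (\<rho> j)) - pairing X f \<nu>\<bar> < inverse (real (Suc j))"
    using accumulation_point_approx[OF \<nu>, of fs] by blast
  define \<sigma> where "\<sigma> j = \<omega> (\<rho> (Suc j))" for j
  have \<rho>1: "1 \<le> \<rho> (Suc j)" for j using \<rho>(1)[of "Suc j"] by linarith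
  have E: "\<sigma> j \<in> E" for j using iterates[OF \<rho>1] by (simp add: \<sigma>_def)
  have conv: "(\<lambda>j. pairing X f (\<sigma> j)) \<longlonglongrightarrow> pairing X f \<nu>" if "f \<in> fs" for f
  proof -
    have "(\<lambda>j. pairing X f (\<sigma> j) - pairing X f \<nu>) \<longlonglongrightarrow> 0"
    proof (rule tendsto_rabs_zero_cancel, rule tendsto_sandwich[OF _ _ tendsto_const])
      show "eventually (\<lambda>j. 0 \<le> \<bar>pairing X f (\<sigma> j) - pairing X f \<nu>\<bar>) sequentially" by simp
      show "eventually (\<lambda>j. \<bar>pairing X f (\<sigma> j) - pairing X f \<nu>\<bar> \<le> inverse (real (Suc (Suc j)))) sequentially"
        unfolding \<sigma>_def by (intro always_eventually allI less_imp_le \<rho>(2)[OF that])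
      show "(\<lambda>j. inverse (real (Suc (Suc j)))) \<longlonglongrightarrow> 0"
        by (rule LIMSEQ_Suc[OF LIMSEQ_inverse_real_of_nat])
    qed
    then show ?thesis by (simp add: LIM_zero_iff)
  qed
  have "(\<lambda>j. pairing X (\<lambda>y. 1) (\<sigma> j)) \<longlonglongrightarrow> pairing X (\<lambda>y. 1) \<nu>"
    by (rule conv) (simp add: fs_def)
  then have mass: "(\<lambda>j. tv_norm X (\<sigma> j)) \<longlonglongrightarrow> tv_norm X \<nu>"
    using E_positive[OF E] pos by (simp add: tv_norm_positive pairing_const_1 positive_measures_signed)
  have "(\<lambda>j. pairing X (\<lambda>y. g y $ k * g y $ l) (\<sigma> j)) \<longlonglongrightarrow> pairing X (\<lambda>y. g y $ k * g y $ l) \<nu>" for k l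
    by (rule conv) (force simp: fs_def)
  then have "(\<lambda>j. info_op X g (\<sigma> j)) \<longlonglongrightarrow> info_op X g \<nu>"
    by (intro vec_tendstoI) (simp add: info_op_def)
  then have J: "(\<lambda>j. J (\<sigma> j)) \<longlonglongrightarrow> J \<nu>" by (intro tendsto_intros)
  have "filterlim (\<lambda>j. \<rho> (Suc j)) at_top sequentially"
    by (rule filterlim_at_top_mono[OF filterlim_Suc]) (use \<rho>(1) in \<open>auto intro!: always_eventually\<close>)
  from filterlim_compose[OF r_tendsto_0 this]
  have r: "(\<lambda>j. r (\<rho> (Suc j))) \<longlonglongrightarrow> 0" .
  have "\<Psi> (J \<nu>) \<le> ereal (0 + minF - \<beta> * tv_norm X \<nu>)"
  proof (rule design_criterion_lsc[OF \<Psi> J_NND[OF E_positive[OF E]] J])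
    fix j
    have PD: "J (\<sigma> j) \<in> PD"
      by (rule F_finite_PD[OF E_positive[OF E] le_less_trans[OF E_F_le[OF E]]]) simp
    have "F (\<sigma> j) = ereal (r (\<rho> (Suc j)) + minF)" unfolding \<sigma>_def by (rule F_iterate[OF \<rho>1])
    then show "\<Psi> (J (\<sigma> j)) \<le> ereal (r (\<rho> (Suc j)) + minF - \<beta> * tv_norm X (\<sigma> j))"
      unfolding F_PD[OF PD] by (subst design_criterion_real[OF \<Psi> PD]) simp
  next
    show "(\<lambda>j. r (\<rho> (Suc j)) + minF - \<beta> * tv_norm X (\<sigma> j)) \<longlonglongrightarrow> 0 + minF - \<beta> * tv_norm X \<nu>"
      by (intro tendsto_intros r mass)
  qed
  then have "F \<nu> \<le> ereal (0 + minF - \<beta> * tv_norm X \<nu>) + ereal (\<beta> * tv_norm X \<nu>)"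
    unfolding objective_def psi_def by (intro add_mono) auto
  then have "F \<nu> \<le> ereal minF" by simp
  then have "F \<nu> \<le> F \<mu>" if "\<mu> \<in> positive_measures X" for \<mu>
    using minF_le[OF that] by (rule order_trans)
  then show ?thesis
    unfolding optimal_solution_def is_arg_min_def using pos by (auto simp: not_less)
qed

end

theorem proposition4p9:
  fixes \<Omega> X :: "(real^'d) set"
    and Qad U :: "(real^'n) set" and qhat :: "real^'n"
    and S :: "real^'n \<Rightarrow> real^'d \<Rightarrow> real" and DS :: "real^'n \<Rightarrow> real^'d \<Rightarrow> real^'n"
    and I0 :: "real^'n^'n"
    and \<Psi> :: "real^'n^'n \<Rightarrow> ereal" and \<Psi>' :: "real^'n^'n \<Rightarrow> real^'n^'n"
    and \<beta> \<alpha> \<gamma> M0 r1 :: real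
    and \<omega> v :: "nat \<Rightarrow> (real^'d) set \<Rightarrow> real" and x :: "nat \<Rightarrow> real^'d" and m :: "nat \<Rightarrow> nat"
  defines "g \<equiv> DS qhat"
  assumes "open \<Omega>" "connected \<Omega>" "\<Omega> \<noteq> {}" "bounded \<Omega>"
    and "X \<subseteq> closure \<Omega>" "closed X" "X \<noteq> {}"
    and "open U" "Qad \<subseteq> U" "C1_into_C X U S DS" "qhat \<in> Qad"
    and "I0 \<in> NND" "0 < \<beta>"
    and "design_criterion \<Psi> \<Psi>'"
    and "0 < \<gamma>" "\<gamma> < 1" "0 < \<alpha>" "\<alpha> \<le> 1/2"
    and "\<omega> 1 \<in> dom_psi X g I0 \<Psi>"
    and "finite (supp X (\<omega> 1))" "card (supp X (\<omega> 1)) \<le> CARD('n) * (CARD('n) + 1) div 2"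
    and "M0 = real_of_ereal (objective X g I0 \<Psi> \<beta> (\<omega> 1)) / \<beta>" "0 < M0"
    and "point_insertion X g I0 \<Psi> \<Psi>' \<beta> M0 \<alpha> \<gamma> \<omega> x v m"
    and "r1 = real_of_ereal (residual X g I0 \<Psi> \<beta> (\<omega> 1))"
  shows
    "(\<exists>\<nu>. weak_star_accumulation_point X \<omega> \<nu>) \<and>
     (\<forall>\<nu>. weak_star_accumulation_point X \<omega> \<nu> \<longrightarrow> optimal_solution X g I0 \<Psi> \<beta> \<nu>) \<and>
     (\<exists>L>0. dpsi_lipschitz X g I0 \<Psi>' (sublevel X g I0 \<Psi> \<beta> (\<omega> 1)) L) \<and>
     (\<exists>c>0. inserted_bounded X g I0 \<Psi>' \<beta> M0 \<omega> v c) \<and>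
     (\<forall>L>0. \<forall>c>0.
        dpsi_lipschitz X g I0 \<Psi>' (sublevel X g I0 \<Psi> \<beta> (\<omega> 1)) L \<and>
        inserted_bounded X g I0 \<Psi>' \<beta> M0 \<omega> v c \<longrightarrow>
        (let q = \<alpha> * min (2 * \<gamma> * (1 - \<alpha>) * r1 / (L * (M0 + c)\<^sup>2)) 1
         in \<forall>k\<ge>1. residual X g I0 \<Psi> \<beta> (\<omega> k) \<le> ereal (r1 / (1 + q * (real k - 1))))) \<and>
     (\<forall>k\<ge>1. finite (supp X (\<omega> k)) \<and> card (supp X (\<omega> k)) \<le> CARD('n) * (CARD('n) + 1) div 2) \<and>
     (\<forall>\<nu>. weak_star_accumulation_point X \<omega> \<nu> \<longrightarrow>
        finite (supp X \<nu>) \<and> card (supp X \<nu>) \<le> CARD('n) * (CARD('n) + 1) div 2)"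
proof -
  have "bounded X" using bounded_subset[OF bounded_closure[OF assms(5)] assms(6)] .
  then have X: "compact X" using assms(7) by (simp add: compact_eq_bounded_closed)
  have g: "continuous_on X g"
    using assms(10-12) unfolding g_def C1_into_C_def by blast
  interpret design_problem X g I0 \<Psi> \<Psi>' \<beta>
    using X assms(8) g assms(13-15) by unfold_locales auto
  have start: "\<omega> 1 \<in> positive_measures X" "\<Psi> (J (\<omega> 1)) < \<infinity>"
    using assms(20) by (auto simp: dom_psi_def psi_def)
  have F1: "F (\<omega> 1) = ereal (\<beta> * M0)"
    using F_PD[OF J_PD[OF start]] \<beta> assms(23) by simp
  interpret point_insertion_run X g I0 \<Psi> \<Psi>' \<beta> M0 \<alpha> \<gamma> \<omega> v x m
    using assms(16-19,24,25) start(1) F1 by unfold_locales auto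
  have r1: "r1 = r 1" using assms(26) residual_iterate[of 1] by simp
  have few: "finite (supp X \<nu>) \<and> card (supp X \<nu>) \<le> (CARD('n) * (CARD('n) + 1) div 2)"
    if "\<nu> \<in> insert (\<omega> 1) (few_atoms X (CARD('n) * (CARD('n) + 1) div 2) M0)" for \<nu>
    using that assms(21,22) few_atoms_supp by blast
  have rate: "residual X g I0 \<Psi> \<beta> (\<omega> k)
      \<le> ereal (r1 / (1 + \<alpha> * min (2 * \<gamma> * (1 - \<alpha>) * r1 / (L * (M0 + c)\<^sup>2)) 1 * (real k - 1)))"
    if "0 < L" "0 < c" "dpsi_lipschitz X g I0 \<Psi>' E L" "inserted_bounded X g I0 \<Psi>' \<beta> M0 \<omega> v c" "1 \<le> k" for L c k
    using residual_rate[OF that(1,3,2,4,5)] unfolding residual_iterate[OF that(5)] r1 by simp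
  show ?thesis
    unfolding Let_def
  proof (intro conjI allI impI)
    show "\<exists>\<nu>. weak_star_accumulation_point X \<omega> \<nu>"
      using iterates by (intro accumulation_point_exists[OF compactin_iterates]) simp
    show "optimal_solution X g I0 \<Psi> \<beta> \<nu>" if "weak_star_accumulation_point X \<omega> \<nu>" for \<nu>
      using that by (rule accumulation_point_optimal)
    show "\<exists>L>0. dpsi_lipschitz X g I0 \<Psi>' E L" by (rule dpsi_lipschitz_exists[OF F1])
    show "\<exists>c>0. inserted_bounded X g I0 \<Psi>' \<beta> M0 \<omega> v c" by (rule inserted_bounded_exists)
    show "residual X g I0 \<Psi> \<beta> (\<omega> k)
        \<le> ereal (r1 / (1 + \<alpha> * min (2 * \<gamma> * (1 - \<alpha>) * r1 / (L * (M0 + c)\<^sup>2)) 1 * (real k - 1)))"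
      if "0 < L" "0 < c" "dpsi_lipschitz X g I0 \<Psi>' E L \<and> inserted_bounded X g I0 \<Psi>' \<beta> M0 \<omega> v c" "1 \<le> k"
      for L c k
      using that by (intro rate) auto
    show "finite (supp X (\<omega> k))" "card (supp X (\<omega> k)) \<le> CARD('n) * (CARD('n) + 1) div 2" if "1 \<le> k" for k
      using few[OF conjunct2[OF iterates[OF that]]] by auto
    show "finite (supp X \<nu>)" "card (supp X \<nu>) \<le> CARD('n) * (CARD('n) + 1) div 2"
      if "weak_star_accumulation_point X \<omega> \<nu>" for \<nu>
      using few[OF accumulation_point_mem[OF that]] by auto
  qed
qed

end
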